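(* Let $\xi_1,\dots,\xi_n$ be independent real random variables with $\mathbf{E}\xi_i=0$, satisfying Bernstein's condition: there is a constant $\varepsilon>0$ such that $|\mathbf{E}\xi_i^k|\le \frac12 k!\,\varepsilon^{k-2}\mathbf{E}\xi_i^2$ for all $k\ge 3$ and $i=1,\dots,n$. Let $S_n=\sum_{i=1}^n\xi_i$ and $\sigma^2=\sum_{i=1}^n\mathbf{E}\xi_i^2>0$. Then for all $x\ge 0$, \[ \mathbf{P}(S_n>x\sigma)\le B_n\Big(x,\frac{\varepsilon}{\sigma}\Big)\,F_2\Big(x,\frac{\varepsilon}{\sigma}\Big)\le B_n\Big(x,\frac{\varepsilon}{\sigma}\Big), \] where \[ F_2\Big(x,\frac{\varepsilon}{\sigma}\Big)=\Big(M(x)+27.99\,R(x\varepsilon/\sigma)\frac{\varepsilon}{\sigma}\Big)\wedge 1 . \] Moreover, $R$ is increasing, so for all $0\le x\le \alpha\sigma/\varepsilon$ with $0\le\alpha<\frac13$ one has $R(x\varepsilon/\sigma)\le R(\alpha)$; and $27.99R(0.1)\le 88.41$.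
   Context: $\Phi$ is the standard normal distribution function and $M(x)=(1-\Phi(x))e^{x^2/2}$. For $x\ge0$ and $r=\varepsilon/\sigma$, set $\widehat{x}=\frac{2x}{1+\sqrt{1+2xr}}$, $B(x,r)=\exp\{-\widehat{x}^2/2\}$, $\psi(t)=t-\log(1+t)$, and \[ B_n(x,r)=B(x,r)\exp\Big\{-n\,\psi\Big(\frac{\widehat{x}^2}{2n\sqrt{1+2xr}}\Big)\Big\}. \] The function $R$ is defined by $R(t)=\frac{(1-t+6t^2)^3}{(1-3t)^{3/2}(1-t)^7}$ for $0\le t<\frac13$ and $R(t)=\infty$ for $t\ge\frac13$. $a\wedge b=\min\{a,b\}$. *)

theory Defs
  imports "HOL-Probability.Probability"
begin

definition Phi :: "real \<Rightarrow> real" where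
  "Phi x = (\<integral>t\<in>{..x}. std_normal_density t \<partial>lborel)"

definition Mills :: "real \<Rightarrow> real" where
  "Mills x = (1 - Phi x) * exp (x\<^sup>2 / 2)"

definition xhat :: "real \<Rightarrow> real \<Rightarrow> real" where
  "xhat x r = 2 * x / (1 + sqrt (1 + 2 * x * r))"

definition B :: "real \<Rightarrow> real \<Rightarrow> real" where
  "B x r = exp (- (xhat x r)\<^sup>2 / 2)"

definition psi :: "real \<Rightarrow> real" where
  "psi t = t - ln (1 + t)"

definition Bn :: "nat \<Rightarrow> real \<Rightarrow> real \<Rightarrow> real" where
  "Bn n x r = B x r * exp (- real n * psi ((xhat x r)\<^sup>2 / (2 * real n * sqrt (1 + 2 * x * r))))"

definition R :: "real \<Rightarrow> ereal" where
  "R t = (if t < 1/3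
          then ereal ((1 - t + 6 * t\<^sup>2) ^ 3 / ((1 - 3 * t) powr (3/2) * (1 - t) ^ 7))
          else \<infinity>)"

definition F2 :: "real \<Rightarrow> real \<Rightarrow> ereal" where
  "F2 x r = min (ereal (Mills x) + ereal 27.99 * R (x * r) * ereal r) 1"

end

theory Submission
  imports Defs "HOL-Real_Asymp.Real_Asymp"
begin

text \<open>
  Tilt the law of \<open>S = \<xi> 1 + \<dots> + \<xi> n\<close> by \<open>exp (\<lambda> * S)\<close>, where \<open>\<lambda>\<close> minimises Bernstein's bound for the
  log-Laplace transform minus \<open>\<lambda> * x * \<sigma>\<close>. Since \<open>E (exp (\<lambda> * S)) * exp (- \<lambda> * x * \<sigma>) \<le> Bn n x (\<epsilon> / \<sigma>)\<close> by
  concavity of the logarithm, the tail is at most \<open>Bn n x (\<epsilon> / \<sigma>)\<close> times the tilted expectation of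
  \<open>exp (- \<lambda> * (S - x * \<sigma>))\<close> over \<open>S > x * \<sigma>\<close>. That expectation is at most \<open>1\<close>. It is also compared with
  its Gaussian counterpart, which is at most a Mills ratio because the tilted mean does not exceed
  \<open>x * \<sigma>\<close>, by means of a Berry--Esseen inequality for sums of independent variables with
  constant \<open>2.4\<close>; the latter comes from Beurling's majorant of a half-line. The Lyapunov ratio of the
  tilted summands is bounded by a multiple of \<open>R (x * \<epsilon> / \<sigma>) * \<epsilon> / \<sigma>\<close>.
\<close>

section \<open>Fourier integrals on the unit interval\<close>

text \<open>The tilt dictates the shape of \<open>R\<close>. Put t = \<lambda> * \<epsilon>.
  Bernstein's condition with k = 4 forces every variance below 12 * \<epsilon>^2, so each Laplace
  transform is at most (1 - t + 6 * t^2) / (1 - t), whatever the variance. The condition with k = 3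
  leaves a fraction 1 - 3 * t of the variance, before division by the square of the Laplace
  transform. The third moment grows by at most (1 - t)^(-4). The cube of the standard deviation in
  the Lyapunov ratio then produces the exponents 3 and 3/2. The obstacle is the constant. An
  exponential functional is a mixture over bounded intervals, which doubles the Berry--Esseen
  constant, and the moment bounds contribute 3 / 2 * sqrt 12, about 5.2. Once 2 is set aside for the
  change of argument in the Mills ratio, 27.99 leaves room for a Berry--Esseen constant just below
  2.5, for summands that need not be identically distributed. An extremal majorant meets this: it
  bounds a tail from one side, exceeds the indicator by only 1/2 in the integral, and sees
  characteristic functions on a bounded interval only.\<close>

abbreviation U01 :: "real measure" where "U01 \<equiv> restrict_space lborel {0<..<1}"

lemma finite_measure_U01: "finite_measure U01"
  by (rule finite_measureI) (simp add: space_restrict_space emeasure_restrict_space)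

lemma integrable_U01_bounded:
  fixes f :: "real \<Rightarrow> real"
  assumes [measurable]: "f \<in> borel_measurable borel" and "\<And>u. 0 < u \<Longrightarrow> u < 1 \<Longrightarrow> \<bar>f u\<bar> \<le> C"
  shows "integrable U01 f"
proof -
  interpret finite_measure U01 by (rule finite_measure_U01)
  show ?thesis
    by (rule integrable_const_bound[where B = C])
       (auto simp: assms measurable_restrict_space1 intro!: AE_I2)
qed

lemma integral_U01_FTC:
  fixes f F :: "real \<Rightarrow> real"
  assumes [measurable]: "f \<in> borel_measurable borel"
    and "\<And>u. 0 \<le> u \<Longrightarrow> u \<le> 1 \<Longrightarrow> (F has_real_derivative f u) (at u)"
    and "\<And>u. 0 \<le> u \<Longrightarrow> u \<le> 1 \<Longrightarrow> isCont f u"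
  shows "(\<integral>u. f u \<partial>U01) = F 1 - F 0"
proof -
  have "(\<integral>u. f u * indicator {0 .. 1} u \<partial>lborel) = F 1 - F 0"
    using assms by (intro integral_FTC_Icc_real) auto
  also have "(\<integral>u. f u * indicator {0 .. 1} u \<partial>lborel) = (\<integral>u. f u * indicator {0 <..< 1} u \<partial>lborel)"
  proof (intro integral_cong_AE)
    show "AE u in lborel. f u * indicator {0..1} u = f u * indicator {0<..<1} u"
      using AE_lborel_singleton[of 0] AE_lborel_singleton[of 1]
      by eventually_elim (auto simp: indicator_def)
  qed auto
  finally show ?thesis
    by (simp add: integral_restrict_space mult.commute)
qed

text \<open>Expanding the nonnegative integral of the squared distance from \<open>f\<close> to its
  projection on the first N functions gives Bessel's inequality. The squared coefficients are then
  summable, hence they tend to 0.\<close>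

lemma bessel_tendsto_0:
  fixes f :: "'a \<Rightarrow> real" and e :: "nat \<Rightarrow> 'a \<Rightarrow> real"
  assumes "finite_measure M"
    and [measurable]: "f \<in> borel_measurable M" "\<And>k. e k \<in> borel_measurable M"
    and bf: "\<And>x. x \<in> space M \<Longrightarrow> \<bar>f x\<bar> \<le> C"
    and be: "\<And>x k. x \<in> space M \<Longrightarrow> \<bar>e k x\<bar> \<le> 1"
    and orth: "\<And>j k. (\<integral>x. e j x * e k x \<partial>M) = (if j = k then c else 0)" and c: "c > 0"
  shows "(\<lambda>k. \<integral>x. f x * e k x \<partial>M) \<longlonglongrightarrow> 0"
proof -
  interpret finite_measure M by fact
  define a where "a k = (\<integral>x. f x * e k x \<partial>M)" for k
  have int_e: "integrable M (\<lambda>x. e j x * e k x)" for j k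
    using mult_mono[OF be be] by (intro integrable_const_bound[where B = 1] AE_I2) (auto simp: abs_mult)
  have int_f: "integrable M (\<lambda>x. f x * e k x)" for k
    by (intro integrable_const_bound[where B = "\<bar>C\<bar> * 1"] AE_I2)
       (auto simp: abs_mult simp del: mult_1_right intro!: mult_mono order_trans[OF bf] be)
  have int_ff: "integrable M (\<lambda>x. f x * f x)"
    by (intro integrable_const_bound[where B = "C * C"] AE_I2)
       (auto simp: abs_mult simp del: abs_mult_self_eq intro!: mult_mono bf order_trans[OF abs_ge_zero bf])
  have "(\<Sum>k<N. (a k)\<^sup>2) \<le> c * (\<integral>x. f x * f x \<partial>M)" for N
  proof -
    have "0 \<le> (\<integral>x. (f x - (\<Sum>k<N. a k / c * e k x))\<^sup>2 \<partial>M)" by simp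
    also have "(\<lambda>x. (f x - (\<Sum>k<N. a k / c * e k x))\<^sup>2) =
      (\<lambda>x. f x * f x - 2 * (\<Sum>k<N. a k / c * (f x * e k x))
        + (\<Sum>j<N. \<Sum>k<N. (a j / c) * (a k / c) * (e j x * e k x)))"
    proof
      fix x
      have "2 * (f x * (\<Sum>k<N. a k / c * e k x)) = 2 * (\<Sum>k<N. a k / c * (f x * e k x))"
        by (simp add: sum_distrib_left mult_ac)
      moreover have "(\<Sum>k<N. a k / c * e k x) * (\<Sum>k<N. a k / c * e k x)
        = (\<Sum>j<N. \<Sum>k<N. (a j / c) * (a k / c) * (e j x * e k x))"
        by (simp add: sum_product mult_ac)
      moreover have "(f x - S)\<^sup>2 = f x * f x - 2 * (f x * S) + S * S" for S
        by (simp add: power2_eq_square algebra_simps)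
      ultimately show "(f x - (\<Sum>k<N. a k / c * e k x))\<^sup>2 =
        f x * f x - 2 * (\<Sum>k<N. a k / c * (f x * e k x))
        + (\<Sum>j<N. \<Sum>k<N. (a j / c) * (a k / c) * (e j x * e k x))" by simp
    qed
    also have "(\<integral>x. f x * f x - 2 * (\<Sum>k<N. a k / c * (f x * e k x))
        + (\<Sum>j<N. \<Sum>k<N. (a j / c) * (a k / c) * (e j x * e k x)) \<partial>M)
      = (\<integral>x. f x * f x \<partial>M) - 2 * (\<Sum>k<N. a k / c * a k)
        + (\<Sum>j<N. \<Sum>k<N. (a j / c) * (a k / c) * (if j = k then c else 0))"
      by (simp add: int_e int_f int_ff orth a_def)
    also have "\<dots> = (\<integral>x. f x * f x \<partial>M) - (\<Sum>k<N. (a k)\<^sup>2) / c"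
    proof -
      have "(\<Sum>j<N. \<Sum>k<N. (a j / c) * (a k / c) * (if j = k then c else 0)) = (\<Sum>j<N. (a j)\<^sup>2 / c)"
      proof (rule sum.cong[OF refl])
        fix j assume "j \<in> {..<N}"
        have "(\<Sum>k<N. (a j / c) * (a k / c) * (if j = k then c else 0)) = (\<Sum>k<N. if j = k then (a k)\<^sup>2 / c else 0)"
          using c by (intro sum.cong) (auto simp: power2_eq_square)
        then show "(\<Sum>k<N. (a j / c) * (a k / c) * (if j = k then c else 0)) = (a j)\<^sup>2 / c"
          using \<open>j \<in> {..<N}\<close> by simp
      qed
      moreover have "(\<Sum>k<N. a k / c * a k) = (\<Sum>j<N. (a j)\<^sup>2 / c)"
        by (simp add: power2_eq_square)
      ultimately show ?thesis by (simp add: sum_divide_distrib)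
    qed
    finally show ?thesis using c by (simp add: field_simps)
  qed
  then have "summable (\<lambda>k. (a k)\<^sup>2)"
    by (intro summableI_nonneg_bounded) auto
  from summable_LIMSEQ_zero[OF this] have "(\<lambda>k. sqrt ((a k)\<^sup>2)) \<longlonglongrightarrow> sqrt 0"
    by (intro tendsto_intros)
  then show ?thesis by (simp add: a_def tendsto_rabs_zero_iff)
qed

lemma integral_U01_cos:
  assumes "w \<noteq> 0" shows "(\<integral>u. cos (w * u) \<partial>U01) = sin w / w"
  by (subst integral_U01_FTC[where F = "\<lambda>u. sin (w * u) / w"])
     (use assms in \<open>auto intro!: derivative_eq_intros\<close>)

lemma integral_U01_sin:
  assumes "w \<noteq> 0" shows "(\<integral>u. sin (w * u) \<partial>U01) = (1 - cos w) / w"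
  by (subst integral_U01_FTC[where F = "\<lambda>u. - cos (w * u) / w"])
     (use assms in \<open>auto intro!: derivative_eq_intros simp: field_simps\<close>)

lemma integral_U01_triangle_cos:
  assumes "w \<noteq> 0" shows "(\<integral>u. (1 - u) * cos (w * u) \<partial>U01) = (1 - cos w) / w\<^sup>2"
  by (subst integral_U01_FTC[where F = "\<lambda>u. (1 - u) * sin (w * u) / w - cos (w * u) / w\<^sup>2"])
     (use assms in \<open>auto intro!: derivative_eq_intros simp: field_simps power2_eq_square\<close>)

lemma integrable_U01_trig [simp]:
  "integrable U01 (\<lambda>u. cos (w * u))" "integrable U01 (\<lambda>u. sin (w * u))"
  by (auto intro!: integrable_U01_bounded[where C = 1])

text \<open>The addition theorem moves the fixed part x of the frequency into the bounded factors
  sin (2 * pi * x * u) and cos (2 * pi * x * u). What remains are sines and cosines of integer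
  frequency, which are orthogonal on the unit interval.\<close>

lemma riemann_lebesgue_U01:
  fixes f :: "real \<Rightarrow> real"
  assumes [measurable]: "f \<in> borel_measurable borel" and bf: "\<And>u. 0 < u \<Longrightarrow> u < 1 \<Longrightarrow> \<bar>f u\<bar> \<le> C"
  shows "(\<lambda>k. \<integral>u. f u * sin (2 * pi * (x + real k) * u) \<partial>U01) \<longlonglongrightarrow> 0"
proof -
  \<comment> \<open>\<open>Suc\<close> keeps out the frequency 0, where the sine vanishes and the
    squared norm of the cosine is 1 instead of 1/2.\<close>
  define d where "d k = 2 * pi * real (Suc k)" for k
  have d: "d k > 0" for k by (simp add: d_def)
  have sd: "sin (d j - d k) = 0" "sin (d j + d k) = 0" for j k
  proof -
    have "d j - d k = 2 * pi * of_int (int j - int k)" "d j + d k = 2 * pi * of_int (int j + int k + 2)"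
      by (auto simp: d_def algebra_simps)
    then show "sin (d j - d k) = 0" "sin (d j + d k) = 0"
      by (metis sin_int_2pin mult.assoc mult.commute)+
  qed
  have int0: "(\<integral>u. cos ((d j - d k) * u) \<partial>U01) = (if j = k then 1 else 0)" for j k
  proof (cases "j = k")
    case True
    then show ?thesis by (simp add: measure_restrict_space)
  next
    case False
    then have "d j - d k \<noteq> 0" by (simp add: d_def)
    then show ?thesis using False by (simp add: integral_U01_cos sd)
  qed
  have int1: "(\<integral>u. cos ((d j + d k) * u) \<partial>U01) = 0" for j k
    using d[of j] d[of k] by (subst integral_U01_cos) (auto simp: sd)
  have e1: "(\<lambda>k. \<integral>u. (f u * sin (2 * pi * x * u)) * cos (d k * u) \<partial>U01) \<longlonglongrightarrow> 0"
  proof (rule bessel_tendsto_0[OF finite_measure_U01, where C = "\<bar>C\<bar> * 1" and c = "1/2"])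
    show "(\<integral>u. cos (d j * u) * cos (d k * u) \<partial>U01) = (if j = k then 1/2 else 0)" for j k
      using int0[of j k] int1[of j k] by (simp add: cos_times_cos flip: left_diff_distrib distrib_right)
    show "\<bar>f u * sin (2 * pi * x * u)\<bar> \<le> \<bar>C\<bar> * 1" if "u \<in> space U01" for u
      unfolding abs_mult using that by (intro mult_mono order_trans[OF bf]) auto
  qed (auto simp: measurable_restrict_space1)
  have e2: "(\<lambda>k. \<integral>u. (f u * cos (2 * pi * x * u)) * sin (d k * u) \<partial>U01) \<longlonglongrightarrow> 0"
  proof (rule bessel_tendsto_0[OF finite_measure_U01, where C = "\<bar>C\<bar> * 1" and c = "1/2"])
    show "(\<integral>u. sin (d j * u) * sin (d k * u) \<partial>U01) = (if j = k then 1/2 else 0)" for j k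
      using int0[of j k] int1[of j k] by (simp add: sin_times_sin flip: left_diff_distrib distrib_right)
    show "\<bar>f u * cos (2 * pi * x * u)\<bar> \<le> \<bar>C\<bar> * 1" if "u \<in> space U01" for u
      unfolding abs_mult using that by (intro mult_mono order_trans[OF bf]) auto
  qed (auto simp: measurable_restrict_space1)
  have int: "integrable U01 (\<lambda>u. f u * g u)"
    if [measurable]: "g \<in> borel_measurable borel" and "\<And>u. \<bar>g u\<bar> \<le> 1" for g
    by (intro integrable_U01_bounded[where C = "\<bar>C\<bar> * 1"])
       (auto simp: abs_mult simp del: mult_1_right intro!: mult_mono order_trans[OF bf] that)
  have b1: "\<bar>sin y * cos z\<bar> \<le> 1" for y z :: real
    using mult_mono[of "\<bar>sin y\<bar>" 1 "\<bar>cos z\<bar>" 1] by (simp add: abs_mult)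
  have "(\<lambda>k. (\<integral>u. (f u * sin (2 * pi * x * u)) * cos (d k * u) \<partial>U01)
    + (\<integral>u. (f u * cos (2 * pi * x * u)) * sin (d k * u) \<partial>U01)) \<longlonglongrightarrow> 0 + 0"
    by (intro tendsto_add e1 e2)
  also have "(\<lambda>k. (\<integral>u. (f u * sin (2 * pi * x * u)) * cos (d k * u) \<partial>U01)
    + (\<integral>u. (f u * cos (2 * pi * x * u)) * sin (d k * u) \<partial>U01)) =
    (\<lambda>k. \<integral>u. f u * sin (2 * pi * (x + real (Suc k)) * u) \<partial>U01)"
  proof
    fix k
    have "sin (2 * pi * (x + real (Suc k)) * u)
      = sin (2 * pi * x * u) * cos (d k * u) + sin (d k * u) * cos (2 * pi * x * u)" for u
      using sin_add[of "2 * pi * x * u" "d k * u"] by (simp add: d_def algebra_simps)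
    then have "(\<integral>u. f u * sin (2 * pi * (x + real (Suc k)) * u) \<partial>U01) =
      (\<integral>u. f u * (sin (2 * pi * x * u) * cos (d k * u)) + f u * (sin (d k * u) * cos (2 * pi * x * u)) \<partial>U01)"
      by (simp only: distrib_left)
    also have "\<dots> = (\<integral>u. f u * (sin (2 * pi * x * u) * cos (d k * u)) \<partial>U01) + (\<integral>u. f u * (sin (d k * u) * cos (2 * pi * x * u)) \<partial>U01)"
      by (intro Bochner_Integration.integral_add int b1) auto
    finally show "(\<integral>u. (f u * sin (2 * pi * x * u)) * cos (d k * u) \<partial>U01)
      + (\<integral>u. (f u * cos (2 * pi * x * u)) * sin (d k * u) \<partial>U01)
      = (\<integral>u. f u * sin (2 * pi * (x + real (Suc k)) * u) \<partial>U01)"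
      by (simp only: mult_ac)
  qed
  finally show ?thesis by (subst (asm) filterlim_sequentially_Suc[where f = "\<lambda>k. \<integral>u. f u * sin (2 * pi * (x + real k) * u) \<partial>U01"]) simp
qed

section \<open>Beurling's majorant\<close>

lemma one_minus_cos_le_sin: "0 \<le> z \<Longrightarrow> z \<le> pi / 2 \<Longrightarrow> 1 - cos z \<le> sin (z::real)"
proof -
  assume z: "0 \<le> z" "z \<le> pi / 2"
  then have nn: "0 \<le> cos z" "0 \<le> sin z" by (auto intro!: cos_ge_zero sin_ge_zero)
  have "cos z * cos z \<le> cos z" "sin z * sin z \<le> sin z"
    using mult_left_mono[OF cos_le_one nn(1)] mult_left_mono[OF sin_le_one nn(2)] by auto
  with sin_cos_squared_add[of z] show ?thesis by (simp add: power2_eq_square)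
qed

lemma mult_cos_le_sin: "0 \<le> z \<Longrightarrow> z \<le> pi \<Longrightarrow> z * cos z \<le> sin (z::real)"
proof -
  assume z: "0 \<le> z" "z \<le> pi"
  have "sin 0 - 0 * cos 0 \<le> sin z - z * cos z"
  proof (rule DERIV_nonneg_imp_nondecreasing[OF z(1)])
    fix x assume x: "0 \<le> x" "x \<le> z"
    show "\<exists>y. ((\<lambda>a. sin a - a * cos a) has_real_derivative y) (at x) \<and> y \<ge> 0"
      using x z by (intro exI[of _ "x * sin x"] conjI) (auto intro!: derivative_eq_intros mult_nonneg_nonneg sin_ge_zero)
  qed
  then show ?thesis by simp
qed

text \<open>The Fourier form of Beurling's extremal majorant
  \<open>(sin (\<pi> x) / \<pi>)\<^sup>2 * ((\<Sum>n. 1 / (x - n)\<^sup>2) + 1 / x)\<close> of the indicator of \<open>[0, \<infinity>)\<close>. Its one-period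
  differences are elementary integrals of constant sign, and its limits at \<open>\<plusminus>\<infinity>\<close> follow from
  the Dirichlet integral and the Riemann--Lebesgue lemma; this gives the majorant property without
  evaluating the series.\<close>

definition beurling_weight :: "real \<Rightarrow> real" where
  "beurling_weight u = (1 - u) * cot (pi * u) + 1 / pi"

text \<open>The sine part is Vaaler's odd approximation to half the sign of x. The cosine part is
  half the Fejer kernel, whose addition turns the approximation into a majorant.\<close>

definition beurling :: "real \<Rightarrow> real" where
  "beurling x = 1 / 2 + (\<integral>u. beurling_weight u * sin (2 * pi * x * u) + (1 - u) * cos (2 * pi * x * u) \<partial>U01)"

section \<open>Sign, pole and remainder of the weight\<close>

lemma cot_le_inverse: "0 < z \<Longrightarrow> z < pi \<Longrightarrow> cot z \<le> 1 / (z::real)"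
  using mult_cos_le_sin[of z] by (simp add: cot_def field_simps sin_gt_zero)

text \<open>The estimate of the cotangent serves at both ends: at u for the upper bound and, through
  cot (pi * u) = - cot (pi * (1 - u)), at 1 - u for the sign.\<close>

lemma beurling_weight_bounds:
  assumes u: "0 < u" "u < 1"
  shows "0 \<le> beurling_weight u" "beurling_weight u \<le> 1 / (pi * u)"
proof -
  have "cot (pi * u) = - cot (pi * (1 - u))"
    by (simp add: cot_def right_diff_distrib sin_diff cos_diff)
  moreover have "cot (pi * (1 - u)) \<le> 1 / (pi * (1 - u))"
    using u by (intro cot_le_inverse) auto
  then have "(1 - u) * cot (pi * (1 - u)) \<le> (1 - u) * (1 / (pi * (1 - u)))"
    using u by (intro mult_left_mono) auto
  ultimately show "0 \<le> beurling_weight u"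
    using u by (simp add: beurling_weight_def)
  have "(1 - u) * cot (pi * u) \<le> (1 - u) * (1 / (pi * u))"
    using u by (intro mult_left_mono cot_le_inverse) auto
  moreover have "(1 - u) * (1 / (pi * u)) + 1 / pi = 1 / (pi * u)"
    using u by (simp add: field_simps)
  ultimately show "beurling_weight u \<le> 1 / (pi * u)"
    unfolding beurling_weight_def by linarith
qed

text \<open>The unbounded part of the weight is exactly the pole 1 / (pi * u). The pole produces the
  Dirichlet integral in the limit, and the bounded remainder is left to the Riemann--Lebesgue
  lemma.\<close>

lemma beurling_weight_remainder:
  assumes u: "0 < u" "u < 1"
  shows "\<bar>beurling_weight u - 1 / (pi * u)\<bar> \<le> 1"
proof (cases "u \<le> 1 / 2")
  case True
  define z where "z = pi * u"
  have z: "0 < z" "z \<le> pi / 2" using u True by (auto simp: z_def)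
  have s: "0 < sin z" using z by (intro sin_gt_zero) auto
  have "1 / z - cot z \<le> 1"
  proof -
    have "sin z * 1 \<le> z * (sin z + cos z)"
    proof -
      have "1 \<le> sin z + cos z" using one_minus_cos_le_sin[of z] z by simp
      then have "z * 1 \<le> z * (sin z + cos z)" using z by (intro mult_left_mono) auto
      moreover have "sin z \<le> z" using z by (intro sin_x_le_x) auto
      ultimately show ?thesis by linarith
    qed
    then show ?thesis using z s by (simp add: cot_def field_simps)
  qed
  moreover have "cot z \<le> 1 / z" using z by (intro cot_le_inverse) auto
  ultimately have "\<bar>(1 - u) * (1 / z - cot z)\<bar> \<le> 1 * 1"
    unfolding abs_mult using u by (intro mult_mono) auto
  moreover have "beurling_weight u - 1 / (pi * u) = - ((1 - u) * (1 / z - cot z))"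
    using u by (simp add: beurling_weight_def z_def field_simps)
  ultimately show ?thesis by simp
next
  case False
  then have "1 \<le> pi * u" using pi_gt3 mult_mono[of 2 pi "1/2" u] by simp
  then have "1 / (pi * u) \<le> 1" by simp
  with beurling_weight_bounds[OF u] show ?thesis by linarith
qed

lemma beurling_weight_measurable [measurable]: "beurling_weight \<in> borel_measurable borel"
  unfolding beurling_weight_def[abs_def] cot_def by measurable

text \<open>The zero of the sine at u = 0 cancels the pole. The price is linear growth in x, which
  is why distributions are later required to have a first moment.\<close>

lemma abs_beurling_weight_sin_le:
  assumes u: "0 < u" "u < 1"
  shows "\<bar>beurling_weight u * sin (2 * pi * x * u)\<bar> \<le> 2 * \<bar>x\<bar>"
proof -
  have "\<bar>beurling_weight u * sin (2 * pi * x * u)\<bar> \<le> 1 / (pi * u) * \<bar>2 * pi * x * u\<bar>"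
    unfolding abs_mult using beurling_weight_bounds[OF u] abs_sin_x_le_abs_x[of "2 * pi * x * u"] u
    by (intro mult_mono) (auto simp: abs_mult)
  then show ?thesis using u by (simp add: abs_mult)
qed

lemma integrable_beurling [simp]:
  "integrable U01 (\<lambda>u. beurling_weight u * sin (2 * pi * x * u))"
  by (rule integrable_U01_bounded[OF _ abs_beurling_weight_sin_le]) measurable

lemma integrable_U01_triangle_cos [simp]: "integrable U01 (\<lambda>u. (1 - u) * cos (w * u))"
proof (rule integrable_U01_bounded[where C = "1 * 1"])
  show "\<bar>(1 - u) * cos (w * u)\<bar> \<le> 1 * 1" if "0 < u" "u < 1" for u
    unfolding abs_mult using that by (intro mult_mono) auto
qed measurable

lemma beurling_0: "beurling 0 = 1"
proof -
  have "(\<integral>u. (1 - u) \<partial>U01) = (1 - 1\<^sup>2 / 2) - (0 - 0\<^sup>2 / 2)"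
    by (rule integral_U01_FTC[where F = "\<lambda>u. u - u\<^sup>2 / 2"]) (auto intro!: derivative_eq_intros)
  then show ?thesis by (simp add: beurling_def)
qed

lemma beurling_reflect:
  assumes "x \<noteq> 0"
  shows "beurling x + beurling (- x) = 1 + (1 - cos (2 * pi * x)) / (2 * pi\<^sup>2 * x\<^sup>2)"
proof -
  have "beurling x + beurling (- x) = 1 + 2 * (\<integral>u. (1 - u) * cos (2 * pi * x * u) \<partial>U01)"
    using integrable_beurling[of x] by (simp add: beurling_def)
  also have "\<dots> = 1 + 2 * ((1 - cos (2 * pi * x)) / (2 * pi * x)\<^sup>2)"
    using assms by (subst integral_U01_triangle_cos) auto
  also have "(2 * pi * x)\<^sup>2 = 2 * (2 * pi\<^sup>2 * x\<^sup>2)"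
    by (simp add: power_mult_distrib)
  finally show ?thesis by (simp only: mult.commute[of 2] nonzero_divide_mult_cancel_right)
qed

text \<open>Passing from x to x + 1 makes the difference of the sines a multiple of sin (pi * u),
  which cancels the denominator of the cotangent. Only trigonometric integrals with elementary
  values remain.\<close>

lemma beurling_step:
  assumes "x \<noteq> 0" "x \<noteq> -1"
  shows "beurling (x + 1) - beurling x =
    (1 - cos (2 * pi * x)) / (2 * pi\<^sup>2) * (1 / (x + 1)\<^sup>2 + 1 / (x + 1) - 1 / x)"
proof -
  define c where "c = cos (2 * pi * x)"
  have w: "2 * pi * (x + 1) \<noteq> 0" "2 * pi * x \<noteq> 0" using assms by auto
  have c': "cos (2 * pi * (x + 1)) = c" by (simp add: c_def distrib_left cos_add)
  let ?g = "\<lambda>x u. beurling_weight u * sin (2 * pi * x * u) + (1 - u) * cos (2 * pi * x * u)"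
  have "beurling (x + 1) - beurling x = (\<integral>u. ?g (x + 1) u \<partial>U01) - (\<integral>u. ?g x u \<partial>U01)"
    by (simp only: beurling_def)
  also have "\<dots> = (\<integral>u. ?g (x + 1) u - ?g x u \<partial>U01)"
    by (intro Bochner_Integration.integral_diff[symmetric] Bochner_Integration.integrable_add
        integrable_beurling integrable_U01_triangle_cos)
  also have "\<dots> = (\<integral>u. 2 * ((1 - u) * cos (2 * pi * (x + 1) * u))
    + (1 / pi) * (sin (2 * pi * (x + 1) * u) - sin (2 * pi * x * u)) \<partial>U01)"
  proof (rule Bochner_Integration.integral_cong[OF refl])
    fix u assume "u \<in> space U01"
    then have u: "0 < u" "u < 1" by auto
    then have s: "sin (pi * u) \<noteq> 0" using sin_gt_zero[of "pi * u"] by simp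
    define t where "t = pi * u"
    define a where "a = 2 * pi * x * u + t"
    have e: "2 * pi * (x + 1) * u = a + t" "2 * pi * x * u = a - t"
      by (auto simp: a_def t_def algebra_simps)
    have "cot t * sin t = cos t" using s by (simp add: cot_def t_def)
    then have ct: "cot t * (sin t * y) = cos t * y" for y by (metis mult.assoc)
    show "?g (x + 1) u - ?g x u = 2 * ((1 - u) * cos (2 * pi * (x + 1) * u))
      + (1 / pi) * (sin (2 * pi * (x + 1) * u) - sin (2 * pi * x * u))"
      unfolding e beurling_weight_def t_def[symmetric] cos_add cos_diff sin_add sin_diff
      by (simp add: algebra_simps ct)
  qed
  also have "\<dots> = 2 * (\<integral>u. (1 - u) * cos (2 * pi * (x + 1) * u) \<partial>U01) + (1 / pi) *
     ((\<integral>u. sin (2 * pi * (x + 1) * u) \<partial>U01) - (\<integral>u. sin (2 * pi * x * u) \<partial>U01))"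
    by simp
  also have "\<dots> = 2 * ((1 - c) / (2 * pi * (x + 1))\<^sup>2)
    + (1 / pi) * ((1 - c) / (2 * pi * (x + 1)) - (1 - c) / (2 * pi * x))"
    by (simp only: integral_U01_triangle_cos[OF w(1)] integral_U01_sin[OF w(1)] integral_U01_sin[OF w(2)] c' c_def[symmetric])
  also have "\<dots> = (1 - c) / (2 * pi\<^sup>2) * (1 / (x + 1)\<^sup>2 + 1 / (x + 1) - 1 / x)"
  proof -
    define y where "y = x + 1"
    have "y \<noteq> 0" "x \<noteq> 0" using assms by (auto simp: y_def)
    then show ?thesis unfolding y_def[symmetric]
      by (simp add: divide_simps) (simp add: algebra_simps power2_eq_square)
  qed
  finally show ?thesis by (simp only: c_def)
qed

section \<open>Limits at infinity and the majorant property\<close>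

lemma integral_U01_sinc:
  assumes "y > 0" shows "(\<integral>u. sin (y * u) / u \<partial>U01) = Si y"
proof -
  have "(\<integral>u. sin (y * u) / u \<partial>U01) = (LBINT t=ereal 0..ereal 1. sin (t * y) / t)"
    by (subst integral_restrict_space)
       (auto simp: interval_lebesgue_integral_def set_lebesgue_integral_def mult.commute)
  also have "\<dots> = Si y"
    using LBINT_I0c_sin_scale_divide[of 1 y] assms by (simp add: zero_ereal_def)
  finally show ?thesis .
qed

lemma beurling_tendsto:
  assumes "x > 0" shows "(\<lambda>k. beurling (x + real k)) \<longlonglongrightarrow> 1"
proof -
  define V where "V u = beurling_weight u - 1 / (pi * u)" for u
  have [measurable]: "V \<in> borel_measurable borel" unfolding V_def by measurable
  have V: "\<bar>V u\<bar> \<le> 1" if "0 < u" "u < 1" for u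
    using beurling_weight_remainder[OF that] by (simp add: V_def)
  have lim: "filterlim (\<lambda>k. 2 * pi * (x + real k)) at_top sequentially"
    by (intro filterlim_tendsto_pos_mult_at_top[OF tendsto_const] filterlim_tendsto_add_at_top[OF tendsto_const]
        filterlim_real_sequentially) auto
  have intV: "integrable U01 (\<lambda>u. V u * sin (2 * pi * y * u))" for y
  proof (rule integrable_U01_bounded[where C = "1 * 1"])
    show "\<bar>V u * sin (2 * pi * y * u)\<bar> \<le> 1 * 1" if "0 < u" "u < 1" for u
      unfolding abs_mult using that V[OF that] by (intro mult_mono) auto
  qed measurable
  have eq: "beurling y = 1 / 2 + ((\<integral>u. V u * sin (2 * pi * y * u) \<partial>U01) + Si (2 * pi * y) / pi
      + (1 - cos (2 * pi * y)) / (2 * pi * y)\<^sup>2)" if "y > 0" for y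
  proof -
    have "integrable U01 (\<lambda>u. beurling_weight u * sin (2 * pi * y * u) - V u * sin (2 * pi * y * u))"
      by (intro Bochner_Integration.integrable_diff integrable_beurling intV)
    then have i: "integrable U01 (\<lambda>u. sin (2 * pi * y * u) / u / pi)"
      by (simp add: V_def algebra_simps)
    have "(\<integral>u. beurling_weight u * sin (2 * pi * y * u) \<partial>U01)
      = (\<integral>u. V u * sin (2 * pi * y * u) + sin (2 * pi * y * u) / u / pi \<partial>U01)"
      by (intro Bochner_Integration.integral_cong) (auto simp: V_def algebra_simps)
    also have "\<dots> = (\<integral>u. V u * sin (2 * pi * y * u) \<partial>U01) + (\<integral>u. sin (2 * pi * y * u) / u / pi \<partial>U01)"
      by (intro Bochner_Integration.integral_add intV i)
    also have "(\<integral>u. sin (2 * pi * y * u) / u / pi \<partial>U01) = Si (2 * pi * y) / pi"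
      using that integral_U01_sinc[of "2 * pi * y"] by (simp del: divide_divide_eq_left)
    finally show ?thesis
      using that by (simp add: beurling_def integral_U01_triangle_cos)
  qed
  have "(\<lambda>k. 1 / 2 + ((\<integral>u. V u * sin (2 * pi * (x + real k) * u) \<partial>U01) + Si (2 * pi * (x + real k)) / pi
      + (1 - cos (2 * pi * (x + real k))) / (2 * pi * (x + real k))\<^sup>2)) \<longlonglongrightarrow> 1 / 2 + (0 + (pi / 2) / pi + 0)"
  proof (intro tendsto_add tendsto_const riemann_lebesgue_U01[where C = 1] tendsto_divide V)
    show "(\<lambda>k. Si (2 * pi * (x + real k))) \<longlonglongrightarrow> pi / 2"
      by (rule filterlim_compose[OF Si_at_top lim])
    have "(\<lambda>k. 2 / (2 * pi * (x + real k))\<^sup>2) \<longlonglongrightarrow> 0"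
      by (intro tendsto_divide_0[OF tendsto_const] filterlim_at_top_imp_at_infinity
          filterlim_pow_at_top lim) auto
    then show "(\<lambda>k. (1 - cos (2 * pi * (x + real k))) / (2 * pi * (x + real k))\<^sup>2) \<longlonglongrightarrow> 0"
    proof (rule Lim_null_comparison[rotated], intro always_eventually allI)
      fix k
      have "\<bar>1 - cos (2 * pi * (x + real k))\<bar> \<le> 2"
        using cos_le_one[of "2 * pi * (x + real k)"] cos_ge_minus_one[of "2 * pi * (x + real k)"] by linarith
      then show "norm ((1 - cos (2 * pi * (x + real k))) / (2 * pi * (x + real k))\<^sup>2) \<le> 2 / (2 * pi * (x + real k))\<^sup>2"
        by (simp add: divide_right_mono)
    qed
  qed auto
  then show ?thesis using assms by (simp add: eq)
qed

lemma beurling_ge_1: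
  assumes "x \<ge> 0" shows "beurling x \<ge> 1"
proof (cases "x = 0")
  case False
  with assms have x: "x > 0" by simp
  have "decseq (\<lambda>k. beurling (x + real k))"
  proof (rule decseq_SucI)
    fix k
    define y where "y = x + real k"
    have y: "y > 0" using x by (simp add: y_def)
    have "1 / (y + 1)\<^sup>2 + 1 / (y + 1) - 1 / y = - (1 / (y * (y + 1)\<^sup>2))"
      using y by (simp add: divide_simps) (simp add: algebra_simps power2_eq_square)
    then have "1 / (y + 1)\<^sup>2 + 1 / (y + 1) - 1 / y \<le> 0"
      using y by simp
    moreover have "0 \<le> (1 - cos (2 * pi * y)) / (2 * pi\<^sup>2)" by simp
    ultimately have "(1 - cos (2 * pi * y)) / (2 * pi\<^sup>2) * (1 / (y + 1)\<^sup>2 + 1 / (y + 1) - 1 / y) \<le> 0"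
      by (rule mult_nonneg_nonpos[rotated])
    with beurling_step[of y] y have "beurling (y + 1) \<le> beurling y" by simp
    then show "beurling (x + real (Suc k)) \<le> beurling (x + real k)"
      by (simp add: y_def algebra_simps)
  qed
  from decseq_ge[OF this beurling_tendsto[OF x], of 0] show ?thesis by simp
qed (simp add: beurling_0)

lemma beurling_nonneg:
  "0 \<le> beurling x"
proof (cases "x \<ge> 0")
  case True
  then show ?thesis using beurling_ge_1[of x] by simp
next
  case False
  define z where "z = - x"
  have z: "z > 0" using False by (simp add: z_def)
  have "decseq (\<lambda>k. beurling (- (z + real k)))"
  proof (rule decseq_SucI)
    fix k
    define y where "y = z + real k"
    have y: "y > 0" using z by (simp add: y_def)
    have "1 / (- y)\<^sup>2 + 1 / (- y) - 1 / (- (y + 1)) = 1 / (y\<^sup>2 * (y + 1))"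
      using y by (simp add: divide_simps) (simp add: algebra_simps power2_eq_square)
    then have "1 / (- y)\<^sup>2 + 1 / (- y) - 1 / (- (y + 1)) \<ge> 0"
      using y by simp
    moreover have "0 \<le> (1 - cos (2 * pi * (- (y + 1)))) / (2 * pi\<^sup>2)" by simp
    ultimately have "0 \<le> (1 - cos (2 * pi * (- (y + 1)))) / (2 * pi\<^sup>2) * (1 / (- y)\<^sup>2 + 1 / (- y) - 1 / (- (y + 1)))"
      by (rule mult_nonneg_nonneg[rotated])
    with beurling_step[of "- (y + 1)"] y have "beurling (- (y + 1)) \<le> beurling (- y)" by simp
    then show "beurling (- (z + real (Suc k))) \<le> beurling (- (z + real k))"
      by (simp add: y_def algebra_simps)
  qed
  \<comment> \<open>The reflection formula carries the limit 1 at the positive end over to the limit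
    0 at the negative end, since the Fejer kernel tends to 0.\<close>
  moreover have "(\<lambda>k. beurling (- (z + real k))) \<longlonglongrightarrow> 0"
  proof -
    have lim: "filterlim (\<lambda>k. z + real k) at_top sequentially"
      by (intro filterlim_tendsto_add_at_top[OF tendsto_const] filterlim_real_sequentially)
    have "(\<lambda>k. 2 / (2 * pi\<^sup>2 * (z + real k)\<^sup>2)) \<longlonglongrightarrow> 0"
      by (intro tendsto_divide_0[OF tendsto_const] filterlim_at_top_imp_at_infinity
          filterlim_tendsto_pos_mult_at_top[OF tendsto_const] filterlim_pow_at_top lim) auto
    then have "(\<lambda>k. (1 - cos (2 * pi * (z + real k))) / (2 * pi\<^sup>2 * (z + real k)\<^sup>2)) \<longlonglongrightarrow> 0"
    proof (rule Lim_null_comparison[rotated], intro always_eventually allI)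
      fix k
      have "\<bar>1 - cos (2 * pi * (z + real k))\<bar> \<le> 2"
        using cos_le_one[of "2 * pi * (z + real k)"] cos_ge_minus_one[of "2 * pi * (z + real k)"] by linarith
      then show "norm ((1 - cos (2 * pi * (z + real k))) / (2 * pi\<^sup>2 * (z + real k)\<^sup>2)) \<le> 2 / (2 * pi\<^sup>2 * (z + real k)\<^sup>2)"
        using divide_right_mono[of "\<bar>1 - cos (2 * pi * (z + real k))\<bar>" 2 "2 * pi\<^sup>2 * (z + real k)\<^sup>2"]
        unfolding real_norm_def abs_divide by (simp add: abs_mult)
    qed
    from tendsto_diff[OF tendsto_add[OF tendsto_const[of 1] this] beurling_tendsto[OF z]]
    have "(\<lambda>k. 1 + (1 - cos (2 * pi * (z + real k))) / (2 * pi\<^sup>2 * (z + real k)\<^sup>2) - beurling (z + real k)) \<longlonglongrightarrow> 0"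
      by simp
    moreover have "1 + (1 - cos (2 * pi * (z + real k))) / (2 * pi\<^sup>2 * (z + real k)\<^sup>2) - beurling (z + real k)
      = beurling (- (z + real k))" for k
      using beurling_reflect[of "z + real k"] z by (simp add: add_pos_nonneg)
    ultimately show ?thesis by simp
  qed
  ultimately show ?thesis using decseq_ge[of _ 0 0] by (fastforce simp: z_def)
qed

lemma beurling_measurable [measurable]: "beurling \<in> borel_measurable borel"
proof -
  interpret finite_measure U01 by (rule finite_measure_U01)
  have sf: "sigma_finite_measure U01" by unfold_locales
  have [measurable]: "(\<lambda>p. beurling_weight (snd p)) \<in> borel_measurable (borel \<Otimes>\<^sub>M U01)"
    by (intro measurable_compose[OF _ beurling_weight_measurable] measurable_compose[OF measurable_snd]
        measurable_restrict_space1) auto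
  have [measurable]: "(\<lambda>p. snd p) \<in> borel_measurable (borel \<Otimes>\<^sub>M U01)"
    by (intro measurable_compose[OF measurable_snd] measurable_restrict_space1) auto
  have "(\<lambda>x. \<integral>u. (case (x,u) of (x,u) \<Rightarrow> beurling_weight u * sin (2 * pi * x * u) + (1 - u) * cos (2 * pi * x * u)) \<partial>U01) \<in> borel_measurable borel"
    by (intro sigma_finite_measure.borel_measurable_lebesgue_integral[OF sf]) (simp add: case_prod_beta', measurable)
  then show ?thesis unfolding beurling_def[abs_def] by simp
qed

section \<open>The smoothing inequality\<close>

lemma fejer_half_line_integral:
  "(\<integral>\<^sup>+x. ennreal ((1 - cos (2 * pi * x)) / (2 * pi\<^sup>2 * x\<^sup>2)) * indicator {0<..} x \<partial>lborel) = ennreal (1 / 2)"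
proof -
  let ?f = "\<lambda>x. (1 - cos (2 * pi * x)) / (2 * pi\<^sup>2 * x\<^sup>2)"
  \<comment> \<open>Integration by parts of the Fejer kernel: differentiating 1 - cos leaves a sinc,
    whose primitive is \<open>Si\<close>. The limits 0 at 0 and 1 / 2 at infinity give the
    integral.\<close>
  define F where "F x = Si (2 * pi * x) / pi - (1 - cos (2 * pi * x)) / (2 * pi\<^sup>2 * x)" for x
  have D: "(F has_real_derivative ?f x) (at x)" if "x > 0" for x
  proof -
    have "((\<lambda>x. Si (2 * pi * x)) has_real_derivative sinc (2 * pi * x) * (2 * pi)) (at x)"
      by (rule DERIV_chain2[OF DERIV_Si]) (auto intro!: derivative_eq_intros)
    then have "(F has_real_derivative (sinc (2 * pi * x) * (2 * pi)) / pi -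
       (sin (2 * pi * x) * (2 * pi) * (2 * pi\<^sup>2 * x) - (1 - cos (2 * pi * x)) * (2 * pi\<^sup>2)) / ((2 * pi\<^sup>2 * x) * (2 * pi\<^sup>2 * x))) (at x)"
      unfolding F_def using that by (auto intro!: derivative_eq_intros)
    also have "(sinc (2 * pi * x) * (2 * pi)) / pi -
       (sin (2 * pi * x) * (2 * pi) * (2 * pi\<^sup>2 * x) - (1 - cos (2 * pi * x)) * (2 * pi\<^sup>2)) / ((2 * pi\<^sup>2 * x) * (2 * pi\<^sup>2 * x))
       = ?f x"
      using that by (simp add: divide_simps) (simp add: algebra_simps power2_eq_square power4_eq_xxxx)
    finally show ?thesis .
  qed
  have A: "((F \<circ> real_of_ereal) \<longlongrightarrow> 0) (at_right 0)"
  proof -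
    have "((\<lambda>x. Si (2 * pi * x) / pi) \<longlongrightarrow> Si (2 * pi * 0) / pi) (at_right 0)"
      by (intro tendsto_intros isCont_tendsto_compose[OF isCont_Si]) auto
    moreover have "((\<lambda>x. (1 - cos (2 * pi * x)) / (2 * pi\<^sup>2 * x)) \<longlongrightarrow> 0) (at_right 0)"
      by real_asymp
    ultimately have "(F \<longlongrightarrow> Si (2 * pi * 0) / pi - 0) (at_right 0)"
      unfolding F_def by (rule tendsto_diff)
    moreover have "Si 0 = 0" by (simp add: Si_def flip: zero_ereal_def)
    ultimately show ?thesis by (simp add: zero_ereal_def ereal_tendsto_simps)
  qed
  have B: "((F \<circ> real_of_ereal) \<longlongrightarrow> 1 / 2) (at_left \<infinity>)"
  proof -
    have "filterlim (\<lambda>x. 2 * pi * x) at_top at_top"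
      by real_asymp
    from filterlim_compose[OF Si_at_top this]
    have "((\<lambda>x. Si (2 * pi * x) / pi) \<longlongrightarrow> (pi / 2) / pi) at_top"
      by (intro tendsto_intros) auto
    moreover have "((\<lambda>x. (1 - cos (2 * pi * x)) / (2 * pi\<^sup>2 * x)) \<longlongrightarrow> 0) at_top"
      by real_asymp
    ultimately have "(F \<longlongrightarrow> (pi / 2) / pi - 0) at_top"
      unfolding F_def by (rule tendsto_diff)
    then show ?thesis by (simp add: ereal_tendsto_simps)
  qed
  note FTC = interval_integral_FTC_nonneg[of 0 \<infinity> F ?f, OF _ _ _ _ A B]
  have i: "set_integrable lborel {0<..} ?f" and e: "(LINT x:{0<..}|lborel. ?f x) = 1 / 2"
    using FTC D by (auto simp: interval_lebesgue_integral_def zero_ereal_def intro!: AE_I2)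
  have "(\<integral>\<^sup>+x. ennreal (?f x) * indicator {0<..} x \<partial>lborel) = (\<integral>\<^sup>+x. ennreal (indicator {0<..} x *\<^sub>R ?f x) \<partial>lborel)"
    by (intro nn_integral_cong) (auto simp: indicator_def)
  also have "\<dots> = ennreal (1 / 2)"
  proof (subst nn_integral_eq_integral)
    show "integrable lborel (\<lambda>x. indicator {0<..} x *\<^sub>R ?f x)" using i unfolding set_integrable_def .
    show "ennreal (\<integral>x. indicator {0<..} x *\<^sub>R ?f x \<partial>lborel) = ennreal (1 / 2)"
      using e unfolding set_lebesgue_integral_def by (simp only:)
  qed auto
  finally show ?thesis .
qed

text \<open>After folding the negative half-line onto the positive one, the excesses at x and - x
  add up to the Fejer kernel by the reflection formula, so no closed form of the majorant itself is
  integrated.\<close>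

lemma beurling_excess:
  "(\<integral>\<^sup>+x. ennreal (beurling x - indicator {0..} x) \<partial>lborel) = ennreal (1 / 2)"
proof -
  let ?D = "\<lambda>x. beurling x - indicator {0..} x"
  have D: "?D x \<ge> 0" for x
    using beurling_ge_1[of x] beurling_nonneg[of x] by (auto simp: indicator_def)
  have "(\<integral>\<^sup>+x. ennreal (?D x) \<partial>lborel)
    = (\<integral>\<^sup>+x. ennreal (?D x) * indicator {0<..} x + ennreal (?D x) * indicator {..<0} x \<partial>lborel)"
    using AE_lborel_singleton[of 0]
    by (intro nn_integral_cong_AE, eventually_elim) (auto simp: indicator_def)
  also have "\<dots> = (\<integral>\<^sup>+x. ennreal (?D x) * indicator {0<..} x \<partial>lborel)
      + (\<integral>\<^sup>+x. ennreal (?D x) * indicator {..<0} x \<partial>lborel)"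
    by (rule nn_integral_add) auto
  also have "(\<integral>\<^sup>+x. ennreal (?D x) * indicator {..<0} x \<partial>lborel)
      = (\<integral>\<^sup>+x. ennreal (?D (- x)) * indicator {..<0} (- x) \<partial>lborel)"
    by (subst nn_integral_real_affine[where t = 0 and c = "-1"]) auto
  also have "(\<integral>\<^sup>+x. ennreal (?D x) * indicator {0<..} x \<partial>lborel)
      + (\<integral>\<^sup>+x. ennreal (?D (- x)) * indicator {..<0} (- x) \<partial>lborel)
      = (\<integral>\<^sup>+x. ennreal (?D x) * indicator {0<..} x + ennreal (?D (- x)) * indicator {..<0} (- x) \<partial>lborel)"
    by (rule nn_integral_add[symmetric]) auto
  also have "\<dots> = (\<integral>\<^sup>+x. ennreal ((1 - cos (2 * pi * x)) / (2 * pi\<^sup>2 * x\<^sup>2)) * indicator {0<..} x \<partial>lborel)"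
  proof (intro nn_integral_cong)
    fix x :: real
    show "ennreal (?D x) * indicator {0<..} x + ennreal (?D (- x)) * indicator {..<0} (- x)
      = ennreal ((1 - cos (2 * pi * x)) / (2 * pi\<^sup>2 * x\<^sup>2)) * indicator {0<..} x"
    proof (cases "x > 0")
      case True
      then have "?D x + ?D (- x) = (1 - cos (2 * pi * x)) / (2 * pi\<^sup>2 * x\<^sup>2)"
        using beurling_reflect[of x] by simp
      with True show ?thesis using D[of x] D[of "- x"] by (simp flip: ennreal_plus)
    qed (auto simp: indicator_def)
  qed
  finally show ?thesis by (simp only: fejer_half_line_integral)
qed

text \<open>The frequencies of the majorant lie below 2 * pi in modulus. After scaling by T / (2 *
  pi), only the values of the characteristic function on (0, T) enter. The exchange of integrals is
  justified by the majorant 2 * \<bar>y x\<bar> + 1, integrable by the first moment.\<close>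

lemma (in real_distribution) beurling_expectation:
  assumes int: "integrable M (\<lambda>x. x)" and T: "T > 0"
  shows "integrable M (\<lambda>x. beurling (T / (2 * pi) * (x - a)))"
    and "expectation (\<lambda>x. beurling (T / (2 * pi) * (x - a))) = 1 / 2 +
     (\<integral>u. beurling_weight u * Im (iexp (- (T * u * a)) * char M (T * u))
      + (1 - u) * Re (iexp (- (T * u * a)) * char M (T * u)) \<partial>U01)"
    and "integrable U01 (\<lambda>u. beurling_weight u * Im (iexp (- (T * u * a)) * char M (T * u))
      + (1 - u) * Re (iexp (- (T * u * a)) * char M (T * u)))"
proof -
  interpret U: finite_measure U01 by (rule finite_measure_U01)
  interpret P: pair_sigma_finite M U01 ..
  define y where "y x = T / (2 * pi) * (x - a)" for x
  define g where "g x u = beurling_weight u * sin (2 * pi * y x * u) + (1 - u) * cos (2 * pi * y x * u)" for x u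
  have [measurable]: "(\<lambda>p. beurling_weight (snd p)) \<in> borel_measurable (M \<Otimes>\<^sub>M U01)"
    by (intro measurable_compose[OF _ beurling_weight_measurable] measurable_compose[OF measurable_snd]
        measurable_restrict_space1) auto
  have [measurable]: "(\<lambda>p. snd p) \<in> borel_measurable (M \<Otimes>\<^sub>M U01)"
    by (intro measurable_compose[OF measurable_snd] measurable_restrict_space1) auto
  have [measurable]: "(\<lambda>p. fst p) \<in> borel_measurable (M \<Otimes>\<^sub>M U01)"
    by (intro measurable_compose[OF measurable_fst]) auto
  have meas [measurable]: "case_prod g \<in> borel_measurable (M \<Otimes>\<^sub>M U01)"
    unfolding g_def y_def case_prod_beta' by measurable
  have gi: "integrable U01 (g x)" for x
    unfolding g_def by simp
  have bd: "norm (g x u) \<le> 2 * \<bar>y x\<bar> + 1" if u: "0 < u" "u < 1" for x u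
  proof -
    have "\<bar>(1 - u) * cos (2 * pi * y x * u)\<bar> \<le> 1 * 1"
      unfolding abs_mult using u by (intro mult_mono) auto
    with abs_beurling_weight_sin_le[OF u, of "y x"] show ?thesis by (simp add: g_def)
  qed
  have iy: "integrable M (\<lambda>x. 2 * \<bar>y x\<bar> + 1)"
    unfolding y_def using int by simp
  have mU: "measure U01 (space U01) = 1" by (simp add: measure_restrict_space)
  have i: "integrable (M \<Otimes>\<^sub>M U01) (case_prod g)"
  proof (rule P.Fubini_integrable[OF meas])
    show "integrable M (\<lambda>x. \<integral>u. norm (case (x, u) of (x, u) \<Rightarrow> g x u) \<partial>U01)"
    proof (rule Bochner_Integration.integrable_bound[OF iy])
      show "(\<lambda>x. \<integral>u. norm (case (x, u) of (x, u) \<Rightarrow> g x u) \<partial>U01) \<in> borel_measurable M"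
        by measurable
      show "AE x in M. norm (\<integral>u. norm (case (x, u) of (x, u) \<Rightarrow> g x u) \<partial>U01) \<le> norm (2 * \<bar>y x\<bar> + 1)"
      proof (intro AE_I2)
        fix x
        have "(\<integral>u. norm (g x u) \<partial>U01) \<le> (\<integral>u. 2 * \<bar>y x\<bar> + 1 \<partial>U01)"
          using gi bd by (intro integral_mono) (auto simp: space_restrict_space)
        then show "norm (\<integral>u. norm (case (x, u) of (x, u) \<Rightarrow> g x u) \<partial>U01) \<le> norm (2 * \<bar>y x\<bar> + 1)"
          using mU by simp
      qed
    qed
  qed (use gi in auto)
  have b: "beurling (y x) = 1 / 2 + (\<integral>u. g x u \<partial>U01)" for x
    by (simp add: beurling_def g_def)
  have i1: "integrable M (\<lambda>x. \<integral>u. g x u \<partial>U01)"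
    by (rule P.integrable_fst[OF i])
  then show "integrable M (\<lambda>x. beurling (T / (2 * pi) * (x - a)))"
    unfolding y_def[symmetric] b by simp
  have inner: "(\<integral>x. g x u \<partial>M) = beurling_weight u * Im (iexp (- (T * u * a)) * char M (T * u))
      + (1 - u) * Re (iexp (- (T * u * a)) * char M (T * u))" for u
  proof -
    have ie: "integrable M (\<lambda>x. iexp (- (T * u * a)) * iexp (T * u * x))"
      by (intro integrable_mult_right integrable_iexp) auto
    have e: "iexp (- (T * u * a)) * iexp (T * u * x) = iexp (2 * pi * y x * u)" for x
    proof -
      have "2 * pi * y x * u = - (T * u * a) + T * u * x"
        by (simp add: y_def field_simps)
      then show ?thesis by (simp add: right_diff_distrib flip: exp_add)
    qed
    have c: "iexp (- (T * u * a)) * char M (T * u) = (\<integral>x. iexp (2 * pi * y x * u) \<partial>M)"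
      unfolding char_def e[symmetric] by simp
    have ie': "integrable M (\<lambda>x. iexp (2 * pi * y x * u))" using ie unfolding e .
    have "(\<integral>x. g x u \<partial>M) = (\<integral>x. beurling_weight u * Im (iexp (2 * pi * y x * u)) + (1 - u) * Re (iexp (2 * pi * y x * u)) \<partial>M)"
      by (simp only: g_def Re_exp Im_exp) simp
    also have "\<dots> = beurling_weight u * (\<integral>x. Im (iexp (2 * pi * y x * u)) \<partial>M) + (1 - u) * (\<integral>x. Re (iexp (2 * pi * y x * u)) \<partial>M)"
      using integrable_Im[OF ie'] integrable_Re[OF ie'] by simp
    also have "\<dots> = beurling_weight u * Im (\<integral>x. iexp (2 * pi * y x * u) \<partial>M) + (1 - u) * Re (\<integral>x. iexp (2 * pi * y x * u) \<partial>M)"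
      by (simp only: integral_Im[OF ie'] integral_Re[OF ie'])
    finally show ?thesis by (simp only: c)
  qed
  have "expectation (\<lambda>x. beurling (y x)) = 1 / 2 + (\<integral>x. \<integral>u. g x u \<partial>U01 \<partial>M)"
    unfolding b using i1 by (simp add: prob_space del: space_eq_univ)
  also have "(\<integral>x. \<integral>u. g x u \<partial>U01 \<partial>M) = (\<integral>u. \<integral>x. g x u \<partial>M \<partial>U01)"
    by (rule P.Fubini_integral[OF i, symmetric])
  finally show "expectation (\<lambda>x. beurling (T / (2 * pi) * (x - a))) = 1 / 2 +
     (\<integral>u. beurling_weight u * Im (iexp (- (T * u * a)) * char M (T * u))
      + (1 - u) * Re (iexp (- (T * u * a)) * char M (T * u)) \<partial>U01)"
    unfolding inner y_def .
  show "integrable U01 (\<lambda>u. beurling_weight u * Im (iexp (- (T * u * a)) * char M (T * u))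
      + (1 - u) * Re (iexp (- (T * u * a)) * char M (T * u)))"
    unfolding inner[symmetric] by (rule P.integrable_snd[OF i])
qed

text \<open>Enlarging the range to the half-line and substituting u = sqrt 5 / T * x gives 5 * sqrt
  5 times the second half-line moment sqrt pi / 4, a bound free of T.\<close>

lemma integral_U01_gaussian_moment_le:
  assumes T: "T > 0"
  shows "(\<integral>u. T ^ 3 * u\<^sup>2 * exp (- (T * u)\<^sup>2 / 5) \<partial>U01) \<le> 5 / 4 * sqrt (5 * pi)"
proof -
  define f where "f u = T ^ 3 * u\<^sup>2 * exp (- (T * u)\<^sup>2 / 5)" for u
  define c where "c = sqrt 5 / T"
  have c: "c > 0" "c \<noteq> 0" using T by (auto simp: c_def)
  have cT: "T * c = sqrt 5" using T by (simp add: c_def)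
  have hb: "has_bochner_integral lborel (\<lambda>x. indicator {0..} x *\<^sub>R (exp (- x\<^sup>2) * x ^ (2 * 1))) (sqrt pi / 2 * (fact (2 * 1) / (2 ^ (2 * 1) * fact 1)))"
    by (rule gaussian_moment_even_pos)
  have e: "indicator {0..} (0 + c * x) *\<^sub>R f (0 + c * x) = (T ^ 3 * c\<^sup>2) * (indicator {0..} x *\<^sub>R (exp (- x\<^sup>2) * x ^ (2 * 1)))" for x
  proof -
    have "(T * (c * x))\<^sup>2 / 5 = x\<^sup>2"
      using cT by (simp add: power_mult_distrib flip: mult.assoc)
    then show ?thesis using c by (simp add: f_def indicator_def zero_le_mult_iff power_mult_distrib)
  qed
  have i: "integrable lborel (\<lambda>u. indicator {0..} u *\<^sub>R f u)"
  proof -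
    have "integrable lborel (\<lambda>x. indicator {0..} (0 + c * x) *\<^sub>R f (0 + c * x))"
      unfolding e by (intro integrable_mult_right integrable.intros[OF hb])
    then show ?thesis
      using lborel_integrable_real_affine_iff[of c "\<lambda>u. indicator {0..} u *\<^sub>R f u" 0] c by blast
  qed
  have "(\<integral>u. indicator {0..} u *\<^sub>R f u \<partial>lborel) = \<bar>c\<bar> *\<^sub>R (\<integral>x. indicator {0..} (0 + c * x) *\<^sub>R f (0 + c * x) \<partial>lborel)"
    by (rule lborel_integral_real_affine) (use c in auto)
  also have "\<dots> = c * (T ^ 3 * c\<^sup>2 * (sqrt pi / 2 * (2 / 4)))"
    using c has_bochner_integral_integral_eq[OF hb] unfolding e by simp
  also have "\<dots> = (T * c) ^ 3 * (sqrt pi / 4)" by (simp add: power_mult_distrib eval_nat_numeral)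
  also have "\<dots> = 5 / 4 * sqrt (5 * pi)" unfolding cT by (simp add: eval_nat_numeral real_sqrt_mult)
  finally have I: "(\<integral>u. indicator {0..} u *\<^sub>R f u \<partial>lborel) = 5 / 4 * sqrt (5 * pi)" .
  have "(\<integral>u. f u \<partial>U01) = (\<integral>u. indicator {0<..<1} u *\<^sub>R f u \<partial>lborel)"
    by (simp add: integral_restrict_space)
  also have "\<dots> \<le> (\<integral>u. indicator {0..} u *\<^sub>R f u \<partial>lborel)"
  proof (rule integral_mono_AE'[OF i])
    show "AE u in lborel. indicator {0<..<1} u *\<^sub>R f u \<le> indicator {0..} u *\<^sub>R f u"
      using T by (auto simp: f_def indicator_def)
    show "AE u in lborel. 0 \<le> indicator {0..} u *\<^sub>R f u"
      using T by (auto simp: f_def indicator_def)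
  qed
  also note I
  finally show ?thesis unfolding f_def .
qed

lemma beurling_majorizes: "s > 0 \<Longrightarrow> indicator {a..} x \<le> beurling (s * (x - a))"
  using beurling_nonneg[of "s * (x - a)"] beurling_ge_1[of "s * (x - a)"]
  by (auto simp: indicator_def not_le)

lemma std_normal_density_le: "std_normal_density x \<le> 1 / sqrt (2 * pi)"
  unfolding std_normal_density_def by (simp add: divide_simps)

text \<open>The added term is the product of the largest normal density 1 / sqrt (2 * pi), the
  dilation 2 * pi / T and the excess 1 / 2.\<close>

lemma normal_beurling_le:
  assumes T: "T > 0"
  shows "(\<integral>x. beurling (T / (2 * pi) * (x - a)) \<partial>std_normal_distribution)
    \<le> measure std_normal_distribution {a..} + sqrt (2 * pi) / (2 * T)"
proof -
  interpret N: real_distribution std_normal_distribution by (rule real_dist_normal_dist)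
  define s where "s = T / (2 * pi)"
  have s: "s > 0" using T by (simp add: s_def)
  define d where "d x = beurling (s * (x - a)) - indicator {a..} x" for x
  have d: "d x \<ge> 0" for x using beurling_majorizes[OF s, of a x] by (simp add: d_def)
  have dm [measurable]: "d \<in> borel_measurable borel" unfolding d_def[abs_def] by measurable
  have i: "integrable std_normal_distribution (\<lambda>x. beurling (s * (x - a)))"
    unfolding s_def using integrable_std_normal_distribution_moment[of 1] T by (intro N.beurling_expectation) auto
  have id: "integrable std_normal_distribution d"
    unfolding d_def by (intro Bochner_Integration.integrable_diff i N.integrable_const_bound[where B = 1]) auto
  have "ennreal (\<integral>x. d x \<partial>std_normal_distribution) = (\<integral>\<^sup>+x. ennreal (d x) \<partial>std_normal_distribution)"
    using id d by (subst nn_integral_eq_integral) auto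
  also have "\<dots> = (\<integral>\<^sup>+x. ennreal (std_normal_density x) * ennreal (d x) \<partial>lborel)"
    by (subst nn_integral_density) auto
  also have "\<dots> \<le> (\<integral>\<^sup>+x. ennreal (1 / sqrt (2 * pi)) * ennreal (d x) \<partial>lborel)"
    by (intro nn_integral_mono mult_right_mono ennreal_leI std_normal_density_le) auto
  also have "\<dots> = ennreal (1 / sqrt (2 * pi)) * (\<integral>\<^sup>+x. ennreal (d x) \<partial>lborel)"
    by (rule nn_integral_cmult) auto
  also have "(\<integral>\<^sup>+x. ennreal (d x) \<partial>lborel) = ennreal \<bar>1 / s\<bar> * (\<integral>\<^sup>+x. ennreal (d (a + (1 / s) * x)) \<partial>lborel)"
    using s by (intro nn_integral_real_affine) auto
  also have "(\<lambda>x. ennreal (d (a + (1 / s) * x))) = (\<lambda>x. ennreal (beurling x - indicator {0..} x))"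
    using s by (auto simp: d_def indicator_def zero_le_divide_iff fun_eq_iff)
  also have "ennreal (1 / sqrt (2 * pi)) * (ennreal \<bar>1 / s\<bar> * (\<integral>\<^sup>+x. ennreal (beurling x - indicator {0..} x) \<partial>lborel))
     = ennreal (1 / sqrt (2 * pi) * (1 / s * (1 / 2)))"
  proof -
    have "ennreal (1 / sqrt (2 * pi) * (1 / s * (1 / 2))) = ennreal (1 / sqrt (2 * pi)) * ennreal (1 / s * (1 / 2))"
      using s by (intro ennreal_mult) auto
    also have "ennreal (1 / s * (1 / 2)) = ennreal (1 / s) * ennreal (1 / 2)"
      using s by (intro ennreal_mult) auto
    finally show ?thesis using s by (simp only: beurling_excess) simp
  qed
  also have "1 / sqrt (2 * pi) * (1 / s * (1 / 2)) = sqrt (2 * pi) / (2 * T)"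
  proof -
    have "sqrt (2 * pi) * sqrt (2 * pi) = 2 * pi" by simp
    then have "pi / sqrt (2 * pi) = sqrt (2 * pi) / 2" by (simp add: field_simps del: real_sqrt_mult_self)
    moreover have "1 / sqrt (2 * pi) * (1 / s * (1 / 2)) = (pi / sqrt (2 * pi)) / T"
      using T by (simp add: s_def)
    ultimately show ?thesis by (simp only: divide_divide_eq_left)
  qed
  finally have "(\<integral>x. d x \<partial>std_normal_distribution) \<le> sqrt (2 * pi) / (2 * T)"
    using T by (subst (asm) ennreal_le_iff) auto
  moreover have "(\<integral>x. d x \<partial>std_normal_distribution)
    = (\<integral>x. beurling (s * (x - a)) \<partial>std_normal_distribution) - measure std_normal_distribution {a..}"
    unfolding d_def using i by (subst Bochner_Integration.integral_diff) (auto intro!: N.integrable_const_bound[where B = 1])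
  ultimately show ?thesis by (simp add: s_def)
qed

text \<open>The left side is the real part of a product of two complex numbers, so the modulus of
  the weight pair matters. From u * (1 - u) \<le> 1 / 4 comes 1 - u \<le> 0.8 / (pi * u), and 1.29
  rounds up sqrt (1 + 0.8^2).\<close>

lemma beurling_weight_norm_le:
  assumes u: "0 < u" "u < 1"
  shows "\<bar>beurling_weight u * Im z + (1 - u) * Re z\<bar> \<le> 1.29 / (pi * u) * cmod z"
proof -
  let ?w = "Complex (1 - u) (- beurling_weight u)"
  have "\<bar>beurling_weight u * Im z + (1 - u) * Re z\<bar> = \<bar>Re (?w * z)\<bar>" by (simp add: algebra_simps)
  also have "\<dots> \<le> cmod ?w * cmod z" using abs_Re_le_cmod[of "?w * z"] by (simp add: norm_mult)
  also have "cmod ?w \<le> 1.29 / (pi * u)"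
  proof -
    have "(2 * u - 1)\<^sup>2 \<ge> 0" by simp
    then have q: "u * (1 - u) \<le> 1 / 4" by (simp add: power2_eq_square algebra_simps)
    have "pi * (u * (1 - u)) \<le> 3.2 * (1 / 4)" using pi_approx q u by (intro mult_mono) auto
    then have "(1 - u) \<le> 0.8 / (pi * u)" using u by (simp add: field_simps)
    then have "(1 - u)\<^sup>2 \<le> (0.8 / (pi * u))\<^sup>2" using u by (intro power_mono) auto
    moreover have "(beurling_weight u)\<^sup>2 \<le> (1 / (pi * u))\<^sup>2"
      using beurling_weight_bounds[OF u] by (intro power_mono) auto
    moreover have "(0.8 / (pi * u))\<^sup>2 + (1 / (pi * u))\<^sup>2 \<le> (1.29 / (pi * u))\<^sup>2"
      using u by (simp add: power_divide divide_simps)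
    ultimately have "(1 - u)\<^sup>2 + (beurling_weight u)\<^sup>2 \<le> (1.29 / (pi * u))\<^sup>2" by linarith
    then have "sqrt ((1 - u)\<^sup>2 + (beurling_weight u)\<^sup>2) \<le> 1.29 / (pi * u)"
      using u by (intro real_le_lsqrt) auto
    then show ?thesis by (simp add: cmod_def)
  qed
  finally show ?thesis by (simp add: mult_right_mono)
qed

text \<open>The factor t ^ 3 in the hypothesis absorbs the 1 / u of the weight and leaves a Gaussian
  second moment, so the last term does not depend on the cut-off T.\<close>

lemma (in real_distribution) smoothing_inequality:
  assumes int: "integrable M (\<lambda>x. x)" and T: "T > 0" and A: "A \<ge> 0"
    and bnd: "\<And>t. 0 < t \<Longrightarrow> t < T \<Longrightarrow>
      cmod (char M t - of_real (exp (- t\<^sup>2 / 2))) \<le> A * t ^ 3 * exp (- t\<^sup>2 / 5)"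
  shows "measure M {a..} \<le> measure std_normal_distribution {a..} + sqrt (2 * pi) / (2 * T)
    + 1.29 / pi * A * (5 / 4 * sqrt (5 * pi))"
proof -
  interpret N: real_distribution std_normal_distribution by (rule real_dist_normal_dist)
  have iN: "integrable std_normal_distribution (\<lambda>x. x)"
    using integrable_std_normal_distribution_moment[of 1] by simp
  let ?b = "\<lambda>x. beurling (T / (2 * pi) * (x - a))"
  have "measure M {a..} = expectation (indicator {a..})" by simp
  also have "\<dots> \<le> expectation ?b"
    using T by (intro integral_mono beurling_expectation(1) int integrable_const_bound[where B = 1] beurling_majorizes) auto
  also have "expectation ?b - N.expectation ?b \<le> 1.29 / pi * A * (5 / 4 * sqrt (5 * pi))"
  proof -
    let ?g = "\<lambda>D u. beurling_weight u * Im (iexp (- (T * u * a)) * char D (T * u))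
      + (1 - u) * Re (iexp (- (T * u * a)) * char D (T * u))"
    have ig: "integrable U01 (?g M)" "integrable U01 (?g std_normal_distribution)"
      by (intro beurling_expectation(3) int T) (intro N.beurling_expectation(3) iN T)
    have "expectation ?b - N.expectation ?b = (\<integral>u. ?g M u \<partial>U01) - (\<integral>u. ?g std_normal_distribution u \<partial>U01)"
      by (simp only: beurling_expectation(2)[OF int T] N.beurling_expectation(2)[OF iN T] add_diff_cancel_left)
    also have "\<dots> = (\<integral>u. ?g M u - ?g std_normal_distribution u \<partial>U01)"
      by (rule Bochner_Integration.integral_diff[OF ig, symmetric])
    also have "\<dots> \<le> (\<integral>u. 1.29 / pi * A * (T ^ 3 * u\<^sup>2 * exp (- (T * u)\<^sup>2 / 5)) \<partial>U01)"
    proof (rule integral_mono)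
      show "integrable U01 (\<lambda>u. ?g M u - ?g std_normal_distribution u)" using ig by (rule Bochner_Integration.integrable_diff)
      show "integrable U01 (\<lambda>u. 1.29 / pi * A * (T ^ 3 * u\<^sup>2 * exp (- (T * u)\<^sup>2 / 5)))"
      proof (intro integrable_mult_right integrable_U01_bounded[where C = "T ^ 3 * 1 * 1"])
        show "\<bar>T ^ 3 * u\<^sup>2 * exp (- (T * u)\<^sup>2 / 5)\<bar> \<le> T ^ 3 * 1 * 1" if "0 < u" "u < 1" for u
          unfolding abs_mult using that T by (intro mult_mono) (auto simp: power_le_one)
      qed measurable
      fix u assume "u \<in> space U01"
      then have u: "0 < u" "u < 1" by (auto simp: space_restrict_space)
      let ?z = "iexp (- (T * u * a)) * (char M (T * u) - char std_normal_distribution (T * u))"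
      have "?g M u - ?g std_normal_distribution u = beurling_weight u * Im ?z + (1 - u) * Re ?z"
        by (simp add: algebra_simps)
      also have "\<dots> \<le> 1.29 / (pi * u) * cmod ?z"
        using beurling_weight_norm_le[OF u, of ?z] by linarith
      also have "cmod ?z = cmod (char M (T * u) - of_real (exp (- (T * u)\<^sup>2 / 2)))"
        by (simp add: norm_mult char_std_normal_distribution)
      also have "1.29 / (pi * u) * \<dots> \<le> 1.29 / (pi * u) * (A * (T * u) ^ 3 * exp (- (T * u)\<^sup>2 / 5))"
        using u T by (intro mult_left_mono bnd) auto
      also have "\<dots> = 1.29 / pi * A * (T ^ 3 * u\<^sup>2 * exp (- (T * u)\<^sup>2 / 5))"
        using u by (simp add: power_mult_distrib eval_nat_numeral)
      finally show "?g M u - ?g std_normal_distribution u \<le> 1.29 / pi * A * (T ^ 3 * u\<^sup>2 * exp (- (T * u)\<^sup>2 / 5))" .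
    qed
    also have "\<dots> = 1.29 / pi * A * (\<integral>u. T ^ 3 * u\<^sup>2 * exp (- (T * u)\<^sup>2 / 5) \<partial>U01)" by (rule integral_mult_right_zero)
    also have "\<dots> \<le> 1.29 / pi * A * (5 / 4 * sqrt (5 * pi))"
      using A T by (intro mult_left_mono integral_U01_gaussian_moment_le) auto
    finally show ?thesis .
  qed
  then have "expectation ?b \<le> N.expectation ?b + 1.29 / pi * A * (5 / 4 * sqrt (5 * pi))" by simp
  finally show ?thesis using normal_beurling_le[OF T, of a] by linarith
qed

section \<open>The Berry--Esseen inequality\<close>

text \<open>With c = sqrt v, the pointwise inequality 3 * c * x^2 \<le> 2 * \<bar>x\<bar>^3 + c^3
  has a double zero at \<bar>x\<bar> = c. Taking expectations gives the claim, because c^3 = c *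
  v.\<close>

lemma (in real_distribution) lyapunov_2_3:
  assumes i2: "integrable M (\<lambda>x. x\<^sup>2)" and i3: "integrable M (\<lambda>x. \<bar>x\<bar> ^ 3)"
  defines "v \<equiv> expectation (\<lambda>x. x\<^sup>2)"
  shows "v * sqrt v \<le> expectation (\<lambda>x. \<bar>x\<bar> ^ 3)"
proof -
  define c where "c = sqrt v"
  have v: "v \<ge> 0" unfolding v_def by simp
  have c: "c \<ge> 0" "c * c = v" using v by (auto simp: c_def)
  have pt: "3 * c * x\<^sup>2 \<le> 2 * \<bar>x\<bar> ^ 3 + c ^ 3" for x :: real
  proof -
    have "2 * \<bar>x\<bar> ^ 3 + c ^ 3 - 3 * c * \<bar>x\<bar>\<^sup>2 = (\<bar>x\<bar> - c)\<^sup>2 * (2 * \<bar>x\<bar> + c)"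
      by (simp add: power2_eq_square power3_eq_cube algebra_simps)
    moreover have "\<dots> \<ge> 0" using c by simp
    ultimately show ?thesis by simp
  qed
  have "expectation (\<lambda>x. 3 * c * x\<^sup>2) \<le> expectation (\<lambda>x. 2 * \<bar>x\<bar> ^ 3 + c ^ 3)"
    using i2 i3 by (intro integral_mono pt) auto
  then have "3 * c * v \<le> 2 * expectation (\<lambda>x. \<bar>x\<bar> ^ 3) + c ^ 3"
    using i2 i3 by (simp add: v_def prob_space del: space_eq_univ)
  moreover have "c ^ 3 = c * v" using c by (simp add: power3_eq_cube flip: mult.assoc)
  ultimately show ?thesis by (simp add: c_def mult.commute)
qed

text \<open>The exponent 3/2 is the one needed: at s = w^2 / 2 the bound is a multiple of w ^ 3,
  hence controlled by the third moment, whereas the usual quadratic remainder would involve w ^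
  4.\<close>

lemma exp_minus_remainder_le:
  assumes "s \<ge> (0::real)" shows "exp (- s) - 1 + s \<le> s * sqrt s / 2"
proof -
  have "exp (- s) \<le> 1 / (1 + s)"
    using exp_ge_add_one_self[of s] assms by (simp add: exp_minus divide_simps)
  also have "1 / (1 + s) - 1 + s = s * (s / (1 + s))" using assms by (simp add: divide_simps) (simp add: algebra_simps)
  then have "1 / (1 + s) = s * (s / (1 + s)) + 1 - s" by simp
  also have "s / (1 + s) \<le> sqrt s / 2"
  proof -
    have "(sqrt s - 1)\<^sup>2 \<ge> 0" by simp
    then have "2 * sqrt s \<le> 1 + s" using assms by (simp add: power2_eq_square algebra_simps)
    then have "sqrt s * (2 * sqrt s) \<le> sqrt s * (1 + s)" using assms by (intro mult_left_mono) auto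
    moreover have "sqrt s * (2 * sqrt s) = 2 * s" using assms by simp
    ultimately have "2 * s \<le> sqrt s * (1 + s)" by linarith
    then show ?thesis using assms by (simp add: field_simps)
  qed
  finally show ?thesis using assms by (simp add: mult_left_mono)
qed

text \<open>With \<open>w = t * sqrt v\<close>, Lyapunov's inequality gives \<open>w ^ 3 \<le> b * t ^ 3\<close>. The coefficient
  \<open>3 / 8\<close> makes the first bound trivial for \<open>w \<ge> 4 / 3\<close>, while the Taylor bound covers
  \<open>w\<^sup>2 \<le> 2\<close>; with it the exponent is at least \<open>- 32 / 243\<close> (attained at \<open>w = 8 / 9\<close>), and \<open>0.3963\<close>
  dominates \<open>(1 / 6 + 0.177) * exp (32 / 243)\<close>.\<close>

lemma (in real_distribution) char_third_moment:
  assumes i1: "integrable M (\<lambda>x. x)" and i2: "integrable M (\<lambda>x. x\<^sup>2)" and i3: "integrable M (\<lambda>x. \<bar>x\<bar> ^ 3)"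
    and mean: "expectation (\<lambda>x. x) = 0" and t: "t > 0"
  defines "v \<equiv> expectation (\<lambda>x. x\<^sup>2)" and "b \<equiv> expectation (\<lambda>x. \<bar>x\<bar> ^ 3)"
  shows "cmod (char M t) \<le> exp (- v * t\<^sup>2 / 2 + 3 / 8 * b * t ^ 3)"
    and "cmod (char M t - of_real (exp (- v * t\<^sup>2 / 2)))
      \<le> 0.3963 * b * t ^ 3 * exp (- v * t\<^sup>2 / 2 + 3 / 8 * b * t ^ 3)"
proof -
  have v: "v \<ge> 0" and b: "b \<ge> 0" unfolding v_def b_def by auto
  define w where "w = t * sqrt v"
  have w: "w \<ge> 0" and w2: "w\<^sup>2 = v * t\<^sup>2" using t v by (auto simp: w_def power_mult_distrib)
  have w3: "w ^ 3 \<le> b * t ^ 3"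
  proof -
    have "w ^ 3 = (v * sqrt v) * t ^ 3" using v by (simp add: w_def power3_eq_cube)
    also have "\<dots> \<le> b * t ^ 3"
      using lyapunov_2_3[OF i2 i3] t unfolding v_def b_def by (intro mult_right_mono) auto
    finally show ?thesis .
  qed
  have taylor: "cmod (char M t - of_real (1 - w\<^sup>2 / 2)) \<le> b * t ^ 3 / 6"
  proof -
    have "cmod (char M t - (1 - t\<^sup>2 * v / 2)) \<le> (t\<^sup>2 / 6) * expectation (\<lambda>x. min (6 * x\<^sup>2) (\<bar>t\<bar> * \<bar>x\<bar> ^ 3))"
      by (rule char_approx3) (use i1 i2 mean in \<open>auto simp: v_def\<close>)
    also have "\<dots> \<le> (t\<^sup>2 / 6) * expectation (\<lambda>x. \<bar>t\<bar> * \<bar>x\<bar> ^ 3)"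
      using i2 i3 by (intro mult_left_mono integral_mono) auto
    also have "\<dots> = b * t ^ 3 / 6" using t by (simp add: b_def power2_eq_square power3_eq_cube)
    finally show ?thesis by (simp add: w2 mult.commute)
  qed
  have D: "w\<^sup>2 / 2 - 3 / 8 * (b * t ^ 3) \<le> 32 / 243"
  proof -
    have "(w - 8 / 9)\<^sup>2 * (3 * w / 8 + 1 / 6) \<ge> 0" using w by simp
    then have "w\<^sup>2 / 2 - 3 / 8 * w ^ 3 \<le> 32 / 243"
      by (simp add: power2_eq_square power3_eq_cube algebra_simps)
    with w3 show ?thesis by linarith
  qed
  show "cmod (char M t) \<le> exp (- v * t\<^sup>2 / 2 + 3 / 8 * b * t ^ 3)"
  proof (cases "w\<^sup>2 \<le> 2")
    case True
    have "cmod (char M t) \<le> cmod (of_real (1 - w\<^sup>2 / 2)) + b * t ^ 3 / 6"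
      using taylor norm_triangle_ineq2[of "char M t" "of_real (1 - w\<^sup>2 / 2)"] by linarith
    also have "cmod (of_real (1 - w\<^sup>2 / 2)) = 1 - w\<^sup>2 / 2" using True by (simp only: norm_of_real)
    also have "1 - w\<^sup>2 / 2 + b * t ^ 3 / 6 \<le> exp (- w\<^sup>2 / 2 + b * t ^ 3 / 6)"
      using exp_ge_add_one_self[of "- w\<^sup>2 / 2 + b * t ^ 3 / 6"] by linarith
    also have "\<dots> \<le> exp (- v * t\<^sup>2 / 2 + 3 / 8 * b * t ^ 3)"
    proof -
      have "0 \<le> b * t ^ 3" using b t by simp
      then show ?thesis unfolding exp_le_cancel_iff w2 by (simp add: mult.assoc)
    qed
    finally show ?thesis .
  next
    case False
    then have "(4 / 3)\<^sup>2 \<le> w\<^sup>2" by (simp add: power2_eq_square)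
    then have "4 / 3 \<le> w" using w by (rule power2_le_imp_le)
    then have "0 \<le> w\<^sup>2 * (3 * w / 8 - 1 / 2)" by simp
    then have "0 \<le> - w\<^sup>2 / 2 + 3 / 8 * w ^ 3" by (simp add: power2_eq_square power3_eq_cube algebra_simps)
    then have "0 \<le> - v * t\<^sup>2 / 2 + 3 / 8 * b * t ^ 3" using w3 w2 by simp
    then show ?thesis using cmod_char_le_1[of t] by (meson dual_order.trans one_le_exp_iff)
  qed
  have "cmod (char M t - of_real (exp (- (w\<^sup>2 / 2)))) \<le> 0.344 * (b * t ^ 3)"
  proof -
    define s where "s = w\<^sup>2 / 2"
    have s: "s \<ge> 0" by (simp add: s_def)
    have "s * sqrt s / 2 = w ^ 3 * (1 / (4 * sqrt 2))"
      using w by (simp add: s_def real_sqrt_divide power2_eq_square power3_eq_cube)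
    also have "\<dots> \<le> (b * t ^ 3) * 0.177"
    proof (rule mult_mono[OF w3])
      have "sqrt 2 \<ge> 1.413" by (rule real_le_rsqrt) (simp add: power2_eq_square)
      then show "1 / (4 * sqrt 2) \<le> 0.177" by (simp add: divide_simps)
    qed (use b t in auto)
    finally have "exp (- s) - 1 + s \<le> 0.177 * (b * t ^ 3)"
      using exp_minus_remainder_le[OF s] by simp
    moreover have "exp (- s) - 1 + s \<ge> 0" using exp_ge_add_one_self[of "- s"] by simp
    ultimately have "cmod (of_real (1 - s) - of_real (exp (- s))) \<le> 0.177 * (b * t ^ 3)"
      by (simp only: of_real_diff[symmetric] norm_of_real)
    moreover have "cmod (char M t - of_real (1 - s)) \<le> b * t ^ 3 / 6" using taylor by (simp add: s_def)
    ultimately have "cmod (char M t - of_real (exp (- s))) \<le> b * t ^ 3 / 6 + 0.177 * (b * t ^ 3)"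
      using norm_triangle_ineq[of "char M t - of_real (1 - s)" "of_real (1 - s) - of_real (exp (- s))"] by simp
    moreover have "b * t ^ 3 \<ge> 0" using b t by simp
    ultimately show ?thesis unfolding s_def by simp
  qed
  also have "\<dots> \<le> 0.3963 * (b * t ^ 3) * exp (- v * t\<^sup>2 / 2 + 3 / 8 * b * t ^ 3)"
  proof -
    \<comment> \<open>The tangent bound already suffices numerically: 0.3963 * 211 / 243 exceeds
      0.344, which in turn exceeds 1 / 6 + 0.177.\<close>
    have "1 + - (32 / 243) \<le> exp (- (32 / 243 :: real))" by (rule exp_ge_add_one_self)
    also have "\<dots> \<le> exp (- v * t\<^sup>2 / 2 + 3 / 8 * b * t ^ 3)" using D w2 by simp
    finally have "0.344 \<le> 0.3963 * exp (- v * t\<^sup>2 / 2 + 3 / 8 * b * t ^ 3)" by simp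
    from mult_right_mono[OF this, of "b * t ^ 3"] show ?thesis using b t by (simp add: mult_ac)
  qed
  finally show "cmod (char M t - of_real (exp (- v * t\<^sup>2 / 2)))
      \<le> 0.3963 * b * t ^ 3 * exp (- v * t\<^sup>2 / 2 + 3 / 8 * b * t ^ 3)"
    by (simp add: w2 mult.assoc)
qed

text \<open>Replacing the factors one at a time, with errors measured relative to a common majorant
  \<open>E i\<close>, keeps the whole product of the majorants in the bound. No Gaussian decay is
  lost for the factor being exchanged.\<close>

lemma norm_prod_diff_weighted:
  fixes z w :: "'i \<Rightarrow> 'a :: {real_normed_field}"
  assumes "finite I"
    and "\<And>i. i \<in> I \<Longrightarrow> norm (z i) \<le> E i" "\<And>i. i \<in> I \<Longrightarrow> norm (w i) \<le> E i"
    and "\<And>i. i \<in> I \<Longrightarrow> norm (z i - w i) \<le> d i * E i"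
  shows "norm ((\<Prod>i\<in>I. z i) - (\<Prod>i\<in>I. w i)) \<le> (\<Sum>i\<in>I. d i) * (\<Prod>i\<in>I. E i)"
  using assms
proof (induction I rule: finite_induct)
  case (insert a I)
  let ?Z = "\<Prod>i\<in>I. z i" and ?W = "\<Prod>i\<in>I. w i" and ?E = "\<Prod>i\<in>I. E i"
  have Ea: "0 \<le> E a" using insert.prems(1)[of a] norm_ge_zero[of "z a"] by (meson insertI1 order_trans)
  have Z: "norm ?Z \<le> ?E"
    unfolding prod_norm[symmetric] using insert.prems by (intro prod_mono) auto
  have "z a * ?Z - w a * ?W = (z a - w a) * ?Z + w a * (?Z - ?W)" by (simp add: algebra_simps)
  then have "norm (z a * ?Z - w a * ?W) \<le> norm (z a - w a) * norm ?Z + norm (w a) * norm (?Z - ?W)"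
    by (metis norm_mult norm_triangle_ineq)
  also have "\<dots> \<le> (d a * E a) * ?E + E a * ((\<Sum>i\<in>I. d i) * ?E)"
    using insert.prems Z Ea insert.IH order_trans[OF norm_ge_zero insert.prems(3)]
    by (intro add_mono mult_mono) auto
  also have "\<dots> = (\<Sum>i\<in>insert a I. d i) * (\<Prod>i\<in>insert a I. E i)"
    using insert.hyps by (simp add: algebra_simps)
  finally show ?case using insert.hyps by simp
qed simp

text \<open>Independence enters only as a factorisation of characteristic functions, so the laws of
  the summands need not live on a common space. This is the form in which the tilted laws are
  available.\<close>

lemma berry_esseen_upper:
  fixes D :: "real measure" and X :: "'i \<Rightarrow> real measure"
  assumes D: "real_distribution D" "integrable D (\<lambda>x. x)" and I: "finite I"
    and X: "\<And>i. i \<in> I \<Longrightarrow> real_distribution (X i)"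
    and i1: "\<And>i. i \<in> I \<Longrightarrow> integrable (X i) (\<lambda>x. x)"
    and i2: "\<And>i. i \<in> I \<Longrightarrow> integrable (X i) (\<lambda>x. x\<^sup>2)"
    and i3: "\<And>i. i \<in> I \<Longrightarrow> integrable (X i) (\<lambda>x. \<bar>x\<bar> ^ 3)"
    and mean: "\<And>i. i \<in> I \<Longrightarrow> (\<integral>x. x \<partial>X i) = 0"
    and var: "(\<Sum>i\<in>I. \<integral>x. x\<^sup>2 \<partial>X i) = 1"
    and char: "\<And>t. char D t = (\<Prod>i\<in>I. char (X i) t)"
  defines "L \<equiv> \<Sum>i\<in>I. \<integral>x. \<bar>x\<bar> ^ 3 \<partial>X i"
  shows "measure D {a..} \<le> measure std_normal_distribution {a..} + 2.4 * L"
proof -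
  define v where "v i = (\<integral>x. x\<^sup>2 \<partial>X i)" for i
  define b where "b i = (\<integral>x. \<bar>x\<bar> ^ 3 \<partial>X i)" for i
  have v: "v i \<ge> 0" and b: "b i \<ge> 0" for i unfolding v_def b_def by auto
  have vs: "(\<Sum>i\<in>I. v i) = 1" using var by (simp add: v_def)
  have L: "L = (\<Sum>i\<in>I. b i)" by (simp add: L_def b_def)
  \<comment> \<open>Total variance 1 makes some summand nondegenerate, and Lyapunov's inequality
    passes this on to its third moment. The cut-off chosen next divides by \<open>L\<close>.\<close>
  have Lpos: "L > 0"
  proof -
    obtain j where j: "j \<in> I" "v j \<noteq> 0" using vs by (metis sum.neutral zero_neq_one)
    then have "0 < v j * sqrt (v j)" using v[of j] by (simp add: less_le)
    also have "\<dots> \<le> b j"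
      unfolding v_def b_def using j by (intro real_distribution.lyapunov_2_3 X i2 i3)
    also have "b j \<le> L" unfolding L using I b j by (intro member_le_sum) auto
    finally show ?thesis .
  qed
  \<comment> \<open>below this cut-off \<open>- t\<^sup>2 / 2 + 3 / 8 * L * t ^ 3 \<le> - t\<^sup>2 / 5\<close>\<close>
  define T where "T = 4 / (5 * L)"
  have T: "T > 0" using Lpos by (simp add: T_def)
  have bnd: "cmod (char D t - of_real (exp (- t\<^sup>2 / 2))) \<le> (0.3963 * L) * t ^ 3 * exp (- t\<^sup>2 / 5)"
    if t: "0 < t" "t < T" for t
  proof -
    let ?E = "\<lambda>i. exp (- v i * t\<^sup>2 / 2 + 3 / 8 * b i * t ^ 3)"
    let ?d = "\<lambda>i. 0.3963 * b i * t ^ 3"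
    have "exp (- t\<^sup>2 / 2) = (\<Prod>i\<in>I. exp (- v i * t\<^sup>2 / 2))"
    proof -
      have "(\<Sum>i\<in>I. - v i * t\<^sup>2 / 2) = - (\<Sum>i\<in>I. v i) * t\<^sup>2 / 2"
        by (simp add: sum_negf sum_distrib_right sum_divide_distrib)
      then show ?thesis using vs I by (simp flip: exp_sum)
    qed
    then have "cmod (char D t - of_real (exp (- t\<^sup>2 / 2)))
      = cmod ((\<Prod>i\<in>I. char (X i) t) - (\<Prod>i\<in>I. of_real (exp (- v i * t\<^sup>2 / 2))))"
      by (simp only: char of_real_prod)
    also have "\<dots> \<le> (\<Sum>i\<in>I. ?d i) * (\<Prod>i\<in>I. ?E i)"
    proof (rule norm_prod_diff_weighted[OF I])
      fix i assume i: "i \<in> I"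
      interpret Xi: real_distribution "X i" by (rule X[OF i])
      note ct = Xi.char_third_moment[OF i1[OF i] i2[OF i] i3[OF i] mean[OF i] t(1), folded v_def b_def]
      show "cmod (char (X i) t) \<le> ?E i" by (rule ct(1))
      show "cmod (char (X i) t - of_real (exp (- v i * t\<^sup>2 / 2))) \<le> ?d i * ?E i" by (rule ct(2))
      show "cmod (of_real (exp (- v i * t\<^sup>2 / 2))) \<le> ?E i" using b[of i] t by simp
    qed
    also have "(\<Sum>i\<in>I. ?d i) = (0.3963 * L) * t ^ 3"
      by (simp add: L sum_distrib_left sum_distrib_right mult_ac)
    also have "(\<Prod>i\<in>I. ?E i) = exp (- t\<^sup>2 / 2 + 3 / 8 * L * t ^ 3)"
    proof -
      have "(\<Sum>i\<in>I. - v i * t\<^sup>2 / 2 + 3 / 8 * b i * t ^ 3) = - (\<Sum>i\<in>I. v i) * t\<^sup>2 / 2 + 3 / 8 * L * t ^ 3"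
        unfolding L by (simp add: sum.distrib sum_subtractf sum_negf sum_distrib_left sum_distrib_right sum_divide_distrib)
      then show ?thesis using I vs by (simp flip: exp_sum)
    qed
    also have "\<dots> \<le> exp (- t\<^sup>2 / 5)"
    proof -
      have "L * t \<le> L * T" using t Lpos by (intro mult_left_mono) auto
      also have "L * T = 4 / 5" using Lpos by (simp add: T_def)
      finally have "(3 / 8 * t\<^sup>2) * (L * t) \<le> (3 / 8 * t\<^sup>2) * (4 / 5)" by (intro mult_left_mono) auto
      then show ?thesis by (simp add: power2_eq_square power3_eq_cube mult_ac)
    qed
    finally show ?thesis using Lpos t by (simp add: mult_left_mono)
  qed
  \<comment> \<open>The constant splits as 2.4 = 1.58 + 0.82: the excess of the majorant at cut-off
    4 / (5 * L), and the error of the characteristic function.\<close>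
  have "measure D {a..} \<le> measure std_normal_distribution {a..} + sqrt (2 * pi) / (2 * T)
    + 1.29 / pi * (0.3963 * L) * (5 / 4 * sqrt (5 * pi))"
    by (rule real_distribution.smoothing_inequality[OF D T]) (use Lpos bnd in auto)
  moreover have "sqrt (2 * pi) / (2 * T) \<le> 1.58 * L"
  proof -
    have "sqrt (2 * pi) \<le> 2.51" by (rule real_le_lsqrt) (use pi_approx in \<open>auto simp: power2_eq_square\<close>)
    then have "sqrt (2 * pi) * (5 / 8 * L) \<le> 2.51 * (5 / 8 * L)" using Lpos by (intro mult_right_mono) auto
    then show ?thesis using Lpos by (simp add: T_def)
  qed
  moreover have "1.29 / pi * (0.3963 * L) * (5 / 4 * sqrt (5 * pi)) \<le> 0.82 * L"
  proof -
    have s: "sqrt (5 * pi) \<le> 3.97" by (rule real_le_lsqrt) (use pi_approx in \<open>auto simp: power2_eq_square\<close>)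
    have "1.29 / pi \<le> 0.411" using pi_approx by (simp add: divide_simps)
    then have "1.29 / pi * (0.3963 * L) * (5 / 4 * sqrt (5 * pi)) \<le> 0.411 * (0.3963 * L) * (5 / 4 * 3.97)"
      using s Lpos by (intro mult_mono) auto
    then show ?thesis using Lpos by simp
  qed
  ultimately show ?thesis by simp
qed

section \<open>Reflection and the estimate for bounded intervals\<close>

lemma char_reflect: "real_distribution D \<Longrightarrow> char (distr D borel uminus) t = char D (- t)"
proof -
  assume "real_distribution D"
  then interpret real_distribution D .
  show ?thesis unfolding char_def by (subst integral_distr) auto
qed

lemma std_normal_reflect: "distr std_normal_distribution borel uminus = std_normal_distribution"
proof (rule Levy_uniqueness)
  interpret real_distribution std_normal_distribution by (rule real_dist_normal_dist)
  show "real_distribution (distr std_normal_distribution borel uminus)" by (rule real_distribution_distr) simp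
  show "char (distr std_normal_distribution borel uminus) = char std_normal_distribution"
    by (rule ext) (simp add: char_reflect real_dist_normal_dist char_std_normal_distribution)
qed (rule real_dist_normal_dist)

text \<open>The interval is the overlap of two closed half-lines that cover the line. Its measure is
  therefore the sum of theirs minus 1, and the one-sided error is paid twice, the second time for
  the reflected laws.\<close>

lemma berry_esseen_interval:
  fixes D :: "real measure" and X :: "'i \<Rightarrow> real measure"
  assumes D: "real_distribution D" "integrable D (\<lambda>x. x)" and I: "finite I"
    and X: "\<And>i. i \<in> I \<Longrightarrow> real_distribution (X i)"
    and i1: "\<And>i. i \<in> I \<Longrightarrow> integrable (X i) (\<lambda>x. x)"
    and i2: "\<And>i. i \<in> I \<Longrightarrow> integrable (X i) (\<lambda>x. x\<^sup>2)"
    and i3: "\<And>i. i \<in> I \<Longrightarrow> integrable (X i) (\<lambda>x. \<bar>x\<bar> ^ 3)"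
    and mean: "\<And>i. i \<in> I \<Longrightarrow> (\<integral>x. x \<partial>X i) = 0"
    and var: "(\<Sum>i\<in>I. \<integral>x. x\<^sup>2 \<partial>X i) = 1"
    and char: "\<And>t. char D t = (\<Prod>i\<in>I. char (X i) t)"
  defines "L \<equiv> \<Sum>i\<in>I. \<integral>x. \<bar>x\<bar> ^ 3 \<partial>X i"
  assumes ab: "a \<le> b"
  shows "measure D {a..b} \<le> measure std_normal_distribution {a..b} + 4.8 * L"
proof -
  interpret D: real_distribution D by fact
  interpret N: real_distribution std_normal_distribution by (rule real_dist_normal_dist)
  let ?r = "\<lambda>M. distr M borel (uminus :: real \<Rightarrow> real)"
  have rd: "real_distribution (?r M)" if "real_distribution M" for M
  proof -
    interpret real_distribution M by fact
    show ?thesis by (rule real_distribution_distr) simp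
  qed
  have int: "(\<integral>x. f x \<partial>?r M) = (\<integral>x. f (- x) \<partial>M)" "integrable (?r M) f \<longleftrightarrow> integrable M (\<lambda>x. f (- x))"
    if "real_distribution M" "f \<in> borel_measurable borel" for M and f :: "real \<Rightarrow> real"
  proof -
    interpret real_distribution M by fact
    show "(\<integral>x. f x \<partial>?r M) = (\<integral>x. f (- x) \<partial>M)" "integrable (?r M) f \<longleftrightarrow> integrable M (\<lambda>x. f (- x))"
      using that by (auto simp: integral_distr integrable_distr_eq)
  qed
  have even: "(\<integral>x. f x \<partial>?r M) = (\<integral>x. f x \<partial>M)" "integrable M f \<Longrightarrow> integrable (?r M) f"
    if "real_distribution M" "f \<in> borel_measurable borel" "\<And>x. f (- x) = f x" for M and f :: "real \<Rightarrow> real"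
    using int[OF that(1,2)] by (simp_all only: that(3))
  have odd: "integrable (?r M) (\<lambda>x. x)" "(\<integral>x. x \<partial>?r M) = - (\<integral>x. x \<partial>M)"
    if "real_distribution M" "integrable M (\<lambda>x. x)" for M
  proof -
    have m: "(\<lambda>x::real. x) \<in> borel_measurable borel" by simp
    have "integrable M (\<lambda>x. - x)" using that(2) by (rule Bochner_Integration.integrable_minus)
    then show "integrable (?r M) (\<lambda>x. x)" by (rule iffD2[OF int(2)[OF that(1) m]])
    have "(\<integral>x. x \<partial>?r M) = (\<integral>x. - x \<partial>M)" by (rule int(1)[OF that(1) m])
    also have "\<dots> = - (\<integral>x. x \<partial>M)" by (rule Bochner_Integration.integral_minus)
    finally show "(\<integral>x. x \<partial>?r M) = - (\<integral>x. x \<partial>M)" .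
  qed
  have "measure (?r D) {- b..} \<le> measure std_normal_distribution {- b..} + 2.4 * (\<Sum>i\<in>I. \<integral>x. \<bar>x\<bar> ^ 3 \<partial>?r (X i))"
  proof (rule berry_esseen_upper[where D = "?r D" and I = I and X = "\<lambda>i. ?r (X i)" and a = "- b"])
    show "real_distribution (?r D)" by (rule rd[OF D(1)])
    show "finite I" by fact
    show "integrable (?r D) (\<lambda>x. x)" by (rule odd(1)[OF D])
    show "char (?r D) t = (\<Prod>i\<in>I. char (?r (X i)) t)" for t
      unfolding char_reflect[OF D(1)] char by (intro prod.cong refl char_reflect[symmetric] X)
    have "(\<Sum>i\<in>I. \<integral>x. x\<^sup>2 \<partial>?r (X i)) = (\<Sum>i\<in>I. \<integral>x. x\<^sup>2 \<partial>X i)"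
      by (intro sum.cong refl even(1) X) auto
    then show "(\<Sum>i\<in>I. \<integral>x. x\<^sup>2 \<partial>?r (X i)) = 1" using var by simp
    fix i assume i: "i \<in> I"
    show "real_distribution (?r (X i))" by (rule rd[OF X[OF i]])
    show "integrable (?r (X i)) (\<lambda>x. x)" by (rule odd(1)[OF X[OF i] i1[OF i]])
    show "integrable (?r (X i)) (\<lambda>x. x\<^sup>2)" by (rule even(2)[OF X[OF i] _ _ i2[OF i]]) auto
    show "integrable (?r (X i)) (\<lambda>x. \<bar>x\<bar> ^ 3)" by (rule even(2)[OF X[OF i] _ _ i3[OF i]]) auto
    show "(\<integral>x. x \<partial>?r (X i)) = 0" unfolding odd(2)[OF X[OF i] i1[OF i]] mean[OF i] by simp
  qed
  also have "(\<Sum>i\<in>I. \<integral>x. \<bar>x\<bar> ^ 3 \<partial>?r (X i)) = L"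
    unfolding L_def by (intro sum.cong refl even(1) X) auto
  also have "measure std_normal_distribution {- b..} = measure (?r std_normal_distribution) {- b..}"
    by (simp only: std_normal_reflect)
  also have "measure (?r std_normal_distribution) {- b..} = measure std_normal_distribution {..b}"
    by (subst measure_distr) (auto intro!: arg_cong[where f = "measure _"])
  also have "measure (?r D) {- b..} = measure D {..b}"
    by (subst measure_distr) (auto intro!: arg_cong[where f = "measure _"])
  finally have lower: "measure D {..b} \<le> measure std_normal_distribution {..b} + 2.4 * L" .
  have upper: "measure D {a..} \<le> measure std_normal_distribution {a..} + 2.4 * L"
    unfolding L_def by (rule berry_esseen_upper[where D = D and I = I and X = X and a = a]) (fact D I X i1 i2 i3 mean var char)+
  have split: "measure M {a..b} = measure M {a..} + measure M {..b} - 1" if "real_distribution M" for M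
  proof -
    interpret real_distribution M by fact
    have "measure M ({..b} \<union> {b<..}) = measure M {..b} + measure M {b<..}" by (rule finite_measure_Union) auto
    moreover have "{..b} \<union> {b<..} = space M" by auto
    moreover have "measure M ({a..b} \<union> {b<..}) = measure M {a..b} + measure M {b<..}" by (rule finite_measure_Union) auto
    moreover have "{a..b} \<union> {b<..} = {a..}" using ab by auto
    ultimately show ?thesis using prob_space by simp
  qed
  show ?thesis using lower upper split[OF D(1)] split[OF real_dist_normal_dist] by simp
qed

section \<open>Exponential functionals and the Mills ratio\<close>

text \<open>The truncated exponential is a mixture of indicators of intervals starting at \<open>\<delta>\<close>.\<close>

lemma exp_functional_compare:
  fixes P Q :: "real measure"
  assumes P: "real_distribution P" and Q: "real_distribution Q" and \<mu>: "\<mu> > 0" and \<eta>: "\<eta> \<ge> 0"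
    and le: "\<And>a b. a \<le> b \<Longrightarrow> measure P {a..b} \<le> measure Q {a..b} + \<eta>"
  shows "(\<integral>\<^sup>+u. ennreal (exp (- \<mu> * (u - \<delta>)) * indicator {\<delta>..} u) \<partial>P)
    \<le> (\<integral>\<^sup>+u. ennreal (exp (- \<mu> * (u - \<delta>)) * indicator {\<delta>..} u) \<partial>Q) + ennreal \<eta>"
proof -
  define w where "w s = ennreal (\<mu> * exp (- \<mu> * s)) * indicator {0..} s" for s :: real
  have [measurable]: "w \<in> borel_measurable borel" unfolding w_def by measurable
  have tail: "(\<integral>\<^sup>+s. ennreal (\<mu> * exp (- \<mu> * s)) * indicator {a..} s \<partial>lborel) = ennreal (exp (- \<mu> * a))" for a
  proof -
    have "((\<lambda>s. - exp (- \<mu> * s)) \<longlongrightarrow> 0) at_top" using \<mu> by real_asymp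
    then have "(\<integral>\<^sup>+s. ennreal (\<mu> * exp (- \<mu> * s)) * indicator {a..} s \<partial>lborel) = 0 - (- exp (- \<mu> * a))"
      using \<mu> by (intro nn_integral_FTC_atLeast) (auto intro!: derivative_eq_intros)
    then show ?thesis by simp
  qed
  have rep: "(\<integral>\<^sup>+u. ennreal (exp (- \<mu> * (u - \<delta>)) * indicator {\<delta>..} u) \<partial>D)
     = (\<integral>\<^sup>+s. w s * emeasure D {\<delta>..\<delta> + s} \<partial>lborel)" if "real_distribution D" for D
  proof -
    interpret D: real_distribution D by fact
    interpret PS: pair_sigma_finite D lborel ..
    have "(\<integral>\<^sup>+s. w s * indicator {\<delta>..\<delta> + s} u \<partial>lborel) = ennreal (exp (- \<mu> * (u - \<delta>)) * indicator {\<delta>..} u)" for u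
    proof (cases "\<delta> \<le> u")
      case True
      then have "(\<integral>\<^sup>+s. w s * indicator {\<delta>..\<delta> + s} u \<partial>lborel)
        = (\<integral>\<^sup>+s. ennreal (\<mu> * exp (- \<mu> * s)) * indicator {u - \<delta>..} s \<partial>lborel)"
        by (intro nn_integral_cong) (auto simp: w_def indicator_def)
      then show ?thesis using True by (simp only: tail) simp
    qed simp
    then have "(\<integral>\<^sup>+u. ennreal (exp (- \<mu> * (u - \<delta>)) * indicator {\<delta>..} u) \<partial>D)
      = (\<integral>\<^sup>+u. \<integral>\<^sup>+s. w s * indicator {(u, s). \<delta> \<le> u \<and> u \<le> \<delta> + s} (u, s) \<partial>lborel \<partial>D)"
      by (simp add: indicator_def)
    also have "\<dots> = (\<integral>\<^sup>+s. \<integral>\<^sup>+u. w s * indicator {(u, s). \<delta> \<le> u \<and> u \<le> \<delta> + s} (u, s) \<partial>D \<partial>lborel)"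
      by (rule PS.Fubini'[symmetric]) measurable
    also have "\<dots> = (\<integral>\<^sup>+s. w s * emeasure D {\<delta>..\<delta> + s} \<partial>lborel)"
    proof (rule nn_integral_cong)
      fix s
      have "(\<integral>\<^sup>+u. w s * indicator {(u, s). \<delta> \<le> u \<and> u \<le> \<delta> + s} (u, s) \<partial>D) = (\<integral>\<^sup>+u. w s * indicator {\<delta>..\<delta> + s} u \<partial>D)"
        by (intro nn_integral_cong) (auto simp: indicator_def)
      also have "\<dots> = w s * emeasure D {\<delta>..\<delta> + s}" by (rule nn_integral_cmult_indicator) simp
      finally show "(\<integral>\<^sup>+u. w s * indicator {(u, s). \<delta> \<le> u \<and> u \<le> \<delta> + s} (u, s) \<partial>D) = w s * emeasure D {\<delta>..\<delta> + s}" .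
    qed
    finally show ?thesis .
  qed
  interpret P: real_distribution P by fact
  interpret Q: real_distribution Q by fact
  interpret PQ: pair_sigma_finite Q lborel ..
  have [measurable]: "(\<lambda>s. emeasure Q {\<delta>..\<delta> + s}) \<in> borel_measurable lborel"
  proof -
    have "{p \<in> space (lborel \<Otimes>\<^sub>M Q). \<delta> \<le> snd p \<and> snd p \<le> \<delta> + fst p} \<in> sets (lborel \<Otimes>\<^sub>M Q)"
      by measurable
    from Q.measurable_emeasure_Pair[OF this] show ?thesis
      by (simp add: vimage_def space_pair_measure atLeastAtMost_def atLeast_def atMost_def Int_def)
  qed
  have "(\<integral>\<^sup>+s. w s * emeasure P {\<delta>..\<delta> + s} \<partial>lborel) \<le> (\<integral>\<^sup>+s. w s * emeasure Q {\<delta>..\<delta> + s} + w s * ennreal \<eta> \<partial>lborel)"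
  proof (rule nn_integral_mono)
    fix s
    show "w s * emeasure P {\<delta>..\<delta> + s} \<le> w s * emeasure Q {\<delta>..\<delta> + s} + w s * ennreal \<eta>"
    proof (cases "s \<ge> 0")
      case True
      then have "emeasure P {\<delta>..\<delta> + s} \<le> emeasure Q {\<delta>..\<delta> + s} + ennreal \<eta>"
        using le[of \<delta> "\<delta> + s"] \<eta> by (simp add: P.emeasure_eq_measure Q.emeasure_eq_measure flip: ennreal_plus)
      from mult_left_mono[OF this, of "w s"] show ?thesis by (simp add: distrib_left)
    qed (simp add: w_def)
  qed
  also have "\<dots> = (\<integral>\<^sup>+s. w s * emeasure Q {\<delta>..\<delta> + s} \<partial>lborel) + (\<integral>\<^sup>+s. w s * ennreal \<eta> \<partial>lborel)"
    by (rule nn_integral_add) auto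
  \<comment> \<open>The mixing weight \<open>w\<close> is the exponential density of rate \<mu>. Its
    total mass 1 is why the discrepancy \<eta> of the intervals is not amplified.\<close>
  also have "(\<integral>\<^sup>+s. w s * ennreal \<eta> \<partial>lborel) = ennreal \<eta>"
  proof -
    have "(\<integral>\<^sup>+s. w s \<partial>lborel) = 1" using tail[of 0] unfolding w_def by simp
    then show ?thesis by (subst nn_integral_multc) auto
  qed
  finally show ?thesis unfolding rep[OF P] rep[OF Q] .
qed

section \<open>The Mills ratio as a Laplace transform\<close>

lemma integrable_exp_std_normal:
  "0 \<le> x \<Longrightarrow> integrable lborel (\<lambda>u. indicator {0..} u * (exp (- x * u) * std_normal_density u))"
proof (rule Bochner_Integration.integrable_bound)
  show "integrable lborel std_normal_density" by simp
  assume x: "0 \<le> x"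
  show "AE u in lborel. norm (indicator {0..} u * (exp (- x * u) * std_normal_density u)) \<le> norm (std_normal_density u)"
    using x by (intro AE_I2) (auto simp: indicator_def abs_mult mult_left_le_one_le)
qed measurable

text \<open>Shifting the tail integral by x and completing the square frees the factor exp (- x^2 /
  2), which the definition of \<open>Mills\<close> cancels. Monotonicity and difference bounds can
  then be read off the integrand.\<close>

lemma Mills_integral:
  "Mills x = (\<integral>u. indicator {0..} u * (exp (- x * u) * std_normal_density u) \<partial>lborel)"
proof -
  have "1 = (\<integral>t. std_normal_density t \<partial>lborel)" using integral_std_normal_moment_even[of 0] by simp
  also have "\<dots> = (\<integral>t. indicator {..x} t *\<^sub>R std_normal_density t + indicator {x..} t *\<^sub>R std_normal_density t \<partial>lborel)"
    using AE_lborel_singleton[of x]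
    by (intro integral_cong_AE) (auto simp: indicator_def elim!: eventually_mono)
  also have "\<dots> = Phi x + (\<integral>t. indicator {x..} t *\<^sub>R std_normal_density t \<partial>lborel)"
    unfolding Phi_def set_lebesgue_integral_def
    by (intro Bochner_Integration.integral_add integrable_mult_indicator) auto
  also have "(\<integral>t. indicator {x..} t *\<^sub>R std_normal_density t \<partial>lborel)
     = (\<integral>u. indicator {x..} (x + 1 * u) *\<^sub>R std_normal_density (x + 1 * u) \<partial>lborel)"
    by (subst lborel_integral_real_affine[where t = x and c = 1]) auto
  also have "\<dots> = (\<integral>u. exp (- x\<^sup>2 / 2) * (indicator {0..} u * (exp (- x * u) * std_normal_density u)) \<partial>lborel)"
  proof (rule Bochner_Integration.integral_cong[OF refl])
    fix u
    have "- (x + u)\<^sup>2 / 2 = - x\<^sup>2 / 2 + (- x * u + - u\<^sup>2 / 2)"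
      by (simp add: power2_eq_square field_simps)
    then show "indicator {x..} (x + 1 * u) *\<^sub>R std_normal_density (x + 1 * u)
       = exp (- x\<^sup>2 / 2) * (indicator {0..} u * (exp (- x * u) * std_normal_density u))"
      unfolding std_normal_density_def by (simp only: exp_add mult_1) (simp add: indicator_def)
  qed
  finally have "1 - Phi x = exp (- x\<^sup>2 / 2) * (\<integral>u. indicator {0..} u * (exp (- x * u) * std_normal_density u) \<partial>lborel)"
    by simp
  then show ?thesis by (simp add: Mills_def flip: exp_add)
qed

lemma Mills_antimono: "0 \<le> x \<Longrightarrow> x \<le> y \<Longrightarrow> Mills y \<le> Mills x"
  unfolding Mills_integral
proof (intro integral_mono integrable_exp_std_normal)
  fix u :: real assume "0 \<le> x" "x \<le> y"
  then show "indicator {0..} u * (exp (- y * u) * std_normal_density u)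
    \<le> indicator {0..} u * (exp (- x * u) * std_normal_density u)"
    by (cases "u \<ge> 0") (auto intro!: mult_right_mono)
qed auto

text \<open>For u > 0 the difference of the exponentials is nonnegative, so the density may be
  replaced by its maximum; the remaining exponentials integrate to 1 / y and 1 / x.\<close>

lemma Mills_diff_le:
  assumes y: "0 < y" "y \<le> x"
  shows "Mills y \<le> Mills x + (1 / y - 1 / x) / sqrt (2 * pi)"
proof -
  have x: "x > 0" using y by simp
  have i: "integrable lborel (\<lambda>u. indicator {0<..} u * exp (- z * u))"
    and v: "(\<integral>u. indicator {0<..} u * exp (- z * u) \<partial>lborel) = 1 / z" if "z > 0" for z :: real
  proof -
    show "integrable lborel (\<lambda>u. indicator {0<..} u * exp (- z * u))"
      using integrable_I0i_exp_mscale[OF that] by (simp add: set_integrable_def mult.commute)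
    show "(\<integral>u. indicator {0<..} u * exp (- z * u) \<partial>lborel) = 1 / z"
      using LBINT_I0i_exp_mscale[OF that]
      by (simp add: interval_lebesgue_integral_def set_lebesgue_integral_def mult.commute zero_ereal_def)
  qed
  have "Mills y - Mills x = (\<integral>u. indicator {0..} u * (exp (- y * u) * std_normal_density u)
      - indicator {0..} u * (exp (- x * u) * std_normal_density u) \<partial>lborel)"
    unfolding Mills_integral using x y by (intro Bochner_Integration.integral_diff[symmetric] integrable_exp_std_normal) auto
  also have "\<dots> \<le> (\<integral>u. (indicator {0<..} u * exp (- y * u) - indicator {0<..} u * exp (- x * u)) / sqrt (2 * pi) \<partial>lborel)"
  proof (intro integral_mono_AE)
    show "integrable lborel (\<lambda>u. indicator {0..} u * (exp (- y * u) * std_normal_density u)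
      - indicator {0..} u * (exp (- x * u) * std_normal_density u))"
      using x y by (intro Bochner_Integration.integrable_diff integrable_exp_std_normal) auto
    show "integrable lborel (\<lambda>u. (indicator {0<..} u * exp (- y * u) - indicator {0<..} u * exp (- x * u)) / sqrt (2 * pi))"
      using x y by (intro Bochner_Integration.integrable_divide Bochner_Integration.integrable_diff i) auto
    show "AE u in lborel. indicator {0..} u * (exp (- y * u) * std_normal_density u)
      - indicator {0..} u * (exp (- x * u) * std_normal_density u)
      \<le> (indicator {0<..} u * exp (- y * u) - indicator {0<..} u * exp (- x * u)) / sqrt (2 * pi)"
      using AE_lborel_singleton[of 0]
    proof eventually_elim
      case (elim u)
      show ?case
      proof (cases "u > 0")
        case True
        then have "exp (- y * u) - exp (- x * u) \<ge> 0" using y by simp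
        from mult_left_mono[OF std_normal_density_le[of u] this] show ?thesis
          using True by (simp add: algebra_simps diff_divide_distrib)
      qed (use elim in \<open>auto simp: indicator_def\<close>)
    qed
  qed
  also have "\<dots> = (1 / y - 1 / x) / sqrt (2 * pi)"
    using x y i[of x] i[of y] v[of x] v[of y] by simp
  finally show ?thesis by simp
qed

text \<open>After a shift by \<delta> the density is evaluated at \<delta> + u instead of u. For
  \<delta> \<ge> 0 this is smaller, and this is the reason for keeping the tilted mean at or below
  the threshold.\<close>

lemma normal_exp_functional_le:
  assumes \<mu>: "\<mu> \<ge> 0" and \<delta>: "\<delta> \<ge> 0"
  shows "(\<integral>\<^sup>+u. ennreal (exp (- \<mu> * (u - \<delta>)) * indicator {\<delta>..} u) \<partial>std_normal_distribution) \<le> ennreal (Mills \<mu>)"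
proof -
  have "(\<integral>\<^sup>+u. ennreal (exp (- \<mu> * (u - \<delta>)) * indicator {\<delta>..} u) \<partial>std_normal_distribution)
    = (\<integral>\<^sup>+u. ennreal (std_normal_density u) * ennreal (exp (- \<mu> * (u - \<delta>)) * indicator {\<delta>..} u) \<partial>lborel)"
    by (subst nn_integral_density) auto
  also have "\<dots> = (\<integral>\<^sup>+u. ennreal (std_normal_density (\<delta> + 1 * u)) * ennreal (exp (- \<mu> * ((\<delta> + 1 * u) - \<delta>)) * indicator {\<delta>..} (\<delta> + 1 * u)) \<partial>lborel)"
    by (subst nn_integral_real_affine[where t = \<delta> and c = 1]) auto
  also have "\<dots> \<le> (\<integral>\<^sup>+u. ennreal (indicator {0..} u * (exp (- \<mu> * u) * std_normal_density u)) \<partial>lborel)"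
  proof (rule nn_integral_mono)
    fix u :: real
    show "ennreal (std_normal_density (\<delta> + 1 * u)) * ennreal (exp (- \<mu> * ((\<delta> + 1 * u) - \<delta>)) * indicator {\<delta>..} (\<delta> + 1 * u))
      \<le> ennreal (indicator {0..} u * (exp (- \<mu> * u) * std_normal_density u))"
    proof (cases "u \<ge> 0")
      case True
      then have "u\<^sup>2 \<le> (\<delta> + u)\<^sup>2" using \<delta> by (intro power_mono) auto
      then have "std_normal_density (\<delta> + u) \<le> std_normal_density u"
        unfolding std_normal_density_def by (intro mult_left_mono) auto
      then have "std_normal_density (\<delta> + u) * exp (- \<mu> * u) \<le> std_normal_density u * exp (- \<mu> * u)"
        by (intro mult_right_mono) auto
      then show ?thesis using True by (simp add: ennreal_leI mult.commute flip: ennreal_mult)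
    qed simp
  qed
  also have "\<dots> = ennreal (Mills \<mu>)"
    unfolding Mills_integral using \<mu> by (intro nn_integral_eq_integral integrable_exp_std_normal) (auto simp: indicator_def)
  finally show ?thesis .
qed

lemma normal_tail_le: "\<delta> \<ge> 0 \<Longrightarrow> measure std_normal_distribution {\<delta>..} \<le> Mills 0"
proof -
  assume \<delta>: "\<delta> \<ge> 0"
  interpret real_distribution std_normal_distribution by (rule real_dist_normal_dist)
  have "ennreal (measure std_normal_distribution {\<delta>..}) = (\<integral>\<^sup>+u. indicator {\<delta>..} u \<partial>std_normal_distribution)"
    by (simp add: emeasure_eq_measure)
  also have "\<dots> = (\<integral>\<^sup>+u. ennreal (exp (- 0 * (u - \<delta>)) * indicator {\<delta>..} u) \<partial>std_normal_distribution)"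
    by (intro nn_integral_cong) (auto simp: indicator_def)
  also have "\<dots> \<le> ennreal (Mills 0)" by (rule normal_exp_functional_le) (use \<delta> in auto)
  finally show ?thesis
    by (subst (asm) ennreal_le_iff) (auto simp: Mills_integral intro!: integral_nonneg_AE)
qed

section \<open>Moments under Bernstein's condition\<close>

text \<open>Multiplying by a geometric series raises the exponent by one, and the hockey-stick
  identity adds up the coefficients. The series appears because fact (j + k) / fact k is fact j
  times a binomial coefficient.\<close>

lemma binomial_series_sums:
  fixes q :: real
  assumes q: "0 \<le> q" "q < 1"
  shows "(\<lambda>k. real ((m + k) choose m) * q ^ k) sums (1 / (1 - q) ^ Suc m)"
proof (induction m)
  case 0
  then show ?case using geometric_sums[of q] q by simp
next
  case (Suc m)
  let ?a = "\<lambda>k. real ((m + k) choose m) * q ^ k"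
  have "(\<lambda>k. \<Sum>i\<le>k. ?a i * q ^ (k - i)) sums ((\<Sum>k. ?a k) * (\<Sum>k. q ^ k))"
    using Suc.IH q geometric_sums[of q] by (intro Cauchy_product_sums) (auto simp: sums_iff abs_mult)
  also have "(\<Sum>k. ?a k) * (\<Sum>k. q ^ k) = 1 / (1 - q) ^ Suc (Suc m)"
    using Suc.IH q by (simp add: sums_iff suminf_geometric)
  also have "(\<lambda>k. \<Sum>i\<le>k. ?a i * q ^ (k - i)) = (\<lambda>k. real ((Suc m + k) choose Suc m) * q ^ k)"
  proof
    fix k
    have "(\<Sum>i\<le>k. ?a i * q ^ (k - i)) = (\<Sum>i\<le>k. real ((m + i) choose m)) * q ^ k"
      unfolding sum_distrib_right by (intro sum.cong) (auto simp: mult.assoc simp flip: power_add)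
    also have "(\<Sum>i\<le>k. real ((m + i) choose m)) = real ((Suc m + k) choose Suc m)"
      using choose_rising_sum(1)[of m k] by (simp flip: of_nat_sum)
    finally show "(\<Sum>i\<le>k. ?a i * q ^ (k - i)) = real ((Suc m + k) choose Suc m) * q ^ k" .
  qed
  finally show ?case .
qed

text \<open>When \<open>c\<close> is the mean of \<open>x\<close>, the linear term integrates to zero, so that centering costs only a
  factor \<open>3 / 2\<close> in the third absolute moment.\<close>

lemma cube_dist_le:
  fixes x c :: real
  assumes c: "c \<ge> 0"
  shows "\<bar>x - c\<bar> ^ 3 \<le> 3 / 2 * \<bar>x\<bar> ^ 3 - 6 * c\<^sup>2 * (x - c)"
proof -
  consider (ge) "x \<ge> c" | (mid) "0 \<le> x" "x < c" | (neg) "x < 0" by linarith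
  then show ?thesis
  proof cases
    case ge
    define d where "d = x - c"
    have d: "d \<ge> 0" and x: "x = c + d" using ge by (auto simp: d_def)
    \<comment> \<open>The difference of the two sides is 3 / 2 * c * (c^2 - c * d + 3 * d^2) + d^3 /
      2; the quadratic form is completed to a sum of squares.\<close>
    have "0 \<le> 3 / 2 * c * ((c - d / 2)\<^sup>2 + 11 / 4 * d\<^sup>2) + d ^ 3 / 2" using c d by simp
    then show ?thesis using c d unfolding x by (simp add: power2_eq_square power3_eq_cube algebra_simps)
  next
    case mid
    define d where "d = c - x"
    have d: "0 \<le> d" "d \<le> c" and x: "x = c - d" using mid by (auto simp: d_def)
    have "d * d\<^sup>2 \<le> d * c\<^sup>2" using d by (intro mult_left_mono power_mono) auto
    then have "d * d\<^sup>2 \<le> c\<^sup>2 * d" by (simp only: mult.commute)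
    moreover have "0 \<le> \<bar>x\<bar> ^ 3" "0 \<le> c\<^sup>2 * d" using d by auto
    moreover have "\<bar>x - c\<bar> ^ 3 = d * d\<^sup>2" "c\<^sup>2 * (x - c) = - (c\<^sup>2 * d)"
      using d by (simp_all add: x power3_eq_cube power2_eq_square)
    ultimately show ?thesis by linarith
  next
    case neg
    define y where "y = - x"
    have y: "y > 0" and x: "x = - y" using neg by (auto simp: y_def)
    \<comment> \<open>For c = 1 the cubic has its minimum over positive y at 2 + sqrt 2. The
      rational number 171 / 50 lies close to it, so that the terms left over are small but
      positive.\<close>
    have "3 / 2 * y ^ 3 + 6 * c\<^sup>2 * (y + c) - (y + c) ^ 3
      = (y - 171 / 50 * c)\<^sup>2 * (y / 2 + 21 / 50 * c) + 123 / 5000 * (c\<^sup>2 * y) + 10939 / 125000 * c ^ 3"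
      by (simp add: power2_eq_square power3_eq_cube field_simps)
    also have "\<dots> \<ge> 0" using c y by simp
    finally have "(y + c) ^ 3 \<le> 3 / 2 * y ^ 3 - 6 * c\<^sup>2 * (- (y + c))"
      unfolding mult_minus_right by linarith
    moreover have "\<bar>x - c\<bar> = y + c" "\<bar>x\<bar> = y" "x - c = - (y + c)" using c y by (auto simp: x)
    ultimately show ?thesis by (simp only:)
  qed
qed

lemma power_div_fact_le_exp:
  fixes y :: real
  assumes "y \<ge> 0" shows "y ^ j / fact j \<le> exp y"
proof -
  have "(\<lambda>k. y ^ k / fact k) sums exp y"
    using exp_converges[of y] by (simp add: divide_inverse_commute)
  then show ?thesis
    using assms sum_le_suminf[of "\<lambda>k. y ^ k / fact k" "{j}"] by (auto simp: sums_iff)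
qed

locale bernstein_rv = prob_space M for M :: "'a measure" +
  fixes X :: "'a \<Rightarrow> real" and \<epsilon> :: real
  assumes rv [measurable]: "X \<in> borel_measurable M"
    and moment [simp]: "integrable M (\<lambda>\<omega>. X \<omega> ^ k)"
    and mean: "expectation X = 0"
    and eps: "\<epsilon> > 0"
    and bern: "k \<ge> 3 \<Longrightarrow> \<bar>expectation (\<lambda>\<omega>. X \<omega> ^ k)\<bar> \<le> 1/2 * fact k * \<epsilon> ^ (k - 2) * expectation (\<lambda>\<omega>. (X \<omega>)\<^sup>2)"
begin

definition v where "v = expectation (\<lambda>\<omega>. (X \<omega>)\<^sup>2)"

lemma v_nonneg: "v \<ge> 0" unfolding v_def by simp

lemma moment_le: "k \<ge> 2 \<Longrightarrow> expectation (\<lambda>\<omega>. X \<omega> ^ k) \<le> 1/2 * fact k * \<epsilon> ^ (k - 2) * v"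
  using bern[of k] by (cases "k = 2") (auto simp: v_def)

text \<open>The variance of X^2 is nonnegative, so v^2 is at most the fourth moment, which
  Bernstein's condition bounds by 12 * \<epsilon>^2 * v since fact 4 / 2 = 12.\<close>

lemma v_le: "v \<le> 12 * \<epsilon>\<^sup>2"
proof (cases "v = 0")
  case False
  have i: "integrable M (\<lambda>\<omega>. (X \<omega>)\<^sup>2)" "integrable M (\<lambda>\<omega>. X \<omega> ^ 4)" by auto
  have "0 \<le> expectation (\<lambda>\<omega>. ((X \<omega>)\<^sup>2 - v)\<^sup>2)" by simp
  also have "(\<lambda>\<omega>. ((X \<omega>)\<^sup>2 - v)\<^sup>2) = (\<lambda>\<omega>. X \<omega> ^ 4 - 2 * v * (X \<omega>)\<^sup>2 + v\<^sup>2)"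
    by (rule ext) (simp add: power2_eq_square power4_eq_xxxx algebra_simps)
  also have "expectation (\<lambda>\<omega>. X \<omega> ^ 4 - 2 * v * (X \<omega>)\<^sup>2 + v\<^sup>2) = expectation (\<lambda>\<omega>. X \<omega> ^ 4) - 2 * v * v + v\<^sup>2"
    using i by (simp add: prob_space v_def)
  finally have "v * v \<le> expectation (\<lambda>\<omega>. X \<omega> ^ 4)" by (simp add: power2_eq_square)
  also have "\<dots> \<le> 12 * \<epsilon>\<^sup>2 * v" using moment_le[of 4] by (simp add: fact_numeral)
  finally show ?thesis using False v_nonneg by simp
qed (use eps in simp)

text \<open>Bernstein's condition controls signed moments, so odd absolute moments are not directly
  bounded. The hyperbolic cosine involves even powers only, and its series of nonnegative terms can
  be integrated term by term. The summand 1 in 1 + v / \<epsilon>^2 accounts for the term k =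
  0.\<close>

lemma integrable_exp_abs:
  assumes l: "0 \<le> l" "l * \<epsilon> < 1"
  shows "integrable M (\<lambda>\<omega>. exp (l * \<bar>X \<omega>\<bar>))"
proof -
  have cosh: "(\<lambda>k. (l * x) ^ (2 * k) / fact (2 * k)) sums cosh (l * x)" for x
  proof -
    have "(\<lambda>k. if even k then (l * x) ^ k / fact k else 0) sums cosh (l * x)"
      using cosh_converges[of "l * x"] by (simp add: divide_inverse_commute if_distrib scaleR_conv_of_real cong: if_cong)
    moreover have "odd n" if "n \<notin> range ((*) 2)" for n :: nat
      using that by (metis evenE rangeI)
    ultimately show ?thesis
      using sums_mono_reindex[of "\<lambda>k. 2 * k" "\<lambda>k. if even k then (l * x) ^ k / fact k else 0" "cosh (l * x)"]
      by (simp add: strict_mono_def)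
  qed
  let ?q = "(l * \<epsilon>)\<^sup>2"
  have q: "0 \<le> ?q" "?q < 1" using l eps power_strict_mono[of "l * \<epsilon>" 1 2] by auto
  have borel_measurable_cosh_X [measurable]: "(\<lambda>\<omega>. cosh (l * X \<omega>)) \<in> borel_measurable M"
    unfolding cosh_field_def by measurable
  have tm: "(\<integral>\<^sup>+\<omega>. ennreal ((l * X \<omega>) ^ (2 * k) / fact (2 * k)) \<partial>M) \<le> ennreal ((1 + v / \<epsilon>\<^sup>2) * ?q ^ k)" for k
  proof -
    have "(\<integral>\<^sup>+\<omega>. ennreal ((l * X \<omega>) ^ (2 * k) / fact (2 * k)) \<partial>M)
      = ennreal (expectation (\<lambda>\<omega>. (l * X \<omega>) ^ (2 * k) / fact (2 * k)))"
      by (rule nn_integral_eq_integral) (auto simp: power_mult_distrib simp del: power_mult)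
    also have "expectation (\<lambda>\<omega>. (l * X \<omega>) ^ (2 * k) / fact (2 * k)) \<le> (1 + v / \<epsilon>\<^sup>2) * ?q ^ k"
    proof (cases "k = 0")
      case True
      then show ?thesis using v_nonneg eps by (simp add: prob_space)
    next
      case False
      then have "2 * k \<ge> 2" by simp
      have "expectation (\<lambda>\<omega>. (l * X \<omega>) ^ (2 * k) / fact (2 * k)) = l ^ (2 * k) / fact (2 * k) * expectation (\<lambda>\<omega>. X \<omega> ^ (2 * k))"
        by (simp add: power_mult_distrib)
      also have "\<dots> \<le> l ^ (2 * k) / fact (2 * k) * (1/2 * fact (2 * k) * \<epsilon> ^ (2 * k - 2) * v)"
        using l by (intro mult_left_mono moment_le) (use \<open>2 * k \<ge> 2\<close> in auto)
      also have "\<dots> = 1/2 * v / \<epsilon>\<^sup>2 * ?q ^ k"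
      proof -
        have "\<epsilon> ^ (2 * k) = \<epsilon> ^ (2 * k - 2) * \<epsilon>\<^sup>2" using \<open>2 * k \<ge> 2\<close> by (metis le_add_diff_inverse2 power_add)
        then show ?thesis using eps by (simp add: power_mult_distrib flip: power_mult)
      qed
      also have "\<dots> \<le> (1 + v / \<epsilon>\<^sup>2) * ?q ^ k"
      proof (intro mult_right_mono)
        have "1/2 * v / \<epsilon>\<^sup>2 = (v / \<epsilon>\<^sup>2) / 2" "0 \<le> v / \<epsilon>\<^sup>2" using v_nonneg by auto
        then show "1/2 * v / \<epsilon>\<^sup>2 \<le> 1 + v / \<epsilon>\<^sup>2" by linarith
      qed simp
      finally show ?thesis .
    qed
    finally show ?thesis by (simp add: ennreal_leI)
  qed
  have "(\<integral>\<^sup>+\<omega>. ennreal (cosh (l * X \<omega>)) \<partial>M) = (\<integral>\<^sup>+\<omega>. (\<Sum>k. ennreal ((l * X \<omega>) ^ (2 * k) / fact (2 * k))) \<partial>M)"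
    using cosh by (intro nn_integral_cong) (subst suminf_ennreal2, auto simp: sums_iff)
  also have "\<dots> = (\<Sum>k. \<integral>\<^sup>+\<omega>. ennreal ((l * X \<omega>) ^ (2 * k) / fact (2 * k)) \<partial>M)"
    by (rule nn_integral_suminf) measurable
  also have "\<dots> \<le> (\<Sum>k. ennreal ((1 + v / \<epsilon>\<^sup>2) * ?q ^ k))"
    by (intro suminf_le tm) auto
  also have "\<dots> = ennreal (\<Sum>k. (1 + v / \<epsilon>\<^sup>2) * ?q ^ k)"
    using q v_nonneg by (intro suminf_ennreal2) (auto intro!: summable_mult mult_nonneg_nonneg add_nonneg_nonneg summable_geometric)
  also have "\<dots> < \<infinity>" by simp
  finally have "integrable M (\<lambda>\<omega>. cosh (l * X \<omega>))"
    by (intro integrableI_nonneg borel_measurable_cosh_X) (auto simp: cosh_real_nonneg)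
  then have "integrable M (\<lambda>\<omega>. 2 * cosh (l * X \<omega>))" by simp
  then show ?thesis
  proof (rule Bochner_Integration.integrable_bound)
    show "AE \<omega> in M. norm (exp (l * \<bar>X \<omega>\<bar>)) \<le> norm (2 * cosh (l * X \<omega>))"
    proof (intro AE_I2)
      fix \<omega>
      have "exp (l * \<bar>X \<omega>\<bar>) \<le> exp (l * X \<omega>) + exp (- (l * X \<omega>))" by (simp add: abs_if)
      also have "\<dots> = 2 * cosh (l * X \<omega>)" by (simp add: cosh_field_def)
      finally show "norm (exp (l * \<bar>X \<omega>\<bar>)) \<le> norm (2 * cosh (l * X \<omega>))" by simp
    qed
  qed measurable
qed

text \<open>The strict inequality l * \<epsilon> < 1 leaves room for a larger exponent l', and exp
  ((l' - l) * \<bar>X\<bar>) absorbs the power.\<close>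

lemma integrable_power_exp_abs:
  assumes l: "0 \<le> l" "l * \<epsilon> < 1"
  shows "integrable M (\<lambda>\<omega>. \<bar>X \<omega>\<bar> ^ j * exp (l * \<bar>X \<omega>\<bar>))"
proof -
  obtain l' where l': "l < l'" "l' * \<epsilon> < 1"
    using dense[of l "1 / \<epsilon>"] l eps by (auto simp: field_simps)
  have "integrable M (\<lambda>\<omega>. (fact j / (l' - l) ^ j) * exp (l' * \<bar>X \<omega>\<bar>))"
    using l l' by (intro integrable_mult_right integrable_exp_abs) auto
  then show ?thesis
  proof (rule Bochner_Integration.integrable_bound)
    show "AE \<omega> in M. norm (\<bar>X \<omega>\<bar> ^ j * exp (l * \<bar>X \<omega>\<bar>)) \<le> norm ((fact j / (l' - l) ^ j) * exp (l' * \<bar>X \<omega>\<bar>))"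
    proof (intro AE_I2)
      fix \<omega>
      have "((l' - l) * \<bar>X \<omega>\<bar>) ^ j / fact j \<le> exp ((l' - l) * \<bar>X \<omega>\<bar>)"
        using l' by (intro power_div_fact_le_exp) auto
      then have "(l' - l) ^ j * \<bar>X \<omega>\<bar> ^ j / fact j \<le> exp ((l' - l) * \<bar>X \<omega>\<bar>)"
        by (simp only: power_mult_distrib)
      moreover have "Y \<le> F / P * E" if "P * Y / F \<le> E" "P > 0" "F > 0" for P Y F E :: real
        using that by (simp add: field_simps)
      ultimately have "\<bar>X \<omega>\<bar> ^ j \<le> fact j / (l' - l) ^ j * exp ((l' - l) * \<bar>X \<omega>\<bar>)"
        using l' by simp
      then have "\<bar>X \<omega>\<bar> ^ j * exp (l * \<bar>X \<omega>\<bar>) \<le> fact j / (l' - l) ^ j * exp ((l' - l) * \<bar>X \<omega>\<bar>) * exp (l * \<bar>X \<omega>\<bar>)"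
        by (intro mult_right_mono) auto
      also have "\<dots> = fact j / (l' - l) ^ j * exp (l' * \<bar>X \<omega>\<bar>)"
        by (simp add: mult.assoc algebra_simps flip: exp_add)
      finally show "norm (\<bar>X \<omega>\<bar> ^ j * exp (l * \<bar>X \<omega>\<bar>)) \<le> norm ((fact j / (l' - l) ^ j) * exp (l' * \<bar>X \<omega>\<bar>))"
        using l' by (simp add: abs_mult)
    qed
  qed measurable
qed

lemma integrable_power_exp:
  assumes l: "0 \<le> l" "l * \<epsilon> < 1"
  shows "integrable M (\<lambda>\<omega>. X \<omega> ^ j * exp (l * X \<omega>))" "integrable M (\<lambda>\<omega>. \<bar>X \<omega>\<bar> ^ j * exp (l * X \<omega>))"
  using l by (auto intro!: Bochner_Integration.integrable_bound[OF integrable_power_exp_abs[OF l, of j]] AE_I2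
      mult_left_mono simp: abs_mult power_abs)

section \<open>Derivatives of the moment generating function\<close>

definition m where "m j l = expectation (\<lambda>\<omega>. X \<omega> ^ j * exp (l * X \<omega>))"

lemma m_sums:
  assumes l: "0 \<le> l" "l * \<epsilon> < 1"
  shows "(\<lambda>k. l ^ k / fact k * expectation (\<lambda>\<omega>. X \<omega> ^ (j + k))) sums m j l"
proof -
  let ?s = "\<lambda>n \<omega>. \<Sum>k<n. X \<omega> ^ j * ((l * X \<omega>) ^ k / fact k)"
  have "(\<lambda>n. expectation (?s n)) \<longlonglongrightarrow> m j l"
    unfolding m_def
  proof (rule integral_dominated_convergence[OF _ _ integrable_power_exp_abs[OF l, of j]])
    show "AE \<omega> in M. (\<lambda>n. ?s n \<omega>) \<longlonglongrightarrow> X \<omega> ^ j * exp (l * X \<omega>)"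
    proof (intro AE_I2)
      fix \<omega>
      have "(\<lambda>k. (l * X \<omega>) ^ k / fact k) sums exp (l * X \<omega>)"
        using exp_converges[of "l * X \<omega>"] by (simp add: divide_inverse_commute)
      from sums_mult[OF this, of "X \<omega> ^ j"] show "(\<lambda>n. ?s n \<omega>) \<longlonglongrightarrow> X \<omega> ^ j * exp (l * X \<omega>)"
        by (simp add: sums_def)
    qed
    show "AE \<omega> in M. norm (?s n \<omega>) \<le> \<bar>X \<omega>\<bar> ^ j * exp (l * \<bar>X \<omega>\<bar>)" for n
    proof (intro AE_I2)
      fix \<omega>
      have "(\<lambda>k. (l * \<bar>X \<omega>\<bar>) ^ k / fact k) sums exp (l * \<bar>X \<omega>\<bar>)"
        using exp_converges[of "l * \<bar>X \<omega>\<bar>"] by (simp add: divide_inverse_commute)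
      then have "(\<Sum>k<n. (l * \<bar>X \<omega>\<bar>) ^ k / fact k) \<le> exp (l * \<bar>X \<omega>\<bar>)"
        using l sum_le_suminf[of "\<lambda>k. (l * \<bar>X \<omega>\<bar>) ^ k / fact k" "{..<n}"] by (auto simp: sums_iff)
      then have "\<bar>X \<omega>\<bar> ^ j * (\<Sum>k<n. (l * \<bar>X \<omega>\<bar>) ^ k / fact k) \<le> \<bar>X \<omega>\<bar> ^ j * exp (l * \<bar>X \<omega>\<bar>)"
        by (intro mult_left_mono) auto
      moreover have "norm (?s n \<omega>) \<le> \<bar>X \<omega>\<bar> ^ j * (\<Sum>k<n. (l * \<bar>X \<omega>\<bar>) ^ k / fact k)"
        unfolding sum_distrib_left using l
        by (intro sum_norm_le) (simp add: abs_mult power_abs)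
      ultimately show "norm (?s n \<omega>) \<le> \<bar>X \<omega>\<bar> ^ j * exp (l * \<bar>X \<omega>\<bar>)" by linarith
    qed
  qed measurable
  also have "(\<lambda>n. expectation (?s n)) = (\<lambda>n. \<Sum>k<n. l ^ k / fact k * expectation (\<lambda>\<omega>. X \<omega> ^ (j + k)))"
  proof
    fix n
    have "expectation (?s n) = expectation (\<lambda>\<omega>. \<Sum>k<n. l ^ k / fact k * X \<omega> ^ (j + k))"
      by (intro Bochner_Integration.integral_cong sum.cong refl) (simp add: power_add power_mult_distrib)
    then show "expectation (?s n) = (\<Sum>k<n. l ^ k / fact k * expectation (\<lambda>\<omega>. X \<omega> ^ (j + k)))" by simp
  qed
  finally show ?thesis by (simp add: sums_def)
qed

lemma m_le_binomial:
  assumes l: "0 \<le> l" "l * \<epsilon> < 1" and j: "j \<ge> 2"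
  shows "m j l \<le> 1/2 * fact j * \<epsilon> ^ (j - 2) * v / (1 - l * \<epsilon>) ^ Suc j"
proof -
  have S: "(\<lambda>k. 1/2 * fact j * \<epsilon> ^ (j - 2) * v * (real ((j + k) choose j) * (l * \<epsilon>) ^ k)) sums
    (1/2 * fact j * \<epsilon> ^ (j - 2) * v * (1 / (1 - l * \<epsilon>) ^ Suc j))"
    using l eps by (intro sums_mult binomial_series_sums) auto
  have T: "l ^ k / fact k * expectation (\<lambda>\<omega>. X \<omega> ^ (j + k))
    \<le> 1/2 * fact j * \<epsilon> ^ (j - 2) * v * (real ((j + k) choose j) * (l * \<epsilon>) ^ k)" for k
  proof -
    have "l ^ k / fact k * expectation (\<lambda>\<omega>. X \<omega> ^ (j + k)) \<le> l ^ k / fact k * (1/2 * fact (j + k) * \<epsilon> ^ (j + k - 2) * v)"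
      using l j by (intro mult_left_mono moment_le) auto
    also have "fact (j + k) = (fact j * fact k * real ((j + k) choose j) :: real)"
    proof -
      have "fact j * fact k * ((j + k) choose j) = (fact (j + k) :: nat)"
        using binomial_fact_lemma[of j "j + k"] by simp
      then show ?thesis by (metis of_nat_fact of_nat_mult)
    qed
    also have "\<epsilon> ^ (j + k - 2) = \<epsilon> ^ (j - 2) * \<epsilon> ^ k"
    proof -
      have "j + k - 2 = (j - 2) + k" using j by simp
      then show ?thesis by (simp only: power_add)
    qed
    finally show ?thesis by (simp add: power_mult_distrib mult_ac)
  qed
  have "m j l \<le> 1/2 * fact j * \<epsilon> ^ (j - 2) * v * (1 / (1 - l * \<epsilon>) ^ Suc j)"
    by (rule sums_le[OF T m_sums[OF l] S])
  then show ?thesis by simp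
qed

text \<open>The term k = 0 of the series vanishes since the mean is 0. Splitting k + 2 as (k + 1) +
  1 leaves a binomial and a geometric series. The bound is the derivative in l of l^2 * v / (2 * (1
  - l * \<epsilon>)), which is why it matches the stationarity equation of the saddle point.\<close>

lemma m1_le:
  assumes l: "0 \<le> l" "l * \<epsilon> < 1"
  shows "m 1 l \<le> l * v * (1 - l * \<epsilon> / 2) / (1 - l * \<epsilon>)\<^sup>2"
proof -
  let ?q = "l * \<epsilon>"
  have q: "0 \<le> ?q" "?q < 1" using l eps by auto
  have U: "(\<lambda>k. l ^ Suc k / fact (Suc k) * expectation (\<lambda>\<omega>. X \<omega> ^ (1 + Suc k))) sums (m 1 l - 0)"
    using m_sums[OF l, of 1] by (subst sums_Suc_iff) (simp add: mean)
  have S: "(\<lambda>k. l * v / 2 * (real ((1 + k) choose 1) * ?q ^ k) + l * v / 2 * ?q ^ k) sums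
     (l * v / 2 * (1 / (1 - ?q) ^ Suc 1) + l * v / 2 * (1 / (1 - ?q)))"
    using q by (intro sums_add sums_mult binomial_series_sums geometric_sums) auto
  have T: "l ^ Suc k / fact (Suc k) * expectation (\<lambda>\<omega>. X \<omega> ^ (1 + Suc k))
    \<le> l * v / 2 * (real ((1 + k) choose 1) * ?q ^ k) + l * v / 2 * ?q ^ k" for k
  proof -
    have "l ^ Suc k / fact (Suc k) * expectation (\<lambda>\<omega>. X \<omega> ^ (1 + Suc k))
      \<le> l ^ Suc k / fact (Suc k) * (1/2 * fact (1 + Suc k) * \<epsilon> ^ (1 + Suc k - 2) * v)"
      using l by (intro mult_left_mono moment_le) auto
    also have "\<dots> = l ^ Suc k * (1/2 * (real k + 2) * \<epsilon> ^ k * v)"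
      by (simp add: divide_simps add.commute)
    also have "\<dots> = l * v / 2 * (real ((1 + k) choose 1) * ?q ^ k) + l * v / 2 * ?q ^ k"
      by (simp add: power_mult_distrib field_simps)
    finally show ?thesis .
  qed
  have "m 1 l - 0 \<le> l * v / 2 * (1 / (1 - ?q) ^ Suc 1) + l * v / 2 * (1 / (1 - ?q))"
    by (rule sums_le[OF T U S])
  also have "\<dots> = l * v * (1 - ?q / 2) / (1 - ?q)\<^sup>2"
    using q by (simp add: divide_simps) (simp add: power2_eq_square algebra_simps)
  finally show ?thesis by simp
qed

lemma m0_le:
  assumes l: "0 \<le> l" "l * \<epsilon> < 1"
  shows "m 0 l \<le> 1 + l\<^sup>2 * v / (2 * (1 - l * \<epsilon>))"
proof -
  let ?q = "l * \<epsilon>"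
  have q: "0 \<le> ?q" "?q < 1" using l eps by auto
  have U: "(\<lambda>k. l ^ (k + 2) / fact (k + 2) * expectation (\<lambda>\<omega>. X \<omega> ^ (0 + (k + 2)))) sums (m 0 l - 1)"
    using m_sums[OF l, of 0] by (subst sums_iff_shift) (simp add: mean prob_space eval_nat_numeral)
  have S: "(\<lambda>k. l\<^sup>2 * v / 2 * ?q ^ k) sums (l\<^sup>2 * v / 2 * (1 / (1 - ?q)))"
    using q by (intro sums_mult geometric_sums) auto
  have T: "l ^ (k + 2) / fact (k + 2) * expectation (\<lambda>\<omega>. X \<omega> ^ (0 + (k + 2))) \<le> l\<^sup>2 * v / 2 * ?q ^ k" for k
  proof -
    have "l ^ (k + 2) / fact (k + 2) * expectation (\<lambda>\<omega>. X \<omega> ^ (0 + (k + 2)))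
      \<le> l ^ (k + 2) / fact (k + 2) * (1/2 * fact (0 + (k + 2)) * \<epsilon> ^ (0 + (k + 2) - 2) * v)"
      using l by (intro mult_left_mono moment_le) auto
    also have "\<dots> = l\<^sup>2 * v / 2 * ?q ^ k"
      by (simp add: power_mult_distrib power_add power2_eq_square del: fact_Suc)
    finally show ?thesis .
  qed
  have "m 0 l - 1 \<le> l\<^sup>2 * v / 2 * (1 / (1 - ?q))"
    by (rule sums_le[OF T U S])
  then show ?thesis by simp
qed

text \<open>Eliminating v makes the bound the same for all summands and is the source of the
  numerator of \<open>R\<close>.\<close>

lemma m0_le_uniform:
  assumes l: "0 \<le> l" "l * \<epsilon> < 1"
  shows "m 0 l \<le> (1 - l * \<epsilon> + 6 * (l * \<epsilon>)\<^sup>2) / (1 - l * \<epsilon>)"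
proof -
  have "l\<^sup>2 * v \<le> l\<^sup>2 * (12 * \<epsilon>\<^sup>2)" by (intro mult_left_mono v_le) auto
  then have "l\<^sup>2 * v / (2 * (1 - l * \<epsilon>)) \<le> l\<^sup>2 * (12 * \<epsilon>\<^sup>2) / (2 * (1 - l * \<epsilon>))"
    using l by (intro divide_right_mono) auto
  also have "1 + l\<^sup>2 * (12 * \<epsilon>\<^sup>2) / (2 * (1 - l * \<epsilon>)) = (1 - l * \<epsilon> + 6 * (l * \<epsilon>)\<^sup>2) / (1 - l * \<epsilon>)"
    using l by (simp add: divide_simps) (simp add: power_mult_distrib algebra_simps)
  finally show ?thesis using m0_le[OF l] by linarith
qed

lemma integrable_X [simp]: "integrable M X" using moment[of 1] by simp

lemma m0_ge_1:
  assumes l: "0 \<le> l" "l * \<epsilon> < 1"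
  shows "m 0 l \<ge> 1"
proof -
  have "expectation (\<lambda>\<omega>. 1 + l * X \<omega>) \<le> expectation (\<lambda>\<omega>. X \<omega> ^ 0 * exp (l * X \<omega>))"
    by (intro integral_mono integrable_power_exp[OF l]) (auto intro: exp_ge_add_one_self)
  then show ?thesis by (simp add: m_def mean prob_space)
qed

lemma m1_nonneg:
  assumes l: "0 \<le> l" "l * \<epsilon> < 1"
  shows "m 1 l \<ge> 0"
proof -
  have pt: "X \<omega> \<le> X \<omega> ^ 1 * exp (l * X \<omega>)" for \<omega>
  proof (cases "X \<omega> \<ge> 0")
    case True
    then show ?thesis using l mult_left_mono[of 1 "exp (l * X \<omega>)" "X \<omega>"] by simp
  next
    case False
    then have "l * X \<omega> \<le> 0" using l by (simp add: mult_nonneg_nonpos)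
    then show ?thesis using False mult_left_mono_neg[of "exp (l * X \<omega>)" 1 "X \<omega>"] by simp
  qed
  have "expectation X \<le> m 1 l"
    unfolding m_def by (intro integral_mono integrable_power_exp[OF l] pt) simp
  then show ?thesis by (simp add: mean)
qed

text \<open>For an independent copy \<open>Y\<close> of \<open>X\<close>, twice the right-hand side is the expectation of
  \<open>(X - Y)\<^sup>2 * exp (l * (X + Y))\<close>, which is bounded below through \<open>exp z \<ge> 1 + z\<close>. Instead of using
  a product space, the proof integrates the pointwise inequality twice.\<close>

lemma tilted_variance_ge:
  assumes l: "0 \<le> l" "l * \<epsilon> < 1"
  shows "v * (1 - 3 * (l * \<epsilon>)) \<le> m 0 l * m 2 l - (m 1 l)\<^sup>2"
proof -
  define s where "s = expectation (\<lambda>\<omega>. X \<omega> ^ 3)"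
  note i = integrable_power_exp(1)[OF l]
  have pt: "(x - y)\<^sup>2 * (1 + l * (x + y)) \<le> exp (l * x) * exp (l * y) * (x - y)\<^sup>2" for x y :: real
    using mult_left_mono[OF exp_ge_add_one_self[of "l * (x + y)"], of "(x - y)\<^sup>2"]
    by (simp add: distrib_left exp_add mult_ac)
  have step: "x\<^sup>2 + v + l * (x ^ 3 - x * v + s) \<le> exp (l * x) * (x\<^sup>2 * m 0 l - 2 * x * m 1 l + m 2 l)" for x
  proof -
    have "x\<^sup>2 + v + l * (x ^ 3 - x * v + s) = expectation (\<lambda>\<omega>. (x\<^sup>2 + l * x ^ 3) - (2 * x + l * x\<^sup>2) * X \<omega> + (1 - l * x) * (X \<omega>)\<^sup>2 + l * X \<omega> ^ 3)"
      by (simp add: prob_space mean v_def s_def algebra_simps)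
    also have "\<dots> \<le> expectation (\<lambda>\<omega>. exp (l * x) * (x\<^sup>2 * (X \<omega> ^ 0 * exp (l * X \<omega>)) - 2 * x * (X \<omega> ^ 1 * exp (l * X \<omega>)) + X \<omega> ^ 2 * exp (l * X \<omega>)))"
    proof (intro integral_mono)
      fix \<omega>
      show "(x\<^sup>2 + l * x ^ 3) - (2 * x + l * x\<^sup>2) * X \<omega> + (1 - l * x) * (X \<omega>)\<^sup>2 + l * X \<omega> ^ 3
        \<le> exp (l * x) * (x\<^sup>2 * (X \<omega> ^ 0 * exp (l * X \<omega>)) - 2 * x * (X \<omega> ^ 1 * exp (l * X \<omega>)) + X \<omega> ^ 2 * exp (l * X \<omega>))"
        using pt[of x "X \<omega>"] by (simp add: power2_eq_square power3_eq_cube algebra_simps)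
    qed (intro integrable_mult_right Bochner_Integration.integrable_add Bochner_Integration.integrable_diff i moment integrable_X integrable_const)+
    also have "\<dots> = exp (l * x) * (x\<^sup>2 * m 0 l - 2 * x * m 1 l + m 2 l)"
      using i[of 0] i[of 1] i[of 2] by (simp add: m_def)
    finally show ?thesis .
  qed
  have "2 * v + 2 * (l * s) = expectation (\<lambda>\<omega>. v + (X \<omega>)\<^sup>2 + l * X \<omega> ^ 3 - l * v * X \<omega> + l * s)"
    by (simp add: prob_space mean v_def s_def)
  also have "\<dots> \<le> expectation (\<lambda>\<omega>. m 0 l * (X \<omega> ^ 2 * exp (l * X \<omega>)) - 2 * m 1 l * (X \<omega> ^ 1 * exp (l * X \<omega>)) + m 2 l * (X \<omega> ^ 0 * exp (l * X \<omega>)))"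
  proof (intro integral_mono)
    fix \<omega>
    show "v + (X \<omega>)\<^sup>2 + l * X \<omega> ^ 3 - l * v * X \<omega> + l * s
      \<le> m 0 l * (X \<omega> ^ 2 * exp (l * X \<omega>)) - 2 * m 1 l * (X \<omega> ^ 1 * exp (l * X \<omega>)) + m 2 l * (X \<omega> ^ 0 * exp (l * X \<omega>))"
      using step[of "X \<omega>"] by (simp add: algebra_simps)
  qed (intro integrable_mult_right Bochner_Integration.integrable_add Bochner_Integration.integrable_diff i moment integrable_X integrable_const)+
  also have "\<dots> = m 0 l * m 2 l - 2 * m 1 l * m 1 l + m 2 l * m 0 l"
    using i[of 0] i[of 1] i[of 2] by (simp add: m_def)
  finally have "v + l * s \<le> m 0 l * m 2 l - (m 1 l)\<^sup>2" by (simp add: power2_eq_square)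
  \<comment> \<open>Bernstein's condition with k = 3 is used here from below; fact 3 / 2 = 3 is the
    origin of the factor 1 - 3 * t in \<open>R\<close>.\<close>
  moreover have "- (3 * \<epsilon> * v) \<le> s"
    using bern[of 3] by (simp add: s_def v_def fact_numeral)
  then have "l * (- (3 * \<epsilon> * v)) \<le> l * s" using l by (intro mult_left_mono) auto
  ultimately show ?thesis by (simp add: algebra_simps)
qed

text \<open>The weighted AM--GM inequality interpolates the third moment between the second and the fourth.\<close>

lemma tilted_third_moment_le:
  assumes l: "0 \<le> l" "l * \<epsilon> < 1"
  shows "expectation (\<lambda>\<omega>. \<bar>X \<omega>\<bar> ^ 3 * exp (l * X \<omega>)) \<le> sqrt 12 * \<epsilon> * v / (1 - l * \<epsilon>) ^ 4"
proof -
  define d where "d = 1 - l * \<epsilon>"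
  have d: "d > 0" using l by (simp add: d_def)
  \<comment> \<open>The square of \<open>a\<close> is the ratio of the bounds for the fourth and the
    second moment, namely 12 * \<epsilon>^2 * v / d^5 and v / d^3, so both halves of the estimate
    become equal.\<close>
  define a where "a = sqrt 12 * \<epsilon> / d"
  have a: "a > 0" using d eps by (simp add: a_def)
  note i = integrable_power_exp[OF l]
  have pt: "\<bar>x\<bar> ^ 3 \<le> a / 2 * x\<^sup>2 + 1 / (2 * a) * x ^ 4" for x
  proof -
    have "0 \<le> x\<^sup>2 * (\<bar>x\<bar> - a)\<^sup>2" by simp
    also have "\<dots> = x ^ 4 + a * a * x\<^sup>2 - 2 * a * \<bar>x\<bar> ^ 3"
      by (simp add: power2_eq_square power3_eq_cube power4_eq_xxxx algebra_simps abs_if)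
    finally show ?thesis using a by (simp add: field_simps power2_eq_square)
  qed
  have "expectation (\<lambda>\<omega>. \<bar>X \<omega>\<bar> ^ 3 * exp (l * X \<omega>))
    \<le> expectation (\<lambda>\<omega>. a / 2 * ((X \<omega>)\<^sup>2 * exp (l * X \<omega>)) + 1 / (2 * a) * (X \<omega> ^ 4 * exp (l * X \<omega>)))"
  proof (intro integral_mono)
    fix \<omega>
    show "\<bar>X \<omega>\<bar> ^ 3 * exp (l * X \<omega>) \<le> a / 2 * ((X \<omega>)\<^sup>2 * exp (l * X \<omega>)) + 1 / (2 * a) * (X \<omega> ^ 4 * exp (l * X \<omega>))"
      using mult_right_mono[OF pt[of "X \<omega>"], of "exp (l * X \<omega>)"] by (simp add: distrib_right mult.assoc)
  qed (intro integrable_mult_right Bochner_Integration.integrable_add i)+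
  also have "\<dots> = a / 2 * m 2 l + 1 / (2 * a) * m 4 l"
    using i(1)[of 2] i(1)[of 4] by (simp add: m_def)
  also have "\<dots> \<le> a / 2 * (v / d ^ 3) + 1 / (2 * a) * (12 * \<epsilon>\<^sup>2 * v / d ^ 5)"
    using m_le_binomial[OF l, of 2] m_le_binomial[OF l, of 4] a
    by (intro add_mono mult_left_mono) (auto simp: d_def fact_numeral eval_nat_numeral)
  also have "\<dots> = sqrt 12 * \<epsilon> * v / d ^ 4"
  proof -
    have s: "sqrt 12 * sqrt 12 = (12::real)" by simp
    have "1 / (2 * a) * (12 * \<epsilon>\<^sup>2 * v / d ^ 5) = (12 / sqrt 12) * (\<epsilon> * v / d ^ 4) / 2"
      using d eps by (simp add: a_def divide_simps) (simp add: power2_eq_square eval_nat_numeral)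
    also have "12 / sqrt 12 = sqrt (12::real)" by (rule real_div_sqrt) simp
    finally show ?thesis using d by (simp add: a_def eval_nat_numeral field_simps)
  qed
  finally show ?thesis by (simp add: d_def)
qed

end

section \<open>Exponential tilting\<close>

definition weighted_law :: "'a measure \<Rightarrow> ('a \<Rightarrow> real) \<Rightarrow> ('a \<Rightarrow> real) \<Rightarrow> real measure" where
  "weighted_law M w Y = distr (density M (\<lambda>\<omega>. ennreal (w \<omega>))) borel Y"

context
  fixes M :: "'a measure" and w Y :: "'a \<Rightarrow> real"
  assumes [measurable]: "w \<in> borel_measurable M" "Y \<in> borel_measurable M"
    and w0: "\<And>\<omega>. w \<omega> \<ge> 0"
begin

lemma real_distribution_weighted_law:
  assumes "integrable M w" "(\<integral>\<omega>. w \<omega> \<partial>M) = 1"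
  shows "real_distribution (weighted_law M w Y)"
proof -
  have "emeasure (density M (\<lambda>\<omega>. ennreal (w \<omega>))) (space M) = (\<integral>\<^sup>+\<omega>. ennreal (w \<omega>) \<partial>M)"
    by (subst emeasure_density) (auto intro!: nn_integral_cong)
  also have "\<dots> = 1" using assms w0 by (subst nn_integral_eq_integral) auto
  finally interpret W: prob_space "density M (\<lambda>\<omega>. ennreal (w \<omega>))" by (intro prob_spaceI) simp
  show ?thesis unfolding weighted_law_def by (rule W.real_distribution_distr) simp
qed

lemma integral_weighted_law:
  fixes f :: "real \<Rightarrow> 'b::{banach, second_countable_topology}"
  assumes [measurable]: "f \<in> borel_measurable borel"
  shows "(\<integral>u. f u \<partial>weighted_law M w Y) = (\<integral>\<omega>. w \<omega> *\<^sub>R f (Y \<omega>) \<partial>M)"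
  unfolding weighted_law_def using w0
  by (subst integral_distr) (auto simp: integral_density)

lemma integrable_weighted_law:
  fixes f :: "real \<Rightarrow> 'b::{banach, second_countable_topology}"
  assumes [measurable]: "f \<in> borel_measurable borel"
  shows "integrable (weighted_law M w Y) f \<longleftrightarrow> integrable M (\<lambda>\<omega>. w \<omega> *\<^sub>R f (Y \<omega>))"
  unfolding weighted_law_def using w0
  by (subst integrable_distr_eq) (auto simp: integrable_density)

lemma nn_integral_weighted_law:
  assumes [measurable]: "f \<in> borel_measurable borel"
  shows "(\<integral>\<^sup>+u. f u \<partial>weighted_law M w Y) = (\<integral>\<^sup>+\<omega>. ennreal (w \<omega>) * f (Y \<omega>) \<partial>M)"
  unfolding weighted_law_def by (subst nn_integral_distr) (auto simp: nn_integral_density)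

end

section \<open>A single tilted summand\<close>

locale tilted_rv = bernstein_rv +
  fixes l :: real
  assumes l: "0 \<le> l" "l * \<epsilon> < 1"
begin

definition weight where "weight \<omega> = exp (l * X \<omega>) / m 0 l"
definition center where "center = m 1 l / m 0 l"
text \<open>The scale \<open>s\<close> is a parameter because all summands are divided by the same
  number, eventually the standard deviation of the tilted sum.\<close>

definition law where "law s = weighted_law M weight (\<lambda>\<omega>. (X \<omega> - center) / s)"

lemma m0_pos: "m 0 l > 0" using m0_ge_1[OF l] by simp

lemma weight_measurable [measurable]: "weight \<in> borel_measurable M"
  unfolding weight_def[abs_def] by measurable

lemma weight_nonneg: "weight \<omega> \<ge> 0" using m0_pos by (simp add: weight_def)

lemma integrable_weight_power: "integrable M (\<lambda>\<omega>. weight \<omega> * X \<omega> ^ j)" "integrable M (\<lambda>\<omega>. weight \<omega> * \<bar>X \<omega>\<bar> ^ j)"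
  using integrable_power_exp[OF l, of j, THEN Bochner_Integration.integrable_divide, of "m 0 l"]
  by (simp_all add: weight_def mult.commute)

lemma expectation_weight_power: "expectation (\<lambda>\<omega>. weight \<omega> * X \<omega> ^ j) = m j l / m 0 l"
  by (simp add: weight_def m_def mult.commute)

lemma integrable_weight: "integrable M weight" using integrable_weight_power(1)[of 0] by simp

lemma expectation_weight: "expectation weight = 1"
  using expectation_weight_power[of 0] m0_pos by simp

lemma real_distribution_law: "real_distribution (law s)"
  unfolding law_def
  by (rule real_distribution_weighted_law) (auto simp: weight_nonneg integrable_weight expectation_weight)

lemma char_law: "char (law s) t = expectation (\<lambda>\<omega>. weight \<omega> *\<^sub>R iexp (t * ((X \<omega> - center) / s)))"
  unfolding char_def law_def by (rule integral_weighted_law) (auto simp: weight_nonneg)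

lemma center_bounds: "0 \<le> center" "center \<le> l * v * (1 - l * \<epsilon> / 2) / (1 - l * \<epsilon>)\<^sup>2"
proof -
  show "0 \<le> center" using m0_pos m1_nonneg[OF l] by (simp add: center_def)
  have "center \<le> m 1 l / 1"
    unfolding center_def using m0_ge_1[OF l] m1_nonneg[OF l] by (intro divide_left_mono) auto
  then show "center \<le> l * v * (1 - l * \<epsilon> / 2) / (1 - l * \<epsilon>)\<^sup>2" using m1_le[OF l] by simp
qed

lemma law_moments:
  assumes s: "s > 0"
  shows "integrable (law s) (\<lambda>u. u)" "(\<integral>u. u \<partial>law s) = 0"
    and "integrable (law s) (\<lambda>u. u\<^sup>2)" "(\<integral>u. u\<^sup>2 \<partial>law s) = (m 0 l * m 2 l - (m 1 l)\<^sup>2) / (m 0 l)\<^sup>2 / s\<^sup>2"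
    and "integrable (law s) (\<lambda>u. \<bar>u\<bar> ^ 3)"
    and "(\<integral>u. \<bar>u\<bar> ^ 3 \<partial>law s) \<le> 3 / 2 * (sqrt 12 * \<epsilon> * v / (1 - l * \<epsilon>) ^ 4) / s ^ 3"
proof -
  note iw = integrable_weight_power
  note ew = expectation_weight_power
  have [simp]: "integrable M (\<lambda>\<omega>. weight \<omega> * X \<omega>)" "integrable M weight"
    "integrable M (\<lambda>\<omega>. weight \<omega> * (X \<omega>)\<^sup>2)" "integrable M (\<lambda>\<omega>. weight \<omega> * \<bar>X \<omega>\<bar> ^ 3)"
    using iw(1)[of 1] iw(1)[of 0] iw(1)[of 2] iw(2)[of 3] by simp_all
  have [simp]: "expectation (\<lambda>\<omega>. weight \<omega> * X \<omega>) = center" "expectation weight = 1"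
    "expectation (\<lambda>\<omega>. weight \<omega> * (X \<omega>)\<^sup>2) = m 2 l / m 0 l"
    using ew[of 1] ew[of 2] expectation_weight by (simp_all add: center_def)
  have e1: "weight \<omega> *\<^sub>R ((X \<omega> - center) / s) = (weight \<omega> * X \<omega> - center * weight \<omega>) / s" for \<omega>
    by (simp add: algebra_simps)
  have e2: "weight \<omega> *\<^sub>R ((X \<omega> - center) / s)\<^sup>2 = (weight \<omega> * (X \<omega>)\<^sup>2 - 2 * center * (weight \<omega> * X \<omega>) + center\<^sup>2 * weight \<omega>) / s\<^sup>2" for \<omega>
    by (simp add: power_divide power2_eq_square algebra_simps)
  note W = integrable_weighted_law[of weight M "\<lambda>\<omega>. (X \<omega> - center) / s", OF _ _ weight_nonneg, folded law_def]
    integral_weighted_law[of weight M "\<lambda>\<omega>. (X \<omega> - center) / s", OF _ _ weight_nonneg, folded law_def]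
  show "integrable (law s) (\<lambda>u. u)" by (subst W(1)) (unfold e1, simp_all)
  show "(\<integral>u. u \<partial>law s) = 0" by (subst W(2)) (unfold e1, simp_all)
  show "integrable (law s) (\<lambda>u. u\<^sup>2)" by (subst W(1)) (unfold e2, simp_all)
  have "(\<integral>u. u\<^sup>2 \<partial>law s) = (m 2 l / m 0 l - 2 * center * center + center\<^sup>2) / s\<^sup>2"
    by (subst W(2)) (unfold e2, simp_all)
  also have "m 2 l / m 0 l - 2 * center * center + center\<^sup>2 = (m 0 l * m 2 l - (m 1 l)\<^sup>2) / (m 0 l)\<^sup>2"
    using m0_pos by (simp add: center_def power2_eq_square field_simps)
  finally show "(\<integral>u. u\<^sup>2 \<partial>law s) = (m 0 l * m 2 l - (m 1 l)\<^sup>2) / (m 0 l)\<^sup>2 / s\<^sup>2" .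
  let ?g = "\<lambda>\<omega>. (3 / 2 * (weight \<omega> * \<bar>X \<omega>\<bar> ^ 3) - 6 * center\<^sup>2 * (weight \<omega> * X \<omega> - center * weight \<omega>)) / s ^ 3"
  have le: "weight \<omega> *\<^sub>R \<bar>(X \<omega> - center) / s\<bar> ^ 3 \<le> ?g \<omega>" for \<omega>
  proof -
    have "weight \<omega> * \<bar>X \<omega> - center\<bar> ^ 3 \<le> weight \<omega> * (3 / 2 * \<bar>X \<omega>\<bar> ^ 3 - 6 * center\<^sup>2 * (X \<omega> - center))"
      by (intro mult_left_mono cube_dist_le center_bounds weight_nonneg)
    also have "\<dots> = 3 / 2 * (weight \<omega> * \<bar>X \<omega>\<bar> ^ 3) - 6 * center\<^sup>2 * (weight \<omega> * X \<omega> - center * weight \<omega>)"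
      by (simp add: algebra_simps)
    finally have "weight \<omega> * \<bar>X \<omega> - center\<bar> ^ 3 / s ^ 3 \<le> ?g \<omega>"
      using s by (intro divide_right_mono) auto
    then show ?thesis using s by (simp add: abs_divide power_divide)
  qed
  have ig: "integrable M ?g" by simp
  have i3: "integrable M (\<lambda>\<omega>. weight \<omega> *\<^sub>R \<bar>(X \<omega> - center) / s\<bar> ^ 3)"
  proof (rule Bochner_Integration.integrable_bound[OF ig])
    show "AE \<omega> in M. norm (weight \<omega> *\<^sub>R \<bar>(X \<omega> - center) / s\<bar> ^ 3) \<le> norm (?g \<omega>)"
    proof (intro AE_I2)
      fix \<omega>
      have "norm (weight \<omega> *\<^sub>R \<bar>(X \<omega> - center) / s\<bar> ^ 3) = weight \<omega> *\<^sub>R \<bar>(X \<omega> - center) / s\<bar> ^ 3"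
        using weight_nonneg[of \<omega>] by (simp add: abs_mult)
      also note le[of \<omega>]
      finally show "norm (weight \<omega> *\<^sub>R \<bar>(X \<omega> - center) / s\<bar> ^ 3) \<le> norm (?g \<omega>)"
        unfolding real_norm_def by linarith
    qed
  qed measurable
  then show "integrable (law s) (\<lambda>u. \<bar>u\<bar> ^ 3)" by (subst W(1)) simp_all
  have "(\<integral>u. \<bar>u\<bar> ^ 3 \<partial>law s) = expectation (\<lambda>\<omega>. weight \<omega> *\<^sub>R \<bar>(X \<omega> - center) / s\<bar> ^ 3)"
    by (rule W(2)) auto
  also have "\<dots> \<le> expectation ?g" by (intro integral_mono i3 ig le)
  also have "\<dots> = 3 / 2 * expectation (\<lambda>\<omega>. weight \<omega> * \<bar>X \<omega>\<bar> ^ 3) / s ^ 3" by simp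
  also have "expectation (\<lambda>\<omega>. weight \<omega> * \<bar>X \<omega>\<bar> ^ 3) \<le> sqrt 12 * \<epsilon> * v / (1 - l * \<epsilon>) ^ 4"
  proof -
    let ?T = "expectation (\<lambda>\<omega>. \<bar>X \<omega>\<bar> ^ 3 * exp (l * X \<omega>))"
    have "expectation (\<lambda>\<omega>. weight \<omega> * \<bar>X \<omega>\<bar> ^ 3) = ?T / m 0 l" by (simp add: weight_def mult.commute)
    also have "\<dots> \<le> ?T / 1" using m0_ge_1[OF l] by (intro divide_left_mono integral_nonneg) auto
    finally show ?thesis using tilted_third_moment_le[OF l] by simp
  qed
  finally show "(\<integral>u. \<bar>u\<bar> ^ 3 \<partial>law s) \<le> 3 / 2 * (sqrt 12 * \<epsilon> * v / (1 - l * \<epsilon>) ^ 4) / s ^ 3"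
    using s by (simp add: divide_right_mono)
qed

text \<open>As 1 - 3 * l * \<epsilon> is positive, the uniform upper bound for \<open>m 0 l\<close>
  may be inserted in the denominator. The fraction of v that survives is again the same for all
  summands.\<close>

lemma law_variance_ge:
  assumes s: "s > 0" and l3: "l * \<epsilon> < 1 / 3"
  shows "v * ((1 - 3 * (l * \<epsilon>)) * (1 - l * \<epsilon>)\<^sup>2 / (1 - l * \<epsilon> + 6 * (l * \<epsilon>)\<^sup>2)\<^sup>2)
    \<le> (m 0 l * m 2 l - (m 1 l)\<^sup>2) / (m 0 l)\<^sup>2"
proof -
  let ?q = "l * \<epsilon>"
  have D: "1 - ?q + 6 * ?q\<^sup>2 > 0" using l by (intro add_pos_nonneg) auto
  have "(m 0 l)\<^sup>2 \<le> ((1 - ?q + 6 * ?q\<^sup>2) / (1 - ?q))\<^sup>2"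
    using m0_le_uniform[OF l] m0_pos by (intro power_mono) auto
  then have "v * (1 - 3 * ?q) / ((1 - ?q + 6 * ?q\<^sup>2) / (1 - ?q))\<^sup>2 \<le> v * (1 - 3 * ?q) / (m 0 l)\<^sup>2"
    using v_nonneg l3 m0_pos D l by (intro divide_left_mono) (auto intro!: mult_pos_pos)
  also have "\<dots> \<le> (m 0 l * m 2 l - (m 1 l)\<^sup>2) / (m 0 l)\<^sup>2"
    by (intro divide_right_mono tilted_variance_ge l) auto
  finally show ?thesis by (simp add: power_divide mult_ac)
qed

end

section \<open>The tilted independent sum\<close>

locale tilted_sum = prob_space M for M :: "'a measure" +
  fixes \<xi> :: "'i \<Rightarrow> 'a \<Rightarrow> real" and I :: "'i set" and \<epsilon> l s :: real
  assumes I: "finite I" and s: "s > 0"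
    and indep: "indep_vars (\<lambda>_. borel) \<xi> I"
    and rvs: "\<And>i. i \<in> I \<Longrightarrow> tilted_rv M (\<xi> i) \<epsilon> l"
begin

abbreviation "wt i \<equiv> tilted_rv.weight M (\<xi> i) l"
abbreviation "ctr i \<equiv> tilted_rv.center M (\<xi> i) l"
abbreviation "mgf i \<equiv> bernstein_rv.m M (\<xi> i) 0 l"
abbreviation "lw i \<equiv> tilted_rv.law M (\<xi> i) l s"

definition "sum_weight \<omega> = (\<Prod>i\<in>I. wt i \<omega>)"
definition "std_sum \<omega> = (\<Sum>i\<in>I. \<xi> i \<omega> - ctr i) / s"
definition "sum_law = weighted_law M sum_weight std_sum"

lemma wt_eq: "i \<in> I \<Longrightarrow> wt i \<omega> = exp (l * \<xi> i \<omega>) / mgf i"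
  by (rule tilted_rv.weight_def[OF rvs])

lemma rv: "i \<in> I \<Longrightarrow> \<xi> i \<in> borel_measurable M"
  using bernstein_rv.rv[OF tilted_rv.axioms(1)[OF rvs]] .

lemma mgf_pos: "i \<in> I \<Longrightarrow> mgf i > 0"
  by (rule tilted_rv.m0_pos[OF rvs])

lemma sum_weight_measurable [measurable]: "sum_weight \<in> borel_measurable M"
  unfolding sum_weight_def[abs_def] by (intro borel_measurable_prod tilted_rv.weight_measurable[OF rvs])

lemma std_sum_measurable [measurable]: "std_sum \<in> borel_measurable M"
  unfolding std_sum_def[abs_def] by (intro borel_measurable_divide borel_measurable_sum borel_measurable_diff rv) auto

lemma sum_weight_nonneg: "sum_weight \<omega> \<ge> 0"
  unfolding sum_weight_def by (intro prod_nonneg tilted_rv.weight_nonneg[OF rvs]) auto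

lemma expectation_prod:
  fixes f :: "'i \<Rightarrow> real \<Rightarrow> 'b::{real_normed_field, banach, second_countable_topology}"
  assumes [measurable]: "\<And>i. f i \<in> borel_measurable borel"
    and "\<And>i. i \<in> I \<Longrightarrow> integrable M (\<lambda>\<omega>. wt i \<omega> *\<^sub>R f i (\<xi> i \<omega>))"
  shows "expectation (\<lambda>\<omega>. \<Prod>i\<in>I. wt i \<omega> *\<^sub>R f i (\<xi> i \<omega>)) = (\<Prod>i\<in>I. expectation (\<lambda>\<omega>. wt i \<omega> *\<^sub>R f i (\<xi> i \<omega>)))"
    and "integrable M (\<lambda>\<omega>. \<Prod>i\<in>I. wt i \<omega> *\<^sub>R f i (\<xi> i \<omega>))"
proof -
  \<comment> \<open>Each weight is a function of its own summand, so independence under the original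
    measure passes to the weighted factors and no independence under the tilted measure has to be
    formulated.\<close>
  have "indep_vars (\<lambda>_. borel) (\<lambda>i \<omega>. (\<lambda>x. (exp (l * x) / mgf i) *\<^sub>R f i x) (\<xi> i \<omega>)) I"
    by (rule indep_vars_compose2[OF indep]) measurable
  then have "indep_vars (\<lambda>_. borel) (\<lambda>i \<omega>. wt i \<omega> *\<^sub>R f i (\<xi> i \<omega>)) I"
    by (subst indep_vars_cong[OF refl _ refl]) (auto simp: wt_eq)
  from indep_vars_lebesgue_integral[OF I this assms(2)] indep_vars_integrable[OF I this assms(2)]
  show "expectation (\<lambda>\<omega>. \<Prod>i\<in>I. wt i \<omega> *\<^sub>R f i (\<xi> i \<omega>)) = (\<Prod>i\<in>I. expectation (\<lambda>\<omega>. wt i \<omega> *\<^sub>R f i (\<xi> i \<omega>)))"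
    and "integrable M (\<lambda>\<omega>. \<Prod>i\<in>I. wt i \<omega> *\<^sub>R f i (\<xi> i \<omega>))" by auto
qed

lemma integrable_sum_weight: "integrable M sum_weight"
  and expectation_sum_weight: "expectation sum_weight = 1"
  using expectation_prod[of "\<lambda>i x. 1 :: real"] tilted_rv.integrable_weight[OF rvs] tilted_rv.expectation_weight[OF rvs]
  by (simp_all add: sum_weight_def[abs_def])

lemma real_distribution_sum_law: "real_distribution sum_law"
  unfolding sum_law_def
  by (rule real_distribution_weighted_law)
     (auto simp: sum_weight_nonneg integrable_sum_weight expectation_sum_weight)

lemma char_sum_law: "char sum_law t = (\<Prod>i\<in>I. char (lw i) t)"
proof -
  let ?f = "\<lambda>i x. iexp (t * ((x - ctr i) / s))"
  have int: "integrable M (\<lambda>\<omega>. wt i \<omega> *\<^sub>R ?f i (\<xi> i \<omega>))" if "i \<in> I" for i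
    by (rule Bochner_Integration.integrable_bound[OF tilted_rv.integrable_weight[OF rvs[OF that]]])
       (use that rv[OF that] in \<open>auto simp: wt_eq\<close>)
  have "char sum_law t = expectation (\<lambda>\<omega>. sum_weight \<omega> *\<^sub>R iexp (t * std_sum \<omega>))"
    unfolding char_def sum_law_def by (rule integral_weighted_law) (auto simp: sum_weight_nonneg)
  also have "(\<lambda>\<omega>. sum_weight \<omega> *\<^sub>R iexp (t * std_sum \<omega>)) = (\<lambda>\<omega>. \<Prod>i\<in>I. wt i \<omega> *\<^sub>R ?f i (\<xi> i \<omega>))"
  proof
    fix \<omega>
    have "\<i> * complex_of_real (t * std_sum \<omega>) = (\<Sum>i\<in>I. \<i> * complex_of_real (t * ((\<xi> i \<omega> - ctr i) / s)))"
      unfolding std_sum_def sum_divide_distrib sum_distrib_left of_real_sum by simp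
    then show "sum_weight \<omega> *\<^sub>R iexp (t * std_sum \<omega>) = (\<Prod>i\<in>I. wt i \<omega> *\<^sub>R ?f i (\<xi> i \<omega>))"
      using I by (simp only: sum_weight_def exp_sum scaleR_conv_of_real of_real_prod prod.distrib)
  qed
  also have "expectation (\<lambda>\<omega>. \<Prod>i\<in>I. wt i \<omega> *\<^sub>R ?f i (\<xi> i \<omega>)) = (\<Prod>i\<in>I. expectation (\<lambda>\<omega>. wt i \<omega> *\<^sub>R ?f i (\<xi> i \<omega>)))"
    by (rule expectation_prod(1)[OF _ int]) measurable
  also have "\<dots> = (\<Prod>i\<in>I. char (lw i) t)"
    by (intro prod.cong refl tilted_rv.char_law[OF rvs, symmetric])
  finally show ?thesis .
qed

lemma integrable_sum_law: "integrable sum_law (\<lambda>u. u)"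
proof -
  have "integrable M (\<lambda>\<omega>. sum_weight \<omega> * (\<xi> i \<omega> - ctr i))" if i: "i \<in> I" for i
  proof -
    \<comment> \<open>One factor carries the centred variable and all others are 1, so each term of
      the weighted sum is a product to which independence applies.\<close>
    let ?f = "\<lambda>j x. if j = i then x - ctr i else (1::real)"
    have "integrable M (\<lambda>\<omega>. \<Prod>j\<in>I. wt j \<omega> *\<^sub>R ?f j (\<xi> j \<omega>))"
    proof (rule expectation_prod(2))
      fix j assume j: "j \<in> I"
      have "integrable M (\<lambda>\<omega>. wt j \<omega> * \<xi> j \<omega> - wt j \<omega> * ctr i)" "integrable M (wt j)"
        using tilted_rv.integrable_weight_power(1)[OF rvs[OF j], of 1] tilted_rv.integrable_weight[OF rvs[OF j]] by auto
      then show "integrable M (\<lambda>\<omega>. wt j \<omega> *\<^sub>R ?f j (\<xi> j \<omega>))" by (cases "j = i") (auto simp: right_diff_distrib)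
    qed simp
    also have "(\<lambda>\<omega>. \<Prod>j\<in>I. wt j \<omega> *\<^sub>R ?f j (\<xi> j \<omega>)) = (\<lambda>\<omega>. sum_weight \<omega> * (\<xi> i \<omega> - ctr i))"
      using I i by (simp add: sum_weight_def prod.distrib if_distrib[of "\<lambda>f. f _"] fun_eq_iff prod.delta cong: if_cong)
    finally show ?thesis .
  qed
  then have "integrable M (\<lambda>\<omega>. \<Sum>i\<in>I. sum_weight \<omega> * (\<xi> i \<omega> - ctr i) / s)"
    by (intro Bochner_Integration.integrable_sum Bochner_Integration.integrable_divide)
  then have "integrable M (\<lambda>\<omega>. sum_weight \<omega> *\<^sub>R std_sum \<omega>)"
    by (simp add: std_sum_def sum_distrib_left sum_divide_distrib)
  then show ?thesis
    unfolding sum_law_def by (subst integrable_weighted_law) (auto simp: sum_weight_nonneg)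
qed

lemma sum_weight_eq: "(\<Prod>i\<in>I. mgf i) * sum_weight \<omega> = exp (l * (\<Sum>i\<in>I. \<xi> i \<omega>))"
proof -
  have "(\<Prod>i\<in>I. mgf i) * sum_weight \<omega> = (\<Prod>i\<in>I. exp (l * \<xi> i \<omega>))"
    unfolding sum_weight_def prod.distrib[symmetric]
  proof (intro prod.cong refl)
    fix i assume "i \<in> I"
    then show "mgf i * wt i \<omega> = exp (l * \<xi> i \<omega>)" using mgf_pos[of i] by (simp add: wt_eq)
  qed
  then show ?thesis using I by (simp add: exp_sum sum_distrib_left)
qed

text \<open>Change of measure: on the event, the product of the prefactor, the weight and exp (- l *
  (S - a)) is identically 1. Strict inequality is relaxed to the closed half-line, and the estimates
  above are stated for closed sets.\<close>

lemma tail_le_exp_functional: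
  defines "\<delta> \<equiv> \<lambda>a. (a - (\<Sum>i\<in>I. ctr i)) / s"
  shows "emeasure M {\<omega> \<in> space M. (\<Sum>i\<in>I. \<xi> i \<omega>) > a}
    \<le> ennreal (exp (- l * a) * (\<Prod>i\<in>I. mgf i))
      * (\<integral>\<^sup>+u. ennreal (exp (- (l * s) * (u - \<delta> a)) * indicator {\<delta> a..} u) \<partial>sum_law)"
proof -
  let ?K = "exp (- l * a) * (\<Prod>i\<in>I. mgf i)"
  let ?h = "\<lambda>u. exp (- (l * s) * (u - \<delta> a)) * indicator {\<delta> a..} u"
  have [measurable]: "(\<lambda>\<omega>. \<Sum>i\<in>I. \<xi> i \<omega>) \<in> borel_measurable M" by (intro borel_measurable_sum rv)
  have K: "?K \<ge> 0" by (intro mult_nonneg_nonneg prod_nonneg less_imp_le[OF mgf_pos]) auto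
  have "emeasure M {\<omega> \<in> space M. (\<Sum>i\<in>I. \<xi> i \<omega>) > a} = (\<integral>\<^sup>+\<omega>. indicator {\<omega> \<in> space M. (\<Sum>i\<in>I. \<xi> i \<omega>) > a} \<omega> \<partial>M)"
    by (rule nn_integral_indicator[symmetric]) measurable
  also have "\<dots> \<le> (\<integral>\<^sup>+\<omega>. ennreal ?K * (ennreal (sum_weight \<omega>) * ennreal (?h (std_sum \<omega>))) \<partial>M)"
  proof (rule nn_integral_mono)
    fix \<omega>
    let ?S = "\<Sum>i\<in>I. \<xi> i \<omega>"
    have sd: "s * (std_sum \<omega> - \<delta> a) = ?S - a" using s by (simp add: std_sum_def \<delta>_def sum_subtractf field_simps)
    show "indicator {\<omega> \<in> space M. (\<Sum>i\<in>I. \<xi> i \<omega>) > a} \<omega> \<le> ennreal ?K * (ennreal (sum_weight \<omega>) * ennreal (?h (std_sum \<omega>)))"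
    proof (cases "?S > a")
      case True
      then have "0 < s * (std_sum \<omega> - \<delta> a)" by (simp add: sd)
      then have ge: "\<delta> a \<le> std_sum \<omega>" using s by (simp add: zero_less_mult_iff)
      have "?K * (sum_weight \<omega> * ?h (std_sum \<omega>)) = exp (- l * a) * exp (l * ?S) * exp (- l * (s * (std_sum \<omega> - \<delta> a)))"
        using ge by (simp add: sum_weight_eq[symmetric] mult_ac)
      also have "\<dots> = 1" unfolding sd by (simp add: algebra_simps flip: exp_add)
      finally have "ennreal ?K * (ennreal (sum_weight \<omega>) * ennreal (?h (std_sum \<omega>))) = 1"
        using K sum_weight_nonneg[of \<omega>] by (simp flip: ennreal_mult)
      then show ?thesis by (simp add: indicator_def)
    qed simp
  qed
  also have "\<dots> = ennreal ?K * (\<integral>\<^sup>+\<omega>. ennreal (sum_weight \<omega>) * ennreal (?h (std_sum \<omega>)) \<partial>M)"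
    by (rule nn_integral_cmult) measurable
  also have "(\<integral>\<^sup>+\<omega>. ennreal (sum_weight \<omega>) * ennreal (?h (std_sum \<omega>)) \<partial>M) = (\<integral>\<^sup>+u. ennreal (?h u) \<partial>sum_law)"
    unfolding sum_law_def by (rule nn_integral_weighted_law[symmetric]) (auto simp: sum_weight_nonneg)
  finally show ?thesis .
qed

text \<open>The Chernoff bound: the exponential functional is at most 1. It accounts for the
  truncation at 1 in \<open>F2\<close>.\<close>

lemma tail_le_mgf:
  assumes "l \<ge> 0"
  shows "prob {\<omega> \<in> space M. (\<Sum>i\<in>I. \<xi> i \<omega>) > a} \<le> exp (- l * a) * (\<Prod>i\<in>I. mgf i)"
proof -
  have K: "exp (- l * a) * (\<Prod>i\<in>I. mgf i) \<ge> 0" by (intro mult_nonneg_nonneg prod_nonneg less_imp_le[OF mgf_pos]) auto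
  interpret D: real_distribution sum_law by (rule real_distribution_sum_law)
  let ?\<delta> = "(a - (\<Sum>i\<in>I. ctr i)) / s"
  have "(\<integral>\<^sup>+u. ennreal (exp (- (l * s) * (u - ?\<delta>)) * indicator {?\<delta>..} u) \<partial>sum_law) \<le> (\<integral>\<^sup>+u. 1 \<partial>sum_law)"
    using s assms by (intro nn_integral_mono) (auto simp: indicator_def)
  also have "\<dots> = 1" using D.emeasure_space_1 by simp
  finally have "ennreal (exp (- l * a) * (\<Prod>i\<in>I. mgf i)) * (\<integral>\<^sup>+u. ennreal (exp (- (l * s) * (u - ?\<delta>)) * indicator {?\<delta>..} u) \<partial>sum_law)
    \<le> ennreal (exp (- l * a) * (\<Prod>i\<in>I. mgf i)) * 1" by (rule mult_left_mono) simp
  with tail_le_exp_functional[of a] have "emeasure M {\<omega> \<in> space M. (\<Sum>i\<in>I. \<xi> i \<omega>) > a} \<le> ennreal (exp (- l * a) * (\<Prod>i\<in>I. mgf i))"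
    by (auto intro: order_trans)
  then show ?thesis using K by (simp add: emeasure_eq_measure)
qed

end

section \<open>Numerical bounds\<close>

definition R_real :: "real \<Rightarrow> real" where
  "R_real t = (1 - t + 6 * t\<^sup>2) ^ 3 / ((1 - 3 * t) powr (3/2) * (1 - t) ^ 7)"

definition mgf_ratio :: "real \<Rightarrow> real" where
  "mgf_ratio t = (1 - t + 6 * t\<^sup>2) / (1 - t)"

lemma mgf_ratio_eq: "t < 1 \<Longrightarrow> mgf_ratio t = 1 + 6 * t\<^sup>2 / (1 - t)"
  by (simp add: mgf_ratio_def field_simps)

lemma mgf_ratio_ge_1: "t < 1 \<Longrightarrow> 1 \<le> mgf_ratio t"
  by (simp add: mgf_ratio_eq)

text \<open>The factors appear by origin: Laplace transform, variance, third moment. In this form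
  each of them is visibly monotone.\<close>

lemma R_real_eq: "t < 1 / 3 \<Longrightarrow> R_real t = mgf_ratio t ^ 3 / (sqrt (1 - 3 * t) ^ 3 * (1 - t) ^ 4)"
proof -
  assume t: "t < 1 / 3"
  have "(1 - 3 * t) powr (3/2) = sqrt (1 - 3 * t) ^ 3"
    using t by (simp add: powr_half_sqrt[symmetric] powr_power)
  moreover have "(1 - t) ^ 7 = (1 - t) ^ 3 * (1 - t) ^ 4" by (simp flip: power_add)
  ultimately show ?thesis by (simp add: R_real_def mgf_ratio_def power_divide mult_ac)
qed

lemma R_real_mono:
  assumes "0 \<le> s" "s \<le> t" "t < 1 / 3"
  shows "R_real s \<le> R_real t"
proof -
  have "6 * s\<^sup>2 / (1 - s) \<le> 6 * t\<^sup>2 / (1 - t)"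
    using assms by (intro frac_le) (auto intro!: power_mono)
  then have "mgf_ratio s \<le> mgf_ratio t" using assms by (simp add: mgf_ratio_eq)
  then have "mgf_ratio s ^ 3 \<le> mgf_ratio t ^ 3"
    using assms mgf_ratio_ge_1[of s] by (intro power_mono) auto
  moreover have "sqrt (1 - 3 * t) ^ 3 * (1 - t) ^ 4 \<le> sqrt (1 - 3 * s) ^ 3 * (1 - s) ^ 4"
    using assms by (intro mult_mono power_mono) auto
  ultimately show ?thesis
    using assms mgf_ratio_ge_1[of t] by (subst (1 2) R_real_eq) (auto intro!: frac_le mult_pos_pos zero_less_power)
qed

lemma R_real_tenth: "27.99 * R_real 0.1 \<le> 88.41"
proof -
  \<comment> \<open>0.58566 is 0.7 to the power 3/2 rounded down; comparing squares with 0.7^3 =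
    0.343 verifies it.\<close>
  have s: "0.58566 \<le> (0.7::real) powr (3/2)"
  proof -
    have "0.58566 = ((0.58566::real) powr 2) powr (1/2)" by (simp only: powr_powr) simp
    also have "\<dots> \<le> ((0.7::real) powr 3) powr (1/2)"
      by (intro powr_mono2) (simp_all add: powr_numeral power2_eq_square power3_eq_cube)
    also have "\<dots> = 0.7 powr (3/2)" by (simp only: powr_powr) simp
    finally show ?thesis .
  qed
  have "R_real 0.1 = 0.884736 / (0.7 powr (3/2) * 0.9 ^ 7)"
    by (simp add: R_real_def power2_eq_square power3_eq_cube)
  also have "\<dots> \<le> 0.884736 / (0.58566 * 0.9 ^ 7)"
    using s by (intro divide_left_mono mult_right_mono mult_pos_pos) auto
  finally have "27.99 * R_real 0.1 \<le> 27.99 * (0.884736 / (0.58566 * 0.9 ^ 7))" by simp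
  also have "\<dots> \<le> 88.41" by (simp add: eval_nat_numeral)
  finally show ?thesis .
qed

lemma R_eq: "R t = (if t < 1/3 then ereal (R_real t) else \<infinity>)"
  by (simp add: R_def R_real_def)

lemma R_mono: "mono_on {0..} R"
  by (rule mono_onI) (auto simp: R_eq intro: R_real_mono)

text \<open>Here \<open>p\<close> is the quotient of \<open>x\<close> by \<open>\<lambda> * \<sigma>\<close> at the saddle point \<open>\<lambda>\<close>, and \<open>q\<close> bounds the
  quotient of \<open>\<sigma>\<close> by the standard deviation of the tilted sum.\<close>

lemma tilt_loss_le:
  fixes \<tau> :: real
  assumes \<tau>: "0 \<le> \<tau>" "\<tau> < 1 / 3"
  defines "p \<equiv> (1 - \<tau> / 2) / (1 - \<tau>)\<^sup>2" and "q \<equiv> mgf_ratio \<tau> / sqrt (1 - 3 * \<tau>)"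
  shows "1 \<le> q" "1 \<le> p" "p * q - 1 \<le> 4 * (p * \<tau>) * (q ^ 3 / (1 - \<tau>) ^ 4)"
    and "R_real \<tau> = q ^ 3 / (1 - \<tau>) ^ 4"
proof -
  let ?d = "1 - \<tau> + 6 * \<tau>\<^sup>2"
  have u: "0 < 1 - \<tau>" "1 - \<tau> \<le> 1" "0 < 1 - 3 * \<tau>" using \<tau> by auto
  have d: "?d > 0" using u by (intro add_pos_nonneg) auto
  have "sqrt (1 - 3 * \<tau>) \<le> 1" using \<tau> by simp
  also have "1 \<le> mgf_ratio \<tau>" using u by (intro mgf_ratio_ge_1) auto
  finally show q1: "1 \<le> q" using u by (simp add: q_def)
  have p_eq: "p - 1 = p * \<tau> * ((3 / 2 - \<tau>) / (1 - \<tau> / 2))"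
    using \<tau> by (simp add: p_def divide_simps) (simp add: power2_eq_square algebra_simps)
  have p0: "0 \<le> p * \<tau>" using \<tau> by (simp add: p_def)
  have "0 \<le> (3 / 2 - \<tau>) / (1 - \<tau> / 2)" using \<tau> by simp
  with p_eq p0 show p1: "1 \<le> p" by (smt (verit) mult_nonneg_nonneg)
  have "(3 / 2 - \<tau>) / (1 - \<tau> / 2) \<le> 3 / 2" using \<tau> by (simp add: divide_simps)
  with p_eq p0 have pb: "p - 1 \<le> p * \<tau> * (3 / 2)" by (metis mult_left_mono)
  have q2: "q\<^sup>2 = ?d\<^sup>2 / ((1 - 3 * \<tau>) * (1 - \<tau>)\<^sup>2)"
    using u by (simp add: q_def mgf_ratio_def power_divide power_mult_distrib mult.commute)
  have "q\<^sup>2 - 1 \<le> 5 * \<tau> * q\<^sup>2"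
  proof -
    \<comment> \<open>The claim cleared of denominators. The square takes up the low-order terms,
      and 42 - 96 * \<tau> is positive for \<tau> < 1 / 3.\<close>
    have "0 \<le> \<tau> * (2 * (1 - 4 * \<tau>)\<^sup>2 + \<tau>\<^sup>2 * (42 - 96 * \<tau> + 180 * \<tau>\<^sup>2))"
      using \<tau> by (intro mult_nonneg_nonneg add_nonneg_nonneg) auto
    also have "\<dots> = 5 * \<tau> * ?d\<^sup>2 - (?d\<^sup>2 - (1 - 3 * \<tau>) * (1 - \<tau>)\<^sup>2)"
      by (simp add: power2_eq_square algebra_simps)
    finally have "?d\<^sup>2 - (1 - 3 * \<tau>) * (1 - \<tau>)\<^sup>2 \<le> 5 * \<tau> * ?d\<^sup>2" by simp
    then have "(?d\<^sup>2 - (1 - 3 * \<tau>) * (1 - \<tau>)\<^sup>2) / ((1 - 3 * \<tau>) * (1 - \<tau>)\<^sup>2) \<le> 5 * \<tau> * ?d\<^sup>2 / ((1 - 3 * \<tau>) * (1 - \<tau>)\<^sup>2)"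
      using u by (intro divide_right_mono) auto
    then show ?thesis using u unfolding q2 by (simp add: diff_divide_distrib)
  qed
  moreover have "2 * (q - 1) \<le> q\<^sup>2 - 1"
    using zero_le_power2[of "q - 1"] by (simp add: power2_eq_square algebra_simps)
  ultimately have qb: "q - 1 \<le> 5 / 2 * (\<tau> * q\<^sup>2)" by simp
  have q23: "q\<^sup>2 \<le> q ^ 3" "1 \<le> q ^ 3" using q1 by (auto intro: power_increasing one_le_power)
  have "p * q - 1 = p * (q - 1) + (p - 1)" by (simp add: algebra_simps)
  also have "\<dots> \<le> p * (5 / 2 * (\<tau> * q\<^sup>2)) + p * \<tau> * (3 / 2)"
    using qb pb p1 by (intro add_mono mult_left_mono) auto
  also have "\<dots> = p * \<tau> * (5 / 2 * q\<^sup>2 + 3 / 2)" by (simp add: algebra_simps)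
  also have "\<dots> \<le> p * \<tau> * (4 * (q ^ 3 / (1 - \<tau>) ^ 4))"
  proof (rule mult_left_mono[OF _ p0])
    have "q ^ 3 / 1 \<le> q ^ 3 / (1 - \<tau>) ^ 4"
      using u q23 q1 by (intro divide_left_mono) (auto simp: power_le_one)
    \<comment> \<open>The constant 4 is 5 / 2 + 3 / 2, the sum of the losses in \<open>q\<close> and
      in \<open>p\<close>, both measured by q ^ 3 \<ge> 1.\<close>
    then show "5 / 2 * q\<^sup>2 + 3 / 2 \<le> 4 * (q ^ 3 / (1 - \<tau>) ^ 4)" using q23 by simp
  qed
  finally show "p * q - 1 \<le> 4 * (p * \<tau>) * (q ^ 3 / (1 - \<tau>) ^ 4)" by (simp only: mult_ac)
  show "R_real \<tau> = q ^ 3 / (1 - \<tau>) ^ 4"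
    using \<tau> by (simp add: R_real_eq q_def power_divide)
qed

text \<open>Jensen's inequality for the logarithm, through its tangent at the mean, where the linear
  terms cancel. Averaging over n summands is what yields the factor with \<open>psi\<close> in
  \<open>Bn\<close>, beyond the classical Bernstein exponent.\<close>

lemma prod_one_plus_le:
  fixes y :: "'i \<Rightarrow> real"
  assumes I: "finite I" "I \<noteq> {}" and y: "\<And>i. i \<in> I \<Longrightarrow> y i \<ge> 0"
  shows "(\<Prod>i\<in>I. 1 + y i) \<le> exp (card I * ln (1 + (\<Sum>i\<in>I. y i) / card I))"
proof -
  define a where "a = (\<Sum>i\<in>I. y i) / card I"
  have c: "real (card I) > 0" using I by (simp add: card_gt_0_iff)
  have a: "a \<ge> 0" using y by (simp add: a_def sum_nonneg)
  have "ln (1 + y i) \<le> ln (1 + a) + (y i - a) / (1 + a)" if "i \<in> I" for i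
  proof -
    have "ln ((1 + y i) / (1 + a)) \<le> (1 + y i) / (1 + a) - 1"
      using y[OF that] a by (intro ln_le_minus_one) auto
    moreover have "ln ((1 + y i) / (1 + a)) = ln (1 + y i) - ln (1 + a)"
      using y[OF that] a by (subst ln_div) auto
    moreover have "(1 + y i) / (1 + a) - 1 = (y i - a) / (1 + a)" using a by (simp add: field_simps)
    ultimately show ?thesis by linarith
  qed
  then have "(\<Sum>i\<in>I. ln (1 + y i)) \<le> (\<Sum>i\<in>I. ln (1 + a) + (y i - a) / (1 + a))" by (rule sum_mono)
  also have "\<dots> = card I * ln (1 + a) + ((\<Sum>i\<in>I. y i) - card I * a) / (1 + a)"
    by (simp add: sum.distrib sum_subtractf flip: sum_divide_distrib)
  also have "(\<Sum>i\<in>I. y i) - card I * a = 0" using c by (simp add: a_def)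
  finally have "exp (\<Sum>i\<in>I. ln (1 + y i)) \<le> exp (card I * ln (1 + a))" by simp
  moreover have "exp (\<Sum>i\<in>I. ln (1 + y i)) = (\<Prod>i\<in>I. 1 + y i)"
    unfolding exp_sum[OF I(1)] using y by (intro prod.cong refl exp_ln) (auto simp: add_pos_nonneg)
  ultimately show ?thesis by (simp add: a_def)
qed

text \<open>The first hypothesis says that \<open>s\<close> is the standard deviation of the tilted
  sum, so the scaled laws have total variance 1. At l = 0 the mixture over intervals degenerates and
  the functional is a plain tail, to which the one-sided inequality applies.\<close>

lemma (in tilted_sum) exp_functional_le:
  assumes s2: "s\<^sup>2 = (\<Sum>i\<in>I. \<integral>u. (s * u)\<^sup>2 \<partial>lw i)" and \<delta>: "\<delta> \<ge> 0" and l: "l \<ge> 0"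
  shows "(\<integral>\<^sup>+u. ennreal (exp (- (l * s) * (u - \<delta>)) * indicator {\<delta>..} u) \<partial>sum_law)
    \<le> ennreal (Mills (l * s) + 4.8 * (\<Sum>i\<in>I. \<integral>u. \<bar>u\<bar> ^ 3 \<partial>lw i))"
proof -
  let ?L = "\<Sum>i\<in>I. \<integral>u. \<bar>u\<bar> ^ 3 \<partial>lw i"
  have L: "?L \<ge> 0" by (intro sum_nonneg integral_nonneg) auto
  have Mills: "Mills (l * s) \<ge> 0" by (auto simp: Mills_integral indicator_def intro!: integral_nonneg_AE)
  interpret D: real_distribution sum_law by (rule real_distribution_sum_law)
  have "s\<^sup>2 = s\<^sup>2 * (\<Sum>i\<in>I. \<integral>u. u\<^sup>2 \<partial>lw i)" using s2 by (simp add: power_mult_distrib sum_distrib_left)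
  then have var: "(\<Sum>i\<in>I. \<integral>u. u\<^sup>2 \<partial>lw i) = 1" using s by simp
  note lm = tilted_rv.law_moments[OF rvs s]
  show ?thesis
  proof (cases "l = 0")
    case True
    have "measure sum_law {\<delta>..} \<le> measure std_normal_distribution {\<delta>..} + 2.4 * ?L"
      by (rule berry_esseen_upper[where D = sum_law and I = I and X = lw and a = \<delta>])
         (fact real_distribution_sum_law integrable_sum_law I var char_sum_law tilted_rv.real_distribution_law[OF rvs] lm)+
    then have "measure sum_law {\<delta>..} \<le> Mills (l * s) + 4.8 * ?L"
      using normal_tail_le[OF \<delta>] True L by simp
    moreover have "(\<integral>\<^sup>+u. ennreal (exp (- (l * s) * (u - \<delta>)) * indicator {\<delta>..} u) \<partial>sum_law) = (\<integral>\<^sup>+u. indicator {\<delta>..} u \<partial>sum_law)"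
      using True by (intro nn_integral_cong) (auto simp: indicator_def)
    ultimately show ?thesis by (simp add: D.emeasure_eq_measure ennreal_leI)
  next
    case False
    have "(\<integral>\<^sup>+u. ennreal (exp (- (l * s) * (u - \<delta>)) * indicator {\<delta>..} u) \<partial>sum_law)
      \<le> (\<integral>\<^sup>+u. ennreal (exp (- (l * s) * (u - \<delta>)) * indicator {\<delta>..} u) \<partial>std_normal_distribution) + ennreal (4.8 * ?L)"
    proof (rule exp_functional_compare[OF real_distribution_sum_law real_dist_normal_dist])
      show "l * s > 0" using False l s by simp
      show "0 \<le> 4.8 * ?L" using L by simp
      show "measure sum_law {a..b} \<le> measure std_normal_distribution {a..b} + 4.8 * ?L" if "a \<le> b" for a b
        by (rule berry_esseen_interval[where D = sum_law and I = I and X = lw and a = a and b = b])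
           (fact real_distribution_sum_law integrable_sum_law I var char_sum_law tilted_rv.real_distribution_law[OF rvs] lm that)+
    qed
    also have "\<dots> \<le> ennreal (Mills (l * s)) + ennreal (4.8 * ?L)"
      using l s \<delta> by (intro add_right_mono normal_exp_functional_le) auto
    also have "\<dots> = ennreal (Mills (l * s) + 4.8 * ?L)" using Mills L by simp
    finally show ?thesis .
  qed
qed

section \<open>Large deviations\<close>

text \<open>The tilting parameter \<open>\<lambda> = xhat x r / (s * \<sigma>)\<close>, with \<open>\<tau> = \<lambda> * \<epsilon>\<close>, minimises
  \<open>(\<lambda> * \<sigma>)\<^sup>2 / (2 * (1 - \<lambda> * \<epsilon>)) - \<lambda> * x * \<sigma>\<close>; stationarity is the last but one identity, and it places the
  mean of the tilted sum at or below \<open>x * \<sigma>\<close>.\<close>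

lemma saddlepoint_identities:
  fixes x r :: real
  assumes x: "x \<ge> 0" and r: "r > 0"
  defines "s \<equiv> sqrt (1 + 2 * x * r)" and "\<tau> \<equiv> xhat x r * r / sqrt (1 + 2 * x * r)"
  shows "s \<ge> 1" "\<tau> = 1 - 1 / s" "0 \<le> \<tau>" "\<tau> < 1" "0 \<le> xhat x r"
    and "x = xhat x r * (1 + s) / 2"
    and "x = xhat x r / s * ((1 - \<tau> / 2) / (1 - \<tau>)\<^sup>2)"
    and "x * r = (1 - \<tau> / 2) / (1 - \<tau>)\<^sup>2 * \<tau>"
proof -
  show s: "s \<ge> 1" using x r by (simp add: s_def)
  have s2: "s\<^sup>2 = 1 + 2 * x * r" using x r by (simp add: s_def)
  have xh: "xhat x r = 2 * x / (1 + s)" by (simp add: xhat_def s_def)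
  show "0 \<le> xhat x r" using x s by (simp add: xh)
  show xs: "x = xhat x r * (1 + s) / 2" using s by (simp add: xh)
  have "xhat x r * r = (s\<^sup>2 - 1) / (1 + s)" by (simp add: xh s2)
  also have "\<dots> = s - 1" using s by (simp add: divide_simps) (simp add: power2_eq_square algebra_simps)
  finally show \<tau>: "\<tau> = 1 - 1 / s" using s by (simp add: \<tau>_def s_def[symmetric] diff_divide_distrib)
  show "0 \<le> \<tau>" "\<tau> < 1" using s by (auto simp: \<tau>)
  have p: "(1 - \<tau> / 2) / (1 - \<tau>)\<^sup>2 = s * (1 + s) / 2"
    using s by (simp add: \<tau> power_divide field_simps power2_eq_square)
  show "x = xhat x r / s * ((1 - \<tau> / 2) / (1 - \<tau>)\<^sup>2)" unfolding p using s xs by simp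
  have "(1 - \<tau> / 2) / (1 - \<tau>)\<^sup>2 * \<tau> = (s\<^sup>2 - 1) / 2"
    unfolding p using s by (simp add: \<tau> field_simps power2_eq_square)
  then show "x * r = (1 - \<tau> / 2) / (1 - \<tau>)\<^sup>2 * \<tau>" by (simp add: s2)
qed

text \<open>At the saddle point \<lambda> * x * \<sigma> splits into xhat^2 / 2, the exponent of
  \<open>B\<close>, and a term that cancels the linear part of \<open>psi\<close>. So
  \<open>Bn\<close> is a Chernoff bound with the logarithm left intact.\<close>

lemma Bn_eq:
  assumes x: "x \<ge> 0" and r: "r > 0" and n: "n > 0"
  defines "s \<equiv> sqrt (1 + 2 * x * r)"
  shows "Bn n x r = exp (- (xhat x r / s) * x) * exp (real n * ln (1 + (xhat x r)\<^sup>2 / (2 * s) / real n))"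
proof -
  note S = saddlepoint_identities[OF x r, folded s_def]
  let ?y = "(xhat x r)\<^sup>2 / (2 * s)"
  have "(xhat x r / s) * x = (xhat x r / s) * (xhat x r * (1 + s) / 2)" by (simp only: S(6)[symmetric])
  also have "\<dots> = (xhat x r)\<^sup>2 / 2 + ?y" using S(1) by (simp add: field_simps power2_eq_square)
  finally have e: "(xhat x r / s) * x = (xhat x r)\<^sup>2 / 2 + ?y" .
  have a: "(xhat x r)\<^sup>2 / (2 * real n * s) = ?y / real n" by (simp add: mult_ac)
  have "Bn n x r = exp (- (xhat x r)\<^sup>2 / 2) * exp (- real n * (?y / real n - ln (1 + ?y / real n)))"
    unfolding Bn_def B_def psi_def s_def[symmetric] a ..
  also have "\<dots> = exp (- (xhat x r / s) * x) * exp (real n * ln (1 + ?y / real n))"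
    using n e by (simp add: right_diff_distrib flip: exp_add)
  finally show ?thesis .
qed

section \<open>The sum at its saddle point\<close>

locale bernstein_sum = prob_space M for M :: "'a measure" +
  fixes \<xi> :: "nat \<Rightarrow> 'a \<Rightarrow> real" and n :: nat and \<epsilon> :: real
  assumes indep: "indep_vars (\<lambda>_. borel) \<xi> {1..n}"
    and bern: "\<And>i. i \<in> {1..n} \<Longrightarrow> bernstein_rv M (\<xi> i) \<epsilon>"
    and var_pos: "(\<Sum>i=1..n. \<integral>\<omega>. (\<xi> i \<omega>)\<^sup>2 \<partial>M) > 0"
    and eps: "\<epsilon> > 0"
begin

definition "\<sigma> = sqrt (\<Sum>i=1..n. \<integral>\<omega>. (\<xi> i \<omega>)\<^sup>2 \<partial>M)"
definition "r = \<epsilon> / \<sigma>"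
abbreviation "vr i \<equiv> bernstein_rv.v M (\<xi> i)"
abbreviation "rt x \<equiv> sqrt (1 + 2 * x * r)"
definition "saddle x = xhat x r / rt x / \<sigma>"
definition "tau x = xhat x r * r / rt x"

lemma \<sigma>_pos: "\<sigma> > 0" and r_pos: "r > 0" using var_pos eps by (auto simp: \<sigma>_def r_def)

lemma n_pos: "n > 0" using var_pos by (cases n) auto

lemma sum_vr: "(\<Sum>i=1..n. vr i) = \<sigma>\<^sup>2"
proof -
  have "(\<Sum>i=1..n. vr i) = (\<Sum>i=1..n. \<integral>\<omega>. (\<xi> i \<omega>)\<^sup>2 \<partial>M)"
    by (intro sum.cong refl bernstein_rv.v_def[OF bern])
  then show ?thesis using var_pos by (simp add: \<sigma>_def)
qed

lemma saddle_eps: "saddle x * \<epsilon> = tau x"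
  by (simp add: saddle_def tau_def r_def)

lemma saddle_nonneg: "x \<ge> 0 \<Longrightarrow> saddle x \<ge> 0"
  using saddlepoint_identities(1,5)[of x r] r_pos \<sigma>_pos by (simp add: saddle_def)

lemma tilted_sum: "x \<ge> 0 \<Longrightarrow> s > 0 \<Longrightarrow> tilted_sum M \<xi> {1..n} \<epsilon> (saddle x) s"
proof -
  assume x: "x \<ge> 0" and s: "s > 0"
  have l: "0 \<le> saddle x" "saddle x * \<epsilon> < 1"
    using saddle_nonneg[OF x] saddlepoint_identities(4)[OF x r_pos] by (auto simp: saddle_eps tau_def)
  show ?thesis
    by (intro tilted_sum.intro tilted_sum_axioms.intro prob_space_axioms finite_atLeastAtMost
        s indep tilted_rv.intro bern tilted_rv_axioms.intro l)
qed

lemma mgf_prod_le_Bn: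
  assumes x: "x \<ge> 0"
  shows "exp (- saddle x * (x * \<sigma>)) * (\<Prod>i\<in>{1..n}. bernstein_rv.m M (\<xi> i) 0 (saddle x)) \<le> Bn n x r"
proof -
  let ?l = "saddle x" and ?s = "rt x"
  note S = saddlepoint_identities[OF x r_pos]
  define y where "y i = ?l\<^sup>2 * vr i / (2 * (1 - ?l * \<epsilon>))" for i
  have l: "0 \<le> ?l" "?l * \<epsilon> < 1" using saddle_nonneg[OF x] S(4) by (auto simp: saddle_eps tau_def)
  have v: "vr i \<ge> 0" if "i \<in> {1..n}" for i by (rule bernstein_rv.v_nonneg[OF bern[OF that]])
  have m: "0 \<le> bernstein_rv.m M (\<xi> i) 0 ?l" "bernstein_rv.m M (\<xi> i) 0 ?l \<le> 1 + y i" if "i \<in> {1..n}" for i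
    using bernstein_rv.m0_ge_1[OF bern[OF that] l] bernstein_rv.m0_le[OF bern[OF that] l] by (auto simp: y_def)
  have "(\<Prod>i\<in>{1..n}. bernstein_rv.m M (\<xi> i) 0 ?l) \<le> (\<Prod>i\<in>{1..n}. 1 + y i)"
    by (intro prod_mono conjI m)
  also have "\<dots> \<le> exp (real (card {1..n}) * ln (1 + (\<Sum>i\<in>{1..n}. y i) / real (card {1..n})))"
    using n_pos v l by (intro prod_one_plus_le) (auto simp: y_def)
  also have "(\<Sum>i\<in>{1..n}. y i) = (xhat x r)\<^sup>2 / (2 * ?s)"
  proof -
    have "(\<Sum>i\<in>{1..n}. y i) = ?l\<^sup>2 * (\<Sum>i\<in>{1..n}. vr i) / (2 * (1 - ?l * \<epsilon>))"
      unfolding y_def by (simp add: sum_distrib_left sum_divide_distrib)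
    also have "\<dots> = (xhat x r / ?s)\<^sup>2 / (2 * (1 / ?s))"
    proof -
      have "1 - ?l * \<epsilon> = 1 / ?s" using S(2) by (simp add: saddle_eps tau_def)
      moreover have "?l\<^sup>2 * \<sigma>\<^sup>2 = (xhat x r / ?s)\<^sup>2"
        using \<sigma>_pos by (simp add: saddle_def power_divide power_mult_distrib)
      ultimately show ?thesis by (simp only: sum_vr)
    qed
    also have "\<dots> = (xhat x r)\<^sup>2 / (2 * ?s)"
    proof -
      have "(a / z)\<^sup>2 / (2 * (1 / z)) = a\<^sup>2 / (2 * z)" for a z :: real
        by (simp add: power2_eq_square)
      then show ?thesis .
    qed
    finally show ?thesis .
  qed
  finally have F: "exp (- ?l * (x * \<sigma>)) * (\<Prod>i\<in>{1..n}. bernstein_rv.m M (\<xi> i) 0 ?l)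
    \<le> exp (- ?l * (x * \<sigma>)) * exp (real n * ln (1 + (xhat x r)\<^sup>2 / (2 * ?s) / real n))"
    by (intro mult_left_mono) auto
  have "?l * (x * \<sigma>) = xhat x r / ?s * x" using \<sigma>_pos by (simp add: saddle_def)
  then have "exp (- ?l * (x * \<sigma>)) = exp (- (xhat x r / ?s) * x)" by (simp only: mult_minus_left)
  with F show ?thesis unfolding Bn_eq[OF x r_pos n_pos] by (simp only:)
qed

text \<open>The Chernoff bound does not depend on the scale of the tilted sum, so scale 1 is
  chosen.\<close>

lemma tail_le_Bn:
  assumes x: "x \<ge> 0"
  shows "prob {\<omega> \<in> space M. (\<Sum>i=1..n. \<xi> i \<omega>) > x * \<sigma>} \<le> Bn n x r"
  using tilted_sum.tail_le_mgf[OF tilted_sum[OF x zero_less_one] saddle_nonneg[OF x], of "x * \<sigma>"] mgf_prod_le_Bn[OF x]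
  by linarith

lemma Bn_nonneg: "Bn n x r \<ge> 0" by (simp add: Bn_def B_def)

lemma tail_le_Bn_Mills:
  assumes x: "x \<ge> 0" and xr: "x * r < 1 / 3"
  shows "prob {\<omega> \<in> space M. (\<Sum>i=1..n. \<xi> i \<omega>) > x * \<sigma>} \<le> Bn n x r * (Mills x + 27.99 * R_real (x * r) * r)"
proof -
  let ?I = "{1..n}"
  define l where "l = saddle x"
  define \<tau> where "\<tau> = tau x"
  define p where "p = (1 - \<tau> / 2) / (1 - \<tau>)\<^sup>2"
  define q where "q = mgf_ratio \<tau> / sqrt (1 - 3 * \<tau>)"
  define m where "m i j = bernstein_rv.m M (\<xi> i) j l" for i j
  define vt where "vt i = (m i 0 * m i 2 - (m i 1)\<^sup>2) / (m i 0)\<^sup>2" for i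
  note S = saddlepoint_identities[OF x r_pos, folded tau_def, folded \<tau>_def, folded p_def]
  have l: "0 \<le> l" "l * \<epsilon> < 1" "l * \<epsilon> = \<tau>"
    using saddle_nonneg[OF x] S(4) by (auto simp: l_def \<tau>_def saddle_eps)
  \<comment> \<open>\<open>tilt_loss_le\<close> also yields this, but only for \<tau> < 1 / 3, which
    is deduced below from p \<ge> 1 and p * \<tau> = x * r. The closed form of \<open>p\<close>
    avoids the circle.\<close>
  have p1': "1 \<le> p"
  proof -
    have "p = rt x * (1 + rt x) / 2"
      using S(1) by (simp add: p_def S(2) power_divide field_simps power2_eq_square)
    moreover have "1 * 2 \<le> rt x * (1 + rt x)" using S(1) by (intro mult_mono) auto
    ultimately show ?thesis by simp
  qed
  have \<tau>xr: "\<tau> \<le> x * r" using S(3) p1' mult_right_mono[of 1 p \<tau>] by (simp add: S(8))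
  have \<tau>: "0 \<le> \<tau>" "\<tau> < 1 / 3" using S(3) \<tau>xr xr by auto
  note T = tilt_loss_le[OF \<tau>, folded p_def q_def]
  have trv: "tilted_rv M (\<xi> i) \<epsilon> l" if "i \<in> ?I" for i
    using l by (intro tilted_rv.intro bern that tilted_rv_axioms.intro) auto
  have v0: "vr i \<ge> 0" if "i \<in> ?I" for i by (rule bernstein_rv.v_nonneg[OF bern[OF that]])
  define V where "V = (1 - 3 * \<tau>) * (1 - \<tau>)\<^sup>2 / (1 - \<tau> + 6 * \<tau>\<^sup>2)\<^sup>2"
  have Vq: "V = 1 / q\<^sup>2"
    using \<tau> by (simp add: V_def q_def mgf_ratio_def power_divide power_mult_distrib)
  have vt_ge: "vr i * V \<le> vt i" if "i \<in> ?I" for i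
    using tilted_rv.law_variance_ge[OF trv[OF that] zero_less_one] \<tau> l unfolding vt_def m_def V_def by simp
  define s where "s = sqrt (\<Sum>i\<in>?I. vt i)"
  have "\<sigma>\<^sup>2 / q\<^sup>2 = (\<Sum>i\<in>?I. vr i * V)" by (simp only: sum_distrib_right[symmetric] sum_vr) (simp add: Vq)
  also have "\<dots> \<le> (\<Sum>i\<in>?I. vt i)" by (rule sum_mono) (rule vt_ge)
  finally have vts: "(\<sigma> / q)\<^sup>2 \<le> (\<Sum>i\<in>?I. vt i)" by (simp add: power_divide)
  have \<sigma>q: "0 < \<sigma> / q" using \<sigma>_pos T(1) by simp
  have s_ge: "\<sigma> / q \<le> s" unfolding s_def by (rule real_le_rsqrt[OF vts])
  have s: "s > 0" using s_ge \<sigma>q by linarith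
  have s2: "s\<^sup>2 = (\<Sum>i\<in>?I. vt i)"
    unfolding s_def using vts \<sigma>q by (intro real_sqrt_pow2) (meson order_trans zero_le_power2)
  interpret TS: tilted_sum M \<xi> ?I \<epsilon> l s unfolding l_def by (rule tilted_sum[OF x s])
  note lm = tilted_rv.law_moments[OF trv s]
  have e2: "(\<integral>u. (s * u)\<^sup>2 \<partial>tilted_rv.law M (\<xi> i) l s) = vt i" if "i \<in> ?I" for i
    using lm(4)[OF that] s by (simp add: power_mult_distrib vt_def m_def)
  define \<delta> where "\<delta> = (x * \<sigma> - (\<Sum>i\<in>?I. tilted_rv.center M (\<xi> i) l)) / s"
  have l\<sigma>: "l * \<sigma> = xhat x r / rt x" using \<sigma>_pos by (simp add: l_def saddle_def)
  have xp: "x = l * \<sigma> * p" using S(7) l\<sigma> by simp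
  \<comment> \<open>Each tilted mean is at most l * p times its variance, and these bounds add up to
    exactly x * \<sigma> by stationarity.\<close>
  have \<delta>: "\<delta> \<ge> 0"
  proof -
    have "(\<Sum>i\<in>?I. tilted_rv.center M (\<xi> i) l) \<le> (\<Sum>i\<in>?I. l * p * vr i)"
      using tilted_rv.center_bounds(2)[OF trv] l(3) by (intro sum_mono) (simp add: p_def mult_ac)
    also have "\<dots> = l * p * \<sigma>\<^sup>2" by (simp only: sum_distrib_left[symmetric] sum_vr)
    also have "\<dots> = x * \<sigma>" using xp by (simp add: power2_eq_square mult_ac)
    finally show ?thesis using s by (simp add: \<delta>_def)
  qed
  \<comment> \<open>the constant: \<open>4.8 * 5.2\<close> from the Berry--Esseen error and \<open>2\<close> from replacing \<open>l * s\<close> by \<open>x\<close> in the Mills ratio\<close>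
  define L where "L = (\<Sum>i\<in>?I. \<integral>u. \<bar>u\<bar> ^ 3 \<partial>tilted_rv.law M (\<xi> i) l s)"
  have L_le: "L \<le> 5.2 * R_real \<tau> * r"
  proof -
    let ?c = "3 / 2 * sqrt 12 * \<epsilon> / (1 - \<tau>) ^ 4"
    have c: "?c \<ge> 0" using \<tau> eps by simp
    have "L \<le> (\<Sum>i\<in>?I. ?c * vr i / s ^ 3)"
      unfolding L_def using lm(6) l(3) by (intro sum_mono) (simp add: mult_ac)
    also have "\<dots> = ?c * \<sigma>\<^sup>2 / s ^ 3"
      by (simp only: sum_divide_distrib[symmetric] sum_distrib_left[symmetric] sum_vr)
    also have "\<dots> \<le> ?c * \<sigma>\<^sup>2 / (\<sigma> / q) ^ 3"
      using s_ge \<sigma>q s by (intro divide_left_mono power_mono mult_nonneg_nonneg[OF c]) auto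
    also have "\<dots> = 3 / 2 * sqrt 12 * (q ^ 3 / (1 - \<tau>) ^ 4) * r"
      using \<sigma>_pos by (simp add: r_def power_divide power2_eq_square power3_eq_cube mult_ac)
    also have "\<dots> \<le> 5.2 * (q ^ 3 / (1 - \<tau>) ^ 4) * r"
    proof (intro mult_right_mono)
      have "sqrt 12 \<le> 5.2 * (2 / 3)" by (rule real_le_lsqrt) (auto simp: power2_eq_square)
      then show "3 / 2 * sqrt 12 \<le> 5.2" by simp
    qed (use r_pos T(1) \<tau> in auto)
    finally show ?thesis by (simp add: T(4))
  qed
  have R\<tau>: "R_real \<tau> \<le> R_real (x * r)" by (rule R_real_mono[OF \<tau>(1) \<tau>xr xr])
  have R0: "0 \<le> R_real \<tau> * r" using T(1,4) \<tau> r_pos by simp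
  have M_le: "Mills (l * s) \<le> Mills x + 2 * R_real \<tau> * r"
  \<comment> \<open>If l * s exceeds x, monotonicity of the Mills ratio is enough. The case x = 0
    goes the same way, as the comparison in the first case divides by x.\<close>
  proof (cases "l * s \<le> x \<and> x > 0")
    case True
    have lpos: "l > 0" using xp l(1) True by (auto simp: less_le)
    have "1 / (l * s) \<le> 1 / (l * (\<sigma> / q))"
      using lpos by (intro divide_left_mono mult_left_mono mult_pos_pos s_ge \<sigma>q s) auto
    also have "\<dots> = p * q / x" using xp lpos \<sigma>_pos p1' T(1) by (simp add: field_simps)
    finally have "1 / (l * s) - 1 / x \<le> (p * q - 1) / x" by (simp add: diff_divide_distrib)
    also have "\<dots> \<le> 4 * (p * \<tau>) * R_real \<tau> / x" using T(3,4) True by (intro divide_right_mono) auto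
    \<comment> \<open>The identity p * \<tau> = x * r cancels the denominator x, so the loss stays
      bounded for small x. Below, sqrt (2 * pi) \<ge> 2 halves the constant.\<close>
    also have "\<dots> = 4 * R_real \<tau> * r" using True S(8) by (simp add: field_simps)
    finally have d: "1 / (l * s) - 1 / x \<le> 4 * R_real \<tau> * r" .
    have "Mills (l * s) \<le> Mills x + (1 / (l * s) - 1 / x) / sqrt (2 * pi)"
      using True lpos s by (intro Mills_diff_le) auto
    also have "(1 / (l * s) - 1 / x) / sqrt (2 * pi) \<le> 4 * R_real \<tau> * r / sqrt (2 * pi)"
      using d by (intro divide_right_mono) auto
    also have "\<dots> \<le> 4 * R_real \<tau> * r / 2"
    proof (intro divide_left_mono)
      show "2 \<le> sqrt (2 * pi)" by (rule real_le_rsqrt) (use pi_gt3 in auto)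
    qed (use R0 in \<open>auto simp: mult.assoc\<close>)
    finally show ?thesis by simp
  next
    case False
    then have "Mills (l * s) \<le> Mills x" using x s l by (intro Mills_antimono) (auto simp: not_le not_less)
    then show ?thesis using R0 by simp
  qed
  have "Mills (l * s) + 4.8 * L \<le> Mills x + 2 * (R_real \<tau> * r) + 4.8 * (5.2 * (R_real \<tau> * r))"
    using M_le L_le by (simp add: mult.assoc)
  also have "\<dots> \<le> Mills x + 27.99 * (R_real \<tau> * r)" using R0 by simp
  also have "\<dots> \<le> Mills x + 27.99 * (R_real (x * r) * r)"
    using R\<tau> r_pos by (intro add_left_mono mult_left_mono mult_right_mono) auto
  finally have J: "Mills (l * s) + 4.8 * L \<le> Mills x + 27.99 * R_real (x * r) * r" by (simp add: mult.assoc)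
  have J0: "0 \<le> Mills (l * s) + 4.8 * L"
    unfolding L_def by (intro add_nonneg_nonneg mult_nonneg_nonneg sum_nonneg integral_nonneg)
      (auto simp: Mills_integral indicator_def intro!: integral_nonneg_AE)
  let ?K = "exp (- l * (x * \<sigma>)) * (\<Prod>i\<in>?I. bernstein_rv.m M (\<xi> i) 0 l)"
  have K: "?K \<le> Bn n x r" unfolding l_def by (rule mgf_prod_le_Bn[OF x])
  have "ennreal (prob {\<omega> \<in> space M. (\<Sum>i\<in>?I. \<xi> i \<omega>) > x * \<sigma>}) \<le>
      ennreal ?K * (\<integral>\<^sup>+u. ennreal (exp (- (l * s) * (u - \<delta>)) * indicator {\<delta>..} u) \<partial>TS.sum_law)"
    using TS.tail_le_exp_functional[of "x * \<sigma>"] by (simp only: emeasure_eq_measure \<delta>_def)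
  also have "\<dots> \<le> ennreal (Bn n x r) * ennreal (Mills (l * s) + 4.8 * L)"
    unfolding L_def
    by (intro mult_mono ennreal_leI K TS.exp_functional_le \<delta> l) (simp_all add: s2 e2)
  also have "\<dots> = ennreal (Bn n x r * (Mills (l * s) + 4.8 * L))"
    using Bn_nonneg J0 by (simp add: ennreal_mult)
  finally have "prob {\<omega> \<in> space M. (\<Sum>i\<in>?I. \<xi> i \<omega>) > x * \<sigma>} \<le> Bn n x r * (Mills (l * s) + 4.8 * L)"
    using Bn_nonneg J0 by simp
  also have "\<dots> \<le> Bn n x r * (Mills x + 27.99 * R_real (x * r) * r)"
    by (intro mult_left_mono J Bn_nonneg)
  finally show ?thesis .
qed

lemma tail_le_Bn_F2:
  assumes x: "x \<ge> 0"
  shows "ereal (prob {\<omega> \<in> space M. (\<Sum>i=1..n. \<xi> i \<omega>) > x * \<sigma>}) \<le> ereal (Bn n x r) * F2 x r"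
    and "ereal (Bn n x r) * F2 x r \<le> ereal (Bn n x r)"
proof -
  show "ereal (Bn n x r) * F2 x r \<le> ereal (Bn n x r)"
    using ereal_mult_left_mono[of "F2 x r" 1 "ereal (Bn n x r)"] Bn_nonneg by (simp add: F2_def)
  show "ereal (prob {\<omega> \<in> space M. (\<Sum>i=1..n. \<xi> i \<omega>) > x * \<sigma>}) \<le> ereal (Bn n x r) * F2 x r"
  proof (cases "x * r < 1 / 3")
    case True
    define a where "a = Mills x + 27.99 * R_real (x * r) * r"
    have "F2 x r = ereal (min a 1)"
      using True by (simp add: F2_def R_eq a_def min_def one_ereal_def)
    then show ?thesis
      using tail_le_Bn_Mills[OF x True, folded a_def] tail_le_Bn[OF x] by (simp add: min_def)
  next
    case False
    \<comment> \<open>For x * r \<ge> 1 / 3 the value of \<open>R\<close> is infinite, and its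
      product with r > 0 remains so; the minimum is 1 and the Chernoff bound alone is
      claimed.\<close>
    then have "F2 x r = 1" using r_pos by (simp add: F2_def R_eq)
    then show ?thesis using tail_le_Bn[OF x] by simp
  qed
qed

end

theorem theorem2:
  fixes M :: "'a measure" and \<xi> :: "nat \<Rightarrow> 'a \<Rightarrow> real" and n :: nat
    and \<epsilon> :: real
  assumes P: "prob_space M"
    and rv: "\<And>i. i \<in> {1..n} \<Longrightarrow> \<xi> i \<in> borel_measurable M"
    and indep: "prob_space.indep_vars M (\<lambda>_. borel) \<xi> {1..n}"
    and moments: "\<And>i k. i \<in> {1..n} \<Longrightarrow> integrable M (\<lambda>\<omega>. \<xi> i \<omega> ^ k)"
    and mean0: "\<And>i. i \<in> {1..n} \<Longrightarrow> (\<integral>\<omega>. \<xi> i \<omega> \<partial>M) = 0"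
    and eps: "\<epsilon> > 0"
    and bern: "\<And>i k. i \<in> {1..n} \<Longrightarrow> k \<ge> 3 \<Longrightarrow>
       \<bar>\<integral>\<omega>. \<xi> i \<omega> ^ k \<partial>M\<bar> \<le> 1/2 * fact k * \<epsilon> ^ (k - 2) * (\<integral>\<omega>. (\<xi> i \<omega>)\<^sup>2 \<partial>M)"
    and var_pos: "(\<Sum>i=1..n. \<integral>\<omega>. (\<xi> i \<omega>)\<^sup>2 \<partial>M) > 0"
  shows "(\<forall>x \<ge> 0.
     (let \<sigma> = sqrt (\<Sum>i=1..n. \<integral>\<omega>. (\<xi> i \<omega>)\<^sup>2 \<partial>M) in
      ereal (measure M {\<omega> \<in> space M. (\<Sum>i=1..n. \<xi> i \<omega>) > x * \<sigma>})
        \<le> ereal (Bn n x (\<epsilon> / \<sigma>)) * F2 x (\<epsilon> / \<sigma>)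
      \<and> ereal (Bn n x (\<epsilon> / \<sigma>)) * F2 x (\<epsilon> / \<sigma>) \<le> ereal (Bn n x (\<epsilon> / \<sigma>)))) \<and>
    mono_on {0..} R \<and>
    (\<forall>x \<alpha>. (let \<sigma> = sqrt (\<Sum>i=1..n. \<integral>\<omega>. (\<xi> i \<omega>)\<^sup>2 \<partial>M) in
           0 \<le> \<alpha> \<and> \<alpha> < 1/3 \<and> 0 \<le> x \<and> x \<le> \<alpha> * \<sigma> / \<epsilon>
           \<longrightarrow> R (x * \<epsilon> / \<sigma>) \<le> R \<alpha>)) \<and>
    ereal 27.99 * R 0.1 \<le> ereal 88.41"
proof -
  interpret bernstein_sum M \<xi> n \<epsilon>
    by (intro bernstein_sum.intro bernstein_sum_axioms.intro bernstein_rv.intro bernstein_rv_axioms.intro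
        P indep rv moments mean0 eps bern var_pos)
  have "R (x * \<epsilon> / \<sigma>) \<le> R \<alpha>" if "0 \<le> \<alpha>" "0 \<le> x" "x \<le> \<alpha> * \<sigma> / \<epsilon>" for x \<alpha>
  proof (rule mono_onD[OF R_mono])
    show "x * \<epsilon> / \<sigma> \<le> \<alpha>" using that eps \<sigma>_pos by (simp add: field_simps)
  qed (use that eps \<sigma>_pos in auto)
  moreover have "ereal 27.99 * R 0.1 \<le> ereal 88.41"
    using R_real_tenth by (simp add: R_eq)
  ultimately show ?thesis
    using tail_le_Bn_F2 R_mono unfolding Let_def \<sigma>_def r_def by auto
qed

end
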